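(* If $m,y$ are positive integers such that $y>1$ and $m>10y^2-2y+1$, then there exists a non-negative homogeneous polynomial with real coefficients in $m$ variables of degree $2y$ that is not a degree-restricted hyperzout.
   Context: $F_{m,k}$ denotes the real vector space of homogeneous polynomials (forms) of degree $k$ in $m$ real variables with real coefficients (including $0$; $F_{m,0}=\mathbb{R}$). A form is non-negative if it takes non-negative values on all of $\mathbb{R}^m$. A form $p\in F_{n,d}$ is hyperbolic with respect to $e\in\mathbb{R}^n$ if $p(e)>0$ and for every $x\in\mathbb{R}^n$ the univariate polynomial $t\mapsto p(te-x)$ has only real roots; $\mathrm{Hyp}_{n,d}(e)$ is the set of such $p$. The (closed) hyperbolicity cone $\Lambda_+(p,e)$ is the set of $x\in\mathbb{R}^n$ such that all roots of $t\mapsto p(te-x)$ are non-negative. $D_ap(x)=\frac{d}{dt}p(x+ta)|_{t=0}$. $F_{m,k}^n$ is the set of $n$-tuples of elements of $F_{m,k}$, viewed as polynomial maps $\mathbb{R}^m\to\mathbb{R}^n$. Bézoutian: for univariate polynomials $f,g$ of degree at most $d$, $B_d(f,g)$ is the $d\times d$ matrix $(c_{jl})_{0\le j,l\le d-1}$ defined by $\frac{f(t)g(s)-f(s)g(t)}{t-s}=\sum_{j,l=0}^{d-1}c_{jl}t^js^l$. For $p\in F_{n,d}$ and $u,v\in\mathbb{R}^n$, the parameterized Bézoutian is $B_{p,u,v}(x)=B_d(p_{x,u},D_vp_{x,u})$, where $p_{x,u}(t)=p(x+tu)$ and $D_vp_{x,u}(t)=D_vp(x+tu)$ are regarded as univariate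 polynomials in $t$. For $\mu\le d$, let $T_{\mu,k}^{m,d}=\{0\}^{d-\mu}\times F_{m,0}\times F_{m,k}\times F_{m,2k}\times\cdots\times F_{m,(\mu-1)k}$, whose elements are viewed as column vectors of length $d$ (indexed $0,\dots,d-1$) of forms. A form $q\in F_{m,2y}$ is a degree-restricted hyperzout if there exist positive integers $\mu,k,n,d$ with $\mu\le d$, $y=(\mu-1)k$, and either $\mu=2$ or $d\le 2\mu-3$, together with a vector $e\in\mathbb{R}^n$, a hyperbolic polynomial $p\in\mathrm{Hyp}_{n,d}(e)$, points $u,v\in\Lambda_+(p,e)$, and maps $\phi\in F_{m,k}^n$ and $\xi\in T_{\mu,k}^{m,d}$ such that $q(x)=\xi(x)^\intercal B_{p,u,v}(\phi(x))\,\xi(x)$. *)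

theory Defs
  imports "HOL-Analysis.Derivative" "HOL-Computational_Algebra.Polynomial" "HOL-Library.Poly_Mapping"
    "Jordan_Normal_Form.Matrix"
begin

unbundle no vec_syntax and no inner_syntax

text \<open>
  The number of variables of a form is existentially quantified below, so points of $R^n$ are
  elements of \<^term>\<open>carrier_vec n\<close> and polynomials are finitely supported maps from monomials
  (themselves finitely supported exponent maps) to coefficients.  All indices start at 0.
\<close>

type_synonym mpoly = "(nat \<Rightarrow>\<^sub>0 nat) \<Rightarrow>\<^sub>0 real"

definition mpeval :: "mpoly \<Rightarrow> real vec \<Rightarrow> real" where
  "mpeval p x = (\<Sum>mon\<in>Poly_Mapping.keys p.
     Poly_Mapping.lookup p mon * (\<Prod>i\<in>Poly_Mapping.keys mon. x $ i ^ Poly_Mapping.lookup mon i))"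

definition forms :: "nat \<Rightarrow> nat \<Rightarrow> mpoly set" where
  "forms m k = {p. \<forall>mon\<in>Poly_Mapping.keys p.
     Poly_Mapping.keys mon \<subseteq> {..<m} \<and> (\<Sum>i\<in>Poly_Mapping.keys mon. Poly_Mapping.lookup mon i) = k}"

definition nonneg_form :: "nat \<Rightarrow> mpoly \<Rightarrow> bool" where
  "nonneg_form m q \<longleftrightarrow> (\<forall>x\<in>carrier_vec m. mpeval q x \<ge> 0)"

text \<open>
  $t \mapsto f(x + tu)$ as a univariate polynomial, for a polynomial function $f$.  Over the reals
  a polynomial is determined by its values; existence for the functions used below is shown in
  \<open>poly_line_poly_mpeval\<close> and \<open>poly_line_poly_dir_deriv\<close>.
\<close>

definition line_poly :: "(real vec \<Rightarrow> real) \<Rightarrow> real vec \<Rightarrow> real vec \<Rightarrow> real poly" where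
  "line_poly f x u = (THE r. \<forall>t. poly r t = f (x + t \<cdot>\<^sub>v u))"

definition dir_deriv :: "real vec \<Rightarrow> (real vec \<Rightarrow> real) \<Rightarrow> real vec \<Rightarrow> real" where
  "dir_deriv a f x = deriv (\<lambda>t. f (x + t \<cdot>\<^sub>v a)) 0"

definition Hyp :: "nat \<Rightarrow> nat \<Rightarrow> real vec \<Rightarrow> mpoly set" where
  "Hyp n d e = {p \<in> forms n d. mpeval p e > 0 \<and>
     (\<forall>x\<in>carrier_vec n. \<forall>z::complex.
        poly (map_poly complex_of_real (line_poly (mpeval p) (- x) e)) z = 0 \<longrightarrow> z \<in> \<real>)}"

text \<open>
  For $p$ hyperbolic with respect to $e$ all complex roots are real, so it suffices to look at
  the real ones.
\<close>

definition hyp_cone :: "nat \<Rightarrow> mpoly \<Rightarrow> real vec \<Rightarrow> real vec set" where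
  "hyp_cone n p e =
     {x \<in> carrier_vec n. \<forall>t::real. poly (line_poly (mpeval p) (- x) e) t = 0 \<longrightarrow> t \<ge> 0}"

text \<open>Well-defined whenever both degrees are at most $d$; see \<open>ex1_bezoutian\<close>.\<close>

definition bezoutian :: "nat \<Rightarrow> real poly \<Rightarrow> real poly \<Rightarrow> real mat" where
  "bezoutian d f g = (THE C. C \<in> carrier_mat d d \<and>
     (\<forall>t s. t \<noteq> s \<longrightarrow>
        (poly f t * poly g s - poly f s * poly g t) / (t - s)
          = (\<Sum>j<d. \<Sum>l<d. C $$ (j, l) * t ^ j * s ^ l)))"

definition par_bezoutian :: "nat \<Rightarrow> mpoly \<Rightarrow> real vec \<Rightarrow> real vec \<Rightarrow> real vec \<Rightarrow> real mat" where
  "par_bezoutian d p u v x =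
     bezoutian d (line_poly (mpeval p) x u) (line_poly (dir_deriv v (mpeval p)) x u)"

definition form_tuples :: "nat \<Rightarrow> nat \<Rightarrow> nat \<Rightarrow> mpoly vec set" where
  "form_tuples n m k = {\<phi> \<in> carrier_vec n. \<forall>i<n. \<phi> $ i \<in> forms m k}"

definition T_space :: "nat \<Rightarrow> nat \<Rightarrow> nat \<Rightarrow> nat \<Rightarrow> mpoly vec set" where
  "T_space m d \<mu> k = {\<xi> \<in> carrier_vec d.
     (\<forall>j<d - \<mu>. \<xi> $ j = 0) \<and> (\<forall>i<\<mu>. \<xi> $ (d - \<mu> + i) \<in> forms m (i * k))}"

definition mpeval_tuple :: "mpoly vec \<Rightarrow> real vec \<Rightarrow> real vec" where
  "mpeval_tuple \<phi> x = map_vec (\<lambda>f. mpeval f x) \<phi>"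

text \<open>The inequality $d \le 2\mu - 3$ is written without (truncating) subtraction.\<close>

definition degree_restricted_hyperzout :: "nat \<Rightarrow> nat \<Rightarrow> mpoly \<Rightarrow> bool" where
  "degree_restricted_hyperzout m y q \<longleftrightarrow> q \<in> forms m (2 * y) \<and>
     (\<exists>\<mu> k n d. \<mu> > 0 \<and> k > 0 \<and> n > 0 \<and> d > 0 \<and> \<mu> \<le> d \<and> y = (\<mu> - 1) * k \<and>
        (\<mu> = 2 \<or> d + 3 \<le> 2 * \<mu>) \<and>
        (\<exists>e\<in>carrier_vec n. \<exists>p\<in>Hyp n d e. \<exists>u\<in>hyp_cone n p e. \<exists>v\<in>hyp_cone n p e.
         \<exists>\<phi>\<in>form_tuples n m k. \<exists>\<xi>\<in>T_space m d \<mu> k.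
           \<forall>x\<in>carrier_vec m.
             mpeval q x = mpeval_tuple \<xi> x \<bullet>
               (par_bezoutian d p u v (mpeval_tuple \<phi> x) *\<^sub>v mpeval_tuple \<xi> x)))"


subsection \<open>Well-definedness\<close>

lemma line_poly_eqI:
  assumes "\<And>t. poly r t = f (x + t \<cdot>\<^sub>v u)"
  shows "line_poly f x u = r"
  unfolding line_poly_def
proof (rule the_equality)
  fix r' assume "\<forall>t. poly r' t = f (x + t \<cdot>\<^sub>v u)"
  then have "poly r' = poly r" using assms by auto
  then show "r' = r" by (simp add: poly_eq_poly_eq_iff)
qed (use assms in simp)

lemma ex_line_poly_mpeval:
  assumes "p \<in> forms n d" "x \<in> carrier_vec n" "u \<in> carrier_vec n"
  shows "\<exists>r. degree r \<le> d \<and> (\<forall>t. poly r t = mpeval p (x + t \<cdot>\<^sub>v u))"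
proof -
  define r where "r = (\<Sum>mon\<in>Poly_Mapping.keys p. [:Poly_Mapping.lookup p mon:] * (\<Prod>i\<in>Poly_Mapping.keys mon. [:x $ i, u $ i:] ^ Poly_Mapping.lookup mon i))"
  have "poly r t = mpeval p (x + t \<cdot>\<^sub>v u)" for t
    unfolding r_def mpeval_def poly_sum poly_mult poly_prod poly_power
  proof (intro sum.cong refl arg_cong2[of _ _ _ _ "(*)"] prod.cong)
    fix mon i assume "mon \<in> Poly_Mapping.keys p" "i \<in> Poly_Mapping.keys mon"
    then have "i < n" using assms(1) by (auto simp: forms_def)
    then show "poly [:x $ i, u $ i:] t ^ Poly_Mapping.lookup mon i = (x + t \<cdot>\<^sub>v u) $ i ^ Poly_Mapping.lookup mon i"
      using assms by simp
  qed simp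
  moreover have "degree r \<le> d"
    unfolding r_def
  proof (rule degree_sum_le)
    fix mon assume mon: "mon \<in> Poly_Mapping.keys p"
    have "degree (\<Prod>i\<in>Poly_Mapping.keys mon. [:x $ i, u $ i:] ^ Poly_Mapping.lookup mon i)
        \<le> (\<Sum>i\<in>Poly_Mapping.keys mon. degree ([:x $ i, u $ i:] ^ Poly_Mapping.lookup mon i))"
      using degree_prod_sum_le[of "Poly_Mapping.keys mon" "\<lambda>i. [:x $ i, u $ i:] ^ Poly_Mapping.lookup mon i"] by (simp add: o_def)
    also have "\<dots> \<le> (\<Sum>i\<in>Poly_Mapping.keys mon. Poly_Mapping.lookup mon i)"
    proof (rule sum_mono)
      fix i
      have "degree ([:x $ i, u $ i:] ^ Poly_Mapping.lookup mon i) \<le> degree [:x $ i, u $ i:] * Poly_Mapping.lookup mon i"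
        by (rule degree_power_le)
      also have "\<dots> \<le> 1 * Poly_Mapping.lookup mon i" by (intro mult_right_mono) auto
      finally show "degree ([:x $ i, u $ i:] ^ Poly_Mapping.lookup mon i) \<le> Poly_Mapping.lookup mon i" by simp
    qed
    also have "\<dots> = d" using mon assms(1) by (auto simp: forms_def)
    finally show "degree ([:Poly_Mapping.lookup p mon:] * (\<Prod>i\<in>Poly_Mapping.keys mon. [:x $ i, u $ i:] ^ Poly_Mapping.lookup mon i)) \<le> d"
      using degree_mult_le[of "[:Poly_Mapping.lookup p mon:]" "\<Prod>i\<in>Poly_Mapping.keys mon. [:x $ i, u $ i:] ^ Poly_Mapping.lookup mon i"] by simp
  qed simp
  ultimately show ?thesis by blast
qed

lemma
  assumes "p \<in> forms n d" "x \<in> carrier_vec n" "u \<in> carrier_vec n"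
  shows poly_line_poly_mpeval: "poly (line_poly (mpeval p) x u) t = mpeval p (x + t \<cdot>\<^sub>v u)"
    and degree_line_poly_mpeval: "degree (line_poly (mpeval p) x u) \<le> d"
proof -
  obtain r where r: "degree r \<le> d" "\<And>t. poly r t = mpeval p (x + t \<cdot>\<^sub>v u)"
    using ex_line_poly_mpeval[OF assms] by blast
  have "line_poly (mpeval p) x u = r" using r(2) by (rule line_poly_eqI)
  then show "poly (line_poly (mpeval p) x u) t = mpeval p (x + t \<cdot>\<^sub>v u)"
    "degree (line_poly (mpeval p) x u) \<le> d" using r by auto
qed

lemma dir_deriv_mpeval:
  assumes "p \<in> forms n d" "x \<in> carrier_vec n" "a \<in> carrier_vec n"
  shows "((\<lambda>t. mpeval p (x + t \<cdot>\<^sub>v a)) has_real_derivative dir_deriv a (mpeval p) x) (at 0)"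
    and "dir_deriv a (mpeval p) x =
      (\<Sum>mon\<in>Poly_Mapping.keys p. Poly_Mapping.lookup p mon * (\<Sum>i\<in>Poly_Mapping.keys mon. of_nat (Poly_Mapping.lookup mon i) * x $ i ^ (Poly_Mapping.lookup mon i - 1) * a $ i
         * (\<Prod>j\<in>Poly_Mapping.keys mon - {i}. x $ j ^ Poly_Mapping.lookup mon j)))" (is "_ = ?D")
proof -
  have eq: "mpeval p (x + t \<cdot>\<^sub>v a) =
      (\<Sum>mon\<in>Poly_Mapping.keys p. Poly_Mapping.lookup p mon * (\<Prod>i\<in>Poly_Mapping.keys mon. (x $ i + t * a $ i) ^ Poly_Mapping.lookup mon i))" for t
    unfolding mpeval_def
  proof (intro sum.cong refl arg_cong2[of _ _ _ _ "(*)"] prod.cong)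
    fix mon i assume "mon \<in> Poly_Mapping.keys p" "i \<in> Poly_Mapping.keys mon"
    then have "i < n" using assms(1) by (auto simp: forms_def)
    then show "(x + t \<cdot>\<^sub>v a) $ i ^ Poly_Mapping.lookup mon i = (x $ i + t * a $ i) ^ Poly_Mapping.lookup mon i"
      using assms by simp
  qed
  have 1: "((\<lambda>t. (x $ i + t * a $ i) ^ k) has_real_derivative
      of_nat k * x $ i ^ (k - 1) * a $ i) (at 0)" for i k
    by (auto intro!: derivative_eq_intros)
  have 2: "((\<lambda>t. \<Prod>i\<in>Poly_Mapping.keys mon. (x $ i + t * a $ i) ^ Poly_Mapping.lookup mon i) has_real_derivative
     (\<Sum>i\<in>Poly_Mapping.keys mon. of_nat (Poly_Mapping.lookup mon i) * x $ i ^ (Poly_Mapping.lookup mon i - 1) * a $ i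
         * (\<Prod>j\<in>Poly_Mapping.keys mon - {i}. x $ j ^ Poly_Mapping.lookup mon j))) (at 0)" for mon :: "nat \<Rightarrow>\<^sub>0 nat"
    using has_field_derivative_prod[of "Poly_Mapping.keys mon" "\<lambda>i t. (x $ i + t * a $ i) ^ Poly_Mapping.lookup mon i", OF 1]
    by simp
  have 3: "((\<lambda>t. mpeval p (x + t \<cdot>\<^sub>v a)) has_real_derivative ?D) (at 0)"
    unfolding eq by (intro DERIV_sum DERIV_cmult 2)
  then show *: "dir_deriv a (mpeval p) x = ?D"
    unfolding dir_deriv_def by (rule DERIV_imp_deriv)
  show "((\<lambda>t. mpeval p (x + t \<cdot>\<^sub>v a)) has_real_derivative dir_deriv a (mpeval p) x) (at 0)"
    using 3 unfolding * .
qed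

lemma ex_line_poly_dir_deriv:
  assumes "p \<in> forms n d" "x \<in> carrier_vec n" "u \<in> carrier_vec n" "v \<in> carrier_vec n"
  shows "\<exists>r. degree r \<le> d \<and> (\<forall>t. poly r t = dir_deriv v (mpeval p) (x + t \<cdot>\<^sub>v u))"
proof -
  define L where "L = (\<lambda>i. [:x $ i, u $ i:])"
  define R where "R = (\<lambda>mon i. [:of_nat (Poly_Mapping.lookup mon i) * v $ i:] * L i ^ (Poly_Mapping.lookup mon i - 1)
         * (\<Prod>j\<in>Poly_Mapping.keys mon - {i}. L j ^ Poly_Mapping.lookup mon j))"
  define r where "r = (\<Sum>mon\<in>Poly_Mapping.keys p. [:Poly_Mapping.lookup p mon:] * (\<Sum>i\<in>Poly_Mapping.keys mon. R mon i))"
  have L: "poly (L i) t = (x + t \<cdot>\<^sub>v u) $ i" if "mon \<in> Poly_Mapping.keys p" "i \<in> Poly_Mapping.keys mon" for mon i t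
  proof -
    have "i < n" using that assms(1) by (auto simp: forms_def)
    then show ?thesis using assms by (simp add: L_def)
  qed
  have "poly r t = dir_deriv v (mpeval p) (x + t \<cdot>\<^sub>v u)" for t
  proof -
    have c: "x + t \<cdot>\<^sub>v u \<in> carrier_vec n" using assms by simp
    have "poly (R mon i) t = of_nat (Poly_Mapping.lookup mon i) * (x + t \<cdot>\<^sub>v u) $ i ^ (Poly_Mapping.lookup mon i - 1) * v $ i
         * (\<Prod>j\<in>Poly_Mapping.keys mon - {i}. (x + t \<cdot>\<^sub>v u) $ j ^ Poly_Mapping.lookup mon j)"
      if m: "mon \<in> Poly_Mapping.keys p" "i \<in> Poly_Mapping.keys mon" for mon i
    proof -
      have "(\<Prod>j\<in>Poly_Mapping.keys mon - {i}. poly (L j) t ^ Poly_Mapping.lookup mon j)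
          = (\<Prod>j\<in>Poly_Mapping.keys mon - {i}. (x + t \<cdot>\<^sub>v u) $ j ^ Poly_Mapping.lookup mon j)"
        by (intro prod.cong refl) (use L m in auto)
      then show ?thesis using L[OF m, of t]
        by (simp add: R_def poly_prod poly_power ac_simps)
    qed
    then show ?thesis
      unfolding dir_deriv_mpeval(2)[OF assms(1) c assms(4)]
      unfolding r_def poly_sum poly_mult
      by (intro sum.cong refl arg_cong2[of _ _ _ _ "(*)"]) auto
  qed
  moreover have "degree r \<le> d"
    unfolding r_def
  proof (rule degree_sum_le)
    fix mon assume mon: "mon \<in> Poly_Mapping.keys p"
    have pw: "degree (L i ^ k) \<le> k" for i k
    proof -
      have "degree (L i ^ k) \<le> degree (L i) * k"
        by (rule degree_power_le)
      also have "\<dots> \<le> 1 * k" by (intro mult_right_mono) (auto simp: L_def)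
      finally show ?thesis by simp
    qed
    have "degree (\<Sum>i\<in>Poly_Mapping.keys mon. R mon i) \<le> d"
    proof (rule degree_sum_le)
      fix i assume i: "i \<in> Poly_Mapping.keys mon"
      have "degree (\<Prod>j\<in>Poly_Mapping.keys mon - {i}. L j ^ Poly_Mapping.lookup mon j)
        \<le> (\<Sum>j\<in>Poly_Mapping.keys mon - {i}. degree (L j ^ Poly_Mapping.lookup mon j))"
        using degree_prod_sum_le[of "Poly_Mapping.keys mon - {i}" "\<lambda>i. L i ^ Poly_Mapping.lookup mon i"] by (simp add: o_def)
      also have "\<dots> \<le> (\<Sum>j\<in>Poly_Mapping.keys mon - {i}. Poly_Mapping.lookup mon j)" by (intro sum_mono pw)
      finally have A: "degree (\<Prod>j\<in>Poly_Mapping.keys mon - {i}. L j ^ Poly_Mapping.lookup mon j) \<le> (\<Sum>j\<in>Poly_Mapping.keys mon - {i}. Poly_Mapping.lookup mon j)" .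
      have "degree ([:of_nat (Poly_Mapping.lookup mon i) * v $ i:] * L i ^ (Poly_Mapping.lookup mon i - 1)) \<le> 0 + degree (L i ^ (Poly_Mapping.lookup mon i - 1))"
        using degree_mult_le[of "[:of_nat (Poly_Mapping.lookup mon i) * v $ i:]" "L i ^ (Poly_Mapping.lookup mon i - 1)"] by simp
      also have "\<dots> \<le> Poly_Mapping.lookup mon i" using pw[of i "Poly_Mapping.lookup mon i - 1"] by linarith
      finally have "degree (R mon i) \<le> Poly_Mapping.lookup mon i + (\<Sum>j\<in>Poly_Mapping.keys mon - {i}. Poly_Mapping.lookup mon j)"
        unfolding R_def by (rule order_trans[OF degree_mult_le add_mono[OF _ A]])
      also have "\<dots> = d" using i mon assms(1) by (auto simp: forms_def sum.remove)
      finally show "degree (R mon i) \<le> d" .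
    qed simp
    then show "degree ([:Poly_Mapping.lookup p mon:] * (\<Sum>i\<in>Poly_Mapping.keys mon. R mon i)) \<le> d"
      using degree_mult_le[of "[:Poly_Mapping.lookup p mon:]" "\<Sum>i\<in>Poly_Mapping.keys mon. R mon i"] by simp
  qed simp
  ultimately show ?thesis by blast
qed

lemma
  assumes "p \<in> forms n d" "x \<in> carrier_vec n" "u \<in> carrier_vec n" "v \<in> carrier_vec n"
  shows poly_line_poly_dir_deriv:
      "poly (line_poly (dir_deriv v (mpeval p)) x u) t = dir_deriv v (mpeval p) (x + t \<cdot>\<^sub>v u)"
    and degree_line_poly_dir_deriv: "degree (line_poly (dir_deriv v (mpeval p)) x u) \<le> d"
proof -
  obtain r where r: "degree r \<le> d" "\<And>t. poly r t = dir_deriv v (mpeval p) (x + t \<cdot>\<^sub>v u)"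
    using ex_line_poly_dir_deriv[OF assms] by blast
  have "line_poly (dir_deriv v (mpeval p)) x u = r" using r(2) by (rule line_poly_eqI)
  then show "poly (line_poly (dir_deriv v (mpeval p)) x u) t = dir_deriv v (mpeval p) (x + t \<cdot>\<^sub>v u)"
    "degree (line_poly (dir_deriv v (mpeval p)) x u) \<le> d" using r by auto
qed

lemma ex_divided_difference:
  fixes d :: nat
  defines "E \<equiv> \<lambda>F :: real \<Rightarrow> real \<Rightarrow> real. \<exists>c. \<forall>t s. F t s = (t - s) * (\<Sum>j<d. \<Sum>l<d. c j l * t ^ j * s ^ l :: real)"
  assumes "degree f \<le> d" "degree g \<le> d"
  shows "E (\<lambda>t s. poly f t * poly g s - poly f s * poly g t)"
proof -
  have zero: "E (\<lambda>t s. 0)" unfolding E_def by (rule exI[of _ "\<lambda>_ _. 0"]) simp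
  have add: "E (\<lambda>t s. F t s + G t s)" if "E F" "E G" for F G
  proof -
    from that obtain a b where "\<And>t s. F t s = (t - s) * (\<Sum>j<d. \<Sum>l<d. a j l * t ^ j * s ^ l)"
      "\<And>t s. G t s = (t - s) * (\<Sum>j<d. \<Sum>l<d. b j l * t ^ j * s ^ l)" unfolding E_def by blast
    then show ?thesis unfolding E_def
      by (intro exI[of _ "\<lambda>j l. a j l + b j l"]) (simp add: sum.distrib distrib_left distrib_right)
  qed
  have cmult: "E (\<lambda>t s. c * F t s)" if "E F" for F c
  proof -
    from that obtain a where "\<And>t s. F t s = (t - s) * (\<Sum>j<d. \<Sum>l<d. a j l * t ^ j * s ^ l)"
      unfolding E_def by blast
    then show ?thesis unfolding E_def
      by (intro exI[of _ "\<lambda>j l. c * a j l"]) (simp add: sum_distrib_left algebra_simps)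
  qed
  have sum: "E (\<lambda>t s. \<Sum>i\<in>A. F i t s)" if "finite A" "\<And>i. i \<in> A \<Longrightarrow> E (F i)" for A :: "nat set" and F
    using that by (induction A rule: finite_induct) (auto intro: zero add)
  have single: "E (\<lambda>t s. (t - s) * (t ^ j * s ^ l))" if "j < d" "l < d" for j l
    unfolding E_def
  proof (intro exI[of _ "\<lambda>j' l'. if j' = j then if l' = l then 1 else 0 else 0"] allI)
    fix t s :: real
    have "(\<Sum>j'<d. \<Sum>l'<d. (if j' = j then if l' = l then 1 else 0 else 0) * t ^ j' * s ^ l')
       = (\<Sum>j'<d. if j' = j then t ^ j * s ^ l else 0)"
    proof (rule sum.cong[OF refl])
      fix j'
      have "(\<Sum>l'<d. (if j' = j then if l' = l then 1 else 0 else 0) * t ^ j' * s ^ l')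
        = (\<Sum>l'<d. if l' = l then (if j' = j then t ^ j * s ^ l else 0) else 0)"
        by (rule sum.cong) auto
      also have "\<dots> = (if j' = j then t ^ j * s ^ l else 0)" using that by (subst sum.delta) auto
      finally show "(\<Sum>l'<d. (if j' = j then if l' = l then 1 else 0 else 0) * t ^ j' * s ^ l')
        = (if j' = j then t ^ j * s ^ l else 0)" .
    qed
    also have "\<dots> = t ^ j * s ^ l" using that by (subst sum.delta) auto
    finally show "(t - s) * (t ^ j * s ^ l) = (t - s) *
      (\<Sum>j'<d. \<Sum>l'<d. (if j' = j then if l' = l then 1 else 0 else 0) * t ^ j' * s ^ l')" by simp
  qed
  have ge: "E (\<lambda>t s. t ^ a * s ^ b - s ^ a * t ^ b)" if "b \<le> a" "a \<le> d" for a b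
  proof -
    have "t ^ a * s ^ b - s ^ a * t ^ b
        = (\<Sum>i<a - b. (t - s) * (t ^ (b + i) * s ^ (b + (a - b - Suc i))))" for t s :: real
    proof -
      have "t ^ a * s ^ b - s ^ a * t ^ b = (t ^ b * s ^ b) * (t ^ (a - b) - s ^ (a - b))"
        using that by (simp add: algebra_simps flip: power_add)
      also have "\<dots> = (t ^ b * s ^ b) * ((t - s) * (\<Sum>i<a - b. t ^ i * s ^ (a - b - Suc i)))"
        by (subst power_diff_sumr2) (simp add: ac_simps)
      also have "\<dots> = (\<Sum>i<a - b. (t - s) * (t ^ (b + i) * s ^ (b + (a - b - Suc i))))"
        unfolding sum_distrib_left power_add by (intro sum.cong refl) (simp only: ac_simps)
      finally show ?thesis .
    qed
    moreover have "E (\<lambda>t s. \<Sum>i<a - b. (t - s) * (t ^ (b + i) * s ^ (b + (a - b - Suc i))))"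
      using that by (intro sum single) auto
    ultimately show ?thesis by simp
  qed
  have mon: "E (\<lambda>t s. t ^ a * s ^ b - s ^ a * t ^ b)" if "a \<le> d" "b \<le> d" for a b
  proof (cases "b \<le> a")
    case False
    then have "E (\<lambda>t s. (-1) * (t ^ b * s ^ a - s ^ b * t ^ a))" using that by (intro cmult ge) auto
    then show ?thesis by (simp add: algebra_simps)
  qed (use ge that in auto)
  have ev: "poly h t = (\<Sum>i\<le>d. coeff h i * t ^ i)" if "degree h \<le> d" for h :: "real poly" and t
    using arg_cong[OF poly_as_sum_of_monoms'[OF that], of "\<lambda>h. poly h t"]
    by (simp add: poly_sum poly_monom)
  have "poly f t * poly g s - poly f s * poly g t =
     (\<Sum>a\<le>d. \<Sum>b\<le>d. (coeff f a * coeff g b) * (t ^ a * s ^ b - s ^ a * t ^ b))" for t s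
    unfolding ev[OF assms(2)] ev[OF assms(3)]
    by (simp add: sum_product right_diff_distrib sum_subtractf ac_simps)
  moreover have "E (\<lambda>t s. \<Sum>a\<le>d. \<Sum>b\<le>d. (coeff f a * coeff g b) * (t ^ a * s ^ b - s ^ a * t ^ b))"
    by (intro sum cmult mon) auto
  ultimately show ?thesis by simp
qed

lemma bivariate_coeffs_unique:
  fixes a b :: "nat \<Rightarrow> nat \<Rightarrow> real"
  assumes eq: "\<And>t s. t \<noteq> s \<Longrightarrow>
      (\<Sum>j<d. \<Sum>l<d. a j l * t ^ j * s ^ l) = (\<Sum>j<d. \<Sum>l<d. b j l * t ^ j * s ^ l)"
    and jl: "j < d" "l < d"
  shows "a j l = b j l"
proof -
  define P where "P = (\<lambda>j. \<Sum>l<d. monom (a j l - b j l) l)"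
  have P0: "poly (P j) s = 0" for s
  proof -
    define Q where "Q = (\<Sum>j<d. monom (poly (P j) s) j)"
    have "poly Q t = 0" if "t \<noteq> s" for t
    proof -
      have "poly Q t = (\<Sum>j<d. \<Sum>l<d. (a j l * t ^ j * s ^ l - b j l * t ^ j * s ^ l))"
        by (simp add: Q_def P_def poly_sum poly_monom sum_distrib_left sum_distrib_right algebra_simps)
      also have "\<dots> = 0" using eq[OF that] by (simp add: sum_subtractf)
      finally show ?thesis .
    qed
    then have "- {s} \<subseteq> {t. poly Q t = 0}" by auto
    moreover have "infinite (- {s})" by (simp add: finite_compl infinite_UNIV_char_0)
    ultimately have "infinite {t. poly Q t = 0}" using finite_subset by blast
    then have "Q = 0" using poly_roots_finite by blast
    then have "coeff Q j = 0" by simp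
    then show ?thesis using jl by (simp add: Q_def coeff_sum)
  qed
  then have "P j = 0" using poly_all_0_iff_0 by blast
  then have "coeff (P j) l = 0" by simp
  then show ?thesis using jl by (simp add: P_def coeff_sum)
qed

lemma ex1_bezoutian:
  fixes f g :: "real poly"
  assumes "degree f \<le> d" "degree g \<le> d"
  shows "\<exists>!C. C \<in> carrier_mat d d \<and>
     (\<forall>t s. t \<noteq> s \<longrightarrow>
        (poly f t * poly g s - poly f s * poly g t) / (t - s)
          = (\<Sum>j<d. \<Sum>l<d. C $$ (j, l) * t ^ j * s ^ l))"
proof -
  obtain c :: "nat \<Rightarrow> nat \<Rightarrow> real" where c: "\<And>t s. poly f t * poly g s - poly f s * poly g t
      = (t - s) * (\<Sum>j<d. \<Sum>l<d. c j l * t ^ j * s ^ l)"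
    using ex_divided_difference[OF assms] by blast
  show ?thesis
  proof (rule ex1I[of _ "mat d d (\<lambda>(j, l). c j l)"], intro conjI allI impI)
    fix t s :: real assume "t \<noteq> s"
    then show "(poly f t * poly g s - poly f s * poly g t) / (t - s)
          = (\<Sum>j<d. \<Sum>l<d. mat d d (\<lambda>(j, l). c j l) $$ (j, l) * t ^ j * s ^ l)"
      by (simp add: c)
  next
    fix C assume C: "C \<in> carrier_mat d d \<and> (\<forall>t s. t \<noteq> s \<longrightarrow>
        (poly f t * poly g s - poly f s * poly g t) / (t - s)
          = (\<Sum>j<d. \<Sum>l<d. C $$ (j, l) * t ^ j * s ^ l))"
    have "(\<Sum>j<d. \<Sum>l<d. C $$ (j, l) * t ^ j * s ^ l) = (\<Sum>j<d. \<Sum>l<d. c j l * t ^ j * s ^ l)"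
      if "t \<noteq> s" for t s
    proof -
      have "(\<Sum>j<d. \<Sum>l<d. C $$ (j, l) * t ^ j * s ^ l) = (poly f t * poly g s - poly f s * poly g t) / (t - s)"
        using C that by simp
      also have "\<dots> = (\<Sum>j<d. \<Sum>l<d. c j l * t ^ j * s ^ l)" using that by (simp add: c)
      finally show ?thesis .
    qed
    then have "C $$ (j, l) = c j l" if "j < d" "l < d" for j l
      using bivariate_coeffs_unique[where d = d and a = "\<lambda>j l. C $$ (j, l)" and b = c] that by blast
    then show "C = mat d d (\<lambda>(j, l). c j l)" using C by (intro eq_matI) auto
  qed simp
qed

end

theory Submission
  imports Defs "HOL-Computational_Algebra.Fundamental_Theorem_Algebra" "HOL-Analysis.Connected"
begin

text \<open>
  Sketch of the proof.  Write $q = \xi^\intercal B_{p,u,v}(\phi)\,\xi$ for a degree-restricted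
  hyperzout of size $\mu$ in degree $2y$.  Since $y = (\mu - 1)k > 0$, either $\mu = 2$ or
  $\mu \ge 3$ and $d \le 2\mu - 3$.  The two cases fail to exhaust the non-negative forms for
  different reasons.

  If $d \le 2\mu - 3$, there are too few parameters.  The coefficients of $t^i$ in
  $p(\phi(x) + tu)$ and in $D_vp(\phi(x) + tu)$ are forms in $x$ of degree at most
  $kd \le 2y - k < 2y$, and so are the entries of $\xi$ (\<open>par_bezoutian_forms\<close>).  Hence $q$ is
  a quartic polynomial in the coefficients of at most $5y$ forms of degree at most $2y - 1$, a
  number of parameters that depends on neither $n$ nor $p$ (\<open>hyperzout_in_generic_family\<close>).
  The hypothesis on $m$ says exactly that $5y \dim F_{m,2y-1} < \dim F_{m,2y}$
  (\<open>card_monomials_gap\<close>), and finitely many polynomial maps from a space of smaller dimension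
  cannot cover a box (\<open>polynomial_maps_miss_point\<close>).

  If $\mu = 2$, the parameter count says nothing, but the sign does.  Bezoutians of hyperbolic
  polynomials are positive semidefinite (\<open>par_bezoutian_psd\<close>), and the relevant $2 \times 2$
  block has entries of degree $2, 1, 0$ in $\phi$.  So $q$ is a positive semidefinite quadratic
  form in the components of $\phi$ and one entry of $\xi$, which are forms of degree $y$; in
  effect $q$ is a sum of squares.  The values of a form of degree $y$ at the vertices of a cube
  of dimension $y + 1$ satisfy a linear relation, so $q$ cannot be large at one vertex and small
  at all others (\<open>hyperzout_size_two_bound\<close>).

  It remains to find a box of non-negative forms that violate this inequality.  Such a box lies
  around the Choi-Lam quartic, written in coordinates in which its zeros are vertices of a
  three-dimensional cube and multiplied by squares of further variables
  (\<open>separating_form\<close>, \<open>separating_family\<close>).  A form in the box that the polynomial maps of the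
  first case miss is neither kind of hyperzout.
\<close>


section \<open>Evaluation of polynomials in commutative rings\<close>

definition monomials :: "nat \<Rightarrow> nat \<Rightarrow> (nat \<Rightarrow>\<^sub>0 nat) set" where
  "monomials m k = {\<alpha>. Poly_Mapping.keys \<alpha> \<subseteq> {..<m} \<and>
     (\<Sum>i\<in>Poly_Mapping.keys \<alpha>. Poly_Mapping.lookup \<alpha> i) = k}"

text \<open>
  Polynomials are evaluated at real and complex points, at lines (univariate polynomials), at planes
  (polynomials over polynomials) and at tuples of forms.  Evaluation therefore takes values in an
  arbitrary commutative ring, with a map $h$ that embeds the coefficients.
\<close>

definition mon_eval :: "(nat \<Rightarrow> 'a::comm_ring_1) \<Rightarrow> (nat \<Rightarrow>\<^sub>0 nat) \<Rightarrow> 'a" where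
  "mon_eval \<sigma> \<alpha> = (\<Prod>i\<in>Poly_Mapping.keys \<alpha>. \<sigma> i ^ Poly_Mapping.lookup \<alpha> i)"

definition subst :: "(real \<Rightarrow> 'a::comm_ring_1) \<Rightarrow> (nat \<Rightarrow> 'a) \<Rightarrow> mpoly \<Rightarrow> 'a" where
  "subst h \<sigma> p = (\<Sum>\<alpha>\<in>Poly_Mapping.keys p. h (Poly_Mapping.lookup p \<alpha>) * mon_eval \<sigma> \<alpha>)"

definition mvar :: "nat \<Rightarrow> mpoly" where
  "mvar i = Poly_Mapping.single (Poly_Mapping.single i 1) 1"

definition mconst :: "real \<Rightarrow> mpoly" where
  "mconst c = Poly_Mapping.single 0 c"

lemma mpeval_eq_subst: "mpeval p x = subst (\<lambda>c. c) (($) x) p"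
  by (simp add: mpeval_def subst_def mon_eval_def)

lemma forms_iff: "p \<in> forms m k \<longleftrightarrow> Poly_Mapping.keys p \<subseteq> monomials m k"
  by (auto simp: forms_def monomials_def)

lemma mon_eval_superset:
  assumes "finite A" "Poly_Mapping.keys \<alpha> \<subseteq> A"
  shows "mon_eval \<sigma> \<alpha> = (\<Prod>i\<in>A. \<sigma> i ^ Poly_Mapping.lookup \<alpha> i)"
  unfolding mon_eval_def
  by (rule prod.mono_neutral_left) (use assms in \<open>auto simp: in_keys_iff\<close>)

lemma mon_eval_add: "mon_eval \<sigma> (a + b) = mon_eval \<sigma> a * mon_eval \<sigma> b"
proof -
  let ?A = "Poly_Mapping.keys a \<union> Poly_Mapping.keys b"
  have "mon_eval \<sigma> (a + b) = (\<Prod>i\<in>?A. \<sigma> i ^ Poly_Mapping.lookup (a + b) i)"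
    by (rule mon_eval_superset) (use keys_add[of a b] in auto)
  also have "\<dots> = (\<Prod>i\<in>?A. \<sigma> i ^ Poly_Mapping.lookup a i) * (\<Prod>i\<in>?A. \<sigma> i ^ Poly_Mapping.lookup b i)"
    by (simp add: lookup_add power_add prod.distrib)
  also have "\<dots> = mon_eval \<sigma> a * mon_eval \<sigma> b"
    by (intro arg_cong2[of _ _ _ _ "(*)"] mon_eval_superset[symmetric]) auto
  finally show ?thesis .
qed

lemma subst_superset:
  assumes "h 0 = 0" "finite A" "Poly_Mapping.keys p \<subseteq> A"
  shows "subst h \<sigma> p = (\<Sum>\<alpha>\<in>A. h (Poly_Mapping.lookup p \<alpha>) * mon_eval \<sigma> \<alpha>)"
  unfolding subst_def
  by (rule sum.mono_neutral_left) (use assms in \<open>auto simp: in_keys_iff\<close>)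

text \<open>
  Reduces multiplicativity of evaluation to single terms.
\<close>

lemma mpoly_as_sum: "p = (\<Sum>k\<in>Poly_Mapping.keys p. Poly_Mapping.single k (Poly_Mapping.lookup p k))"
proof (rule poly_mapping_eqI)
  fix k
  show "Poly_Mapping.lookup p k = Poly_Mapping.lookup (\<Sum>k\<in>Poly_Mapping.keys p. Poly_Mapping.single k (Poly_Mapping.lookup p k)) k"
    by (auto simp: lookup_sum lookup_single when_def in_keys_iff sum.delta)
qed

locale real_algebra_map =
  fixes h :: "real \<Rightarrow> 'a::comm_ring_1"
  assumes h_add: "h (a + b) = h a + h b" and h_mult: "h (a * b) = h a * h b" and h_1: "h 1 = 1"
begin

lemma h_0: "h 0 = 0"
  using h_add[of 0 0] by simp

lemma subst_add: "subst h \<sigma> (p + q) = subst h \<sigma> p + subst h \<sigma> q"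
proof -
  let ?A = "Poly_Mapping.keys p \<union> Poly_Mapping.keys q"
  have "subst h \<sigma> (p + q) = (\<Sum>\<alpha>\<in>?A. h (Poly_Mapping.lookup (p + q) \<alpha>) * mon_eval \<sigma> \<alpha>)"
    by (rule subst_superset) (use h_0 keys_add[of p q] in auto)
  also have "\<dots> = (\<Sum>\<alpha>\<in>?A. h (Poly_Mapping.lookup p \<alpha>) * mon_eval \<sigma> \<alpha>)
      + (\<Sum>\<alpha>\<in>?A. h (Poly_Mapping.lookup q \<alpha>) * mon_eval \<sigma> \<alpha>)"
    by (simp add: lookup_add h_add distrib_right sum.distrib)
  also have "\<dots> = subst h \<sigma> p + subst h \<sigma> q"
    by (intro arg_cong2[of _ _ _ _ "(+)"] subst_superset[symmetric]) (auto simp: h_0)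
  finally show ?thesis .
qed

lemma subst_0: "subst h \<sigma> 0 = 0"
  by (simp add: subst_def)

lemma subst_sum: "subst h \<sigma> (\<Sum>i\<in>A. f i) = (\<Sum>i\<in>A. subst h \<sigma> (f i))"
  by (induction A rule: infinite_finite_induct) (auto simp: subst_add subst_0)

lemma subst_single: "subst h \<sigma> (Poly_Mapping.single \<alpha> c) = h c * mon_eval \<sigma> \<alpha>"
  by (cases "c = 0") (auto simp: subst_def h_0)

lemma subst_mult: "subst h \<sigma> (p * q) = subst h \<sigma> p * subst h \<sigma> q"
proof -
  have "p * q = (\<Sum>k\<in>Poly_Mapping.keys p. \<Sum>l\<in>Poly_Mapping.keys q.
      Poly_Mapping.single (k + l) (Poly_Mapping.lookup p k * Poly_Mapping.lookup q l))"
    using arg_cong2[OF mpoly_as_sum[of p] mpoly_as_sum[of q], of "(*)"]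
    by (simp only: sum_product mult_single)
  then show ?thesis
    by (simp add: subst_sum subst_single h_mult mon_eval_add sum_product subst_def[of h \<sigma> p]
        subst_def[of h \<sigma> q] ac_simps)
qed

lemma subst_mconst: "subst h \<sigma> (mconst c) = h c"
  by (simp add: mconst_def subst_single mon_eval_def)

lemma subst_1: "subst h \<sigma> 1 = 1"
  using subst_single[of \<sigma> 0 1] h_1 by (simp add: mon_eval_def)

lemma subst_mvar: "subst h \<sigma> (mvar i) = \<sigma> i"
  by (simp add: mvar_def subst_single mon_eval_def h_1)

lemma subst_power: "subst h \<sigma> (p ^ n) = subst h \<sigma> p ^ n"
  by (induction n) (simp_all add: subst_mult subst_1)

lemma subst_prod: "subst h \<sigma> (\<Prod>i\<in>A. f i) = (\<Prod>i\<in>A. subst h \<sigma> (f i))"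
  by (induction A rule: infinite_finite_induct) (auto simp: subst_mult subst_1)

lemma subst_uminus: "subst h \<sigma> (- p) = - subst h \<sigma> p"
  using subst_add[of \<sigma> p "-p"] by (simp add: eq_neg_iff_add_eq_0 add.commute subst_0)

lemma subst_diff: "subst h \<sigma> (p - q) = subst h \<sigma> p - subst h \<sigma> q"
  using subst_add[of \<sigma> p "-q"] by (simp add: subst_uminus)

end

text \<open>
  Evaluation commutes with ring homomorphisms.  Every change of viewpoint below (specialising a
  variable, passing to complex coefficients, evaluating forms at a point) is an instance.
\<close>

lemma subst_hom:
  assumes "F 0 = 0" "F 1 = 1" "\<And>a b. F (a + b) = F a + F b" "\<And>a b. F (a * b) = F a * F b"
  shows "F (subst h \<sigma> p) = subst (\<lambda>c. F (h c)) (\<lambda>i. F (\<sigma> i)) p"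
proof -
  have sum: "F (\<Sum>i\<in>A. f i) = (\<Sum>i\<in>A. F (f i))" for f and A :: "(nat \<Rightarrow>\<^sub>0 nat) set"
    by (induction A rule: infinite_finite_induct) (auto simp: assms)
  have prod: "F (\<Prod>i\<in>A. f i) = (\<Prod>i\<in>A. F (f i))" for f and A :: "nat set"
    by (induction A rule: infinite_finite_induct) (auto simp: assms)
  have pow: "F (a ^ n) = F a ^ n" for a n
    by (induction n) (auto simp: assms)
  show ?thesis
    by (simp add: subst_def mon_eval_def sum assms prod pow)
qed

lemma subst_cong:
  assumes "p \<in> forms n d" "\<And>i. i < n \<Longrightarrow> \<sigma> i = \<tau> i"
  shows "subst h \<sigma> p = subst h \<tau> p"
  unfolding subst_def mon_eval_def
proof (intro sum.cong prod.cong arg_cong2[of _ _ _ _ "(*)"] refl)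
  fix \<alpha> i assume "\<alpha> \<in> Poly_Mapping.keys p" "i \<in> Poly_Mapping.keys \<alpha>"
  then have "i < n" using assms(1) by (auto simp: forms_def)
  then show "\<sigma> i ^ Poly_Mapping.lookup \<alpha> i = \<tau> i ^ Poly_Mapping.lookup \<alpha> i"
    by (simp add: assms(2))
qed

interpretation mpeval_hom: real_algebra_map "\<lambda>c::real. c"
  by unfold_locales auto

lemmas mpeval_simps = mpeval_hom.subst_add mpeval_hom.subst_mult mpeval_hom.subst_sum
  mpeval_hom.subst_prod mpeval_hom.subst_power mpeval_hom.subst_diff mpeval_hom.subst_uminus
  mpeval_hom.subst_0 mpeval_hom.subst_1 mpeval_hom.subst_mconst mpeval_hom.subst_mvar

section \<open>Gradings\<close>

lemma sum_keys_eq: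
  fixes \<alpha> :: "nat \<Rightarrow>\<^sub>0 nat"
  shows "Poly_Mapping.keys \<alpha> \<subseteq> {..<m} \<Longrightarrow>
    (\<Sum>i\<in>Poly_Mapping.keys \<alpha>. Poly_Mapping.lookup \<alpha> i) = (\<Sum>i<m. Poly_Mapping.lookup \<alpha> i)"
  by (rule sum.mono_neutral_left) (auto simp: in_keys_iff)

lemma monomials_add:
  assumes "a \<in> monomials m k" "b \<in> monomials m l"
  shows "a + b \<in> monomials m (k + l)"
proof -
  have *: "Poly_Mapping.keys (a + b) \<subseteq> {..<m}"
    using assms keys_add[of a b] by (auto simp: monomials_def)
  have "(\<Sum>i\<in>Poly_Mapping.keys (a + b). Poly_Mapping.lookup (a + b) i) = (\<Sum>i<m. Poly_Mapping.lookup (a + b) i)"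
    by (rule sum_keys_eq[OF *])
  also have "\<dots> = (\<Sum>i<m. Poly_Mapping.lookup a i) + (\<Sum>i<m. Poly_Mapping.lookup b i)"
    by (simp add: lookup_add sum.distrib)
  also have "\<dots> = k + l" using assms sum_keys_eq[of a m] sum_keys_eq[of b m]
    by (auto simp: monomials_def)
  finally show ?thesis using * by (simp add: monomials_def)
qed

text \<open>
  The grading is allowed to be any family of sets with the closure properties of homogeneous
  components, so that it can be iterated: forms graded by degree, and polynomials over a graded ring.
\<close>

locale graded_ring =
  fixes G :: "nat \<Rightarrow> 'a::comm_ring_1 set"
  assumes zero: "0 \<in> G k" and one: "1 \<in> G 0"
    and add: "a \<in> G k \<Longrightarrow> b \<in> G k \<Longrightarrow> a + b \<in> G k"
    and mult: "a \<in> G k \<Longrightarrow> b \<in> G l \<Longrightarrow> a * b \<in> G (k + l)"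
begin

lemma sum: "(\<And>i. i \<in> A \<Longrightarrow> f i \<in> G k) \<Longrightarrow> (\<Sum>i\<in>A. f i) \<in> G k"
  by (induction A rule: infinite_finite_induct) (auto intro: zero add)

lemma power: "a \<in> G k \<Longrightarrow> a ^ n \<in> G (k * n)"
  by (induction n) (auto intro: one mult)

lemma prod: "(\<And>i. i \<in> A \<Longrightarrow> f i \<in> G (k i)) \<Longrightarrow> (\<Prod>i\<in>A. f i) \<in> G (\<Sum>i\<in>A. k i)"
  by (induction A rule: infinite_finite_induct) (auto intro: one mult)

text \<open>
  A form of degree $d$ in elements of degree 1 has degree $d$.  Applied to iterated gradings, this
  bounds the degrees of all coefficients of a restricted polynomial at once.
\<close>

lemma subst_graded:
  assumes p: "p \<in> forms n d" and \<sigma>: "\<And>i. i < n \<Longrightarrow> \<sigma> i \<in> G 1" and h: "\<And>c. h c \<in> G 0"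
  shows "subst h \<sigma> p \<in> G d"
  unfolding subst_def
proof (rule sum)
  fix \<alpha> assume \<alpha>: "\<alpha> \<in> Poly_Mapping.keys p"
  have "mon_eval \<sigma> \<alpha> \<in> G (\<Sum>i\<in>Poly_Mapping.keys \<alpha>. 1 * Poly_Mapping.lookup \<alpha> i)"
    unfolding mon_eval_def using p \<alpha> by (intro prod power \<sigma>) (auto simp: forms_def)
  also have "(\<Sum>i\<in>Poly_Mapping.keys \<alpha>. 1 * Poly_Mapping.lookup \<alpha> i) = d"
    using p \<alpha> by (auto simp: forms_def)
  finally show "h (Poly_Mapping.lookup p \<alpha>) * mon_eval \<sigma> \<alpha> \<in> G d"
    using mult[OF h, of "mon_eval \<sigma> \<alpha>" d] by simp
qed

end

text \<open>
  Here the new variable has degree 1, so the coefficient of its $i$-th power lies in degree $e - i$.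
\<close>

definition graded_poly :: "(nat \<Rightarrow> 'a::comm_ring_1 set) \<Rightarrow> nat \<Rightarrow> 'a poly set" where
  "graded_poly G e = {A. \<forall>i. (i \<le> e \<longrightarrow> coeff A i \<in> G (e - i)) \<and> (i > e \<longrightarrow> coeff A i = 0)}"

lemma graded_ring_poly:
  assumes "graded_ring G"
  shows "graded_ring (graded_poly G)"
proof -
  interpret graded_ring G by fact
  show ?thesis
  proof
    fix a b k l assume a: "a \<in> graded_poly G k" and b: "b \<in> graded_poly G l"
    show "a * b \<in> graded_poly G (k + l)"
      unfolding graded_poly_def mem_Collect_eq
    proof (intro allI conjI impI)
      fix i assume "i \<le> k + l"
      show "coeff (a * b) i \<in> G (k + l - i)"
        unfolding coeff_mult
      proof (rule sum)
        fix j assume "j \<in> {..i}"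
        then have "j \<le> i" by simp
        show "coeff a j * coeff b (i - j) \<in> G (k + l - i)"
        proof (cases "j \<le> k \<and> i - j \<le> l")
          case True
          then have "coeff a j * coeff b (i - j) \<in> G ((k - j) + (l - (i - j)))"
            using a b by (intro mult) (auto simp: graded_poly_def)
          also have "(k - j) + (l - (i - j)) = k + l - i" using True \<open>j \<le> i\<close> by linarith
          finally show ?thesis .
        qed (use a b zero in \<open>auto simp: graded_poly_def\<close>)
      qed
    next
      fix i assume "i > k + l"
      then have "coeff a j * coeff b (i - j) = 0" if "j \<le> i" for j
        using a b that by (cases "j \<le> k") (auto simp: graded_poly_def)
      then show "coeff (a * b) i = 0" by (simp add: coeff_mult)
    qed
  qed (auto simp: graded_poly_def zero one add)
qed

lemma const_mem_graded_poly: "graded_ring G \<Longrightarrow> c \<in> G k \<Longrightarrow> [:c:] \<in> graded_poly G k"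
  by (auto simp: graded_poly_def coeff_pCons graded_ring.zero split: nat.split)

lemma linear_mem_graded_poly: "c \<in> G 1 \<Longrightarrow> c' \<in> G 0 \<Longrightarrow> [:c, c':] \<in> graded_poly G 1"
  by (auto simp: graded_poly_def coeff_pCons split: nat.split)

lemma graded_ring_forms: "graded_ring (\<lambda>e. forms m (k * e))"
proof
  fix a b e f assume "a \<in> forms m (k * e)" "b \<in> forms m (k * f)"
  then show "a * b \<in> forms m (k * (e + f))"
    using keys_mult[of a b] monomials_add[of _ m "k * e" _ "k * f"]
    unfolding forms_iff distrib_left by blast
next
  fix a b e assume "a \<in> forms m (k * e)" "b \<in> forms m (k * e)"
  then show "a + b \<in> forms m (k * e)"
    using keys_add[of a b] unfolding forms_iff by blast
qed (auto simp: forms_def)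

lemma graded_ring_forms_1: "graded_ring (forms m)"
  using graded_ring_forms[of m 1] by simp

lemmas forms_zero [simp] = graded_ring.zero[OF graded_ring_forms_1]
  and forms_add = graded_ring.add[OF graded_ring_forms_1]
  and forms_mult = graded_ring.mult[OF graded_ring_forms_1]
  and forms_sum = graded_ring.sum[OF graded_ring_forms_1]
  and forms_power = graded_ring.power[OF graded_ring_forms_1]
  and forms_prod = graded_ring.prod[OF graded_ring_forms_1]

lemma forms_mconst [simp]: "mconst c \<in> forms m 0"
proof -
  have "0 \<in> monomials m 0" by (simp add: monomials_def)
  then show ?thesis unfolding forms_iff mconst_def keys_single by (cases "c = 0") simp_all
qed

lemma forms_mvar:
  assumes "i < m"
  shows "mvar i \<in> forms m 1"
proof -
  have "Poly_Mapping.single i 1 \<in> monomials m 1"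
    using assms by (simp add: monomials_def)
  then show ?thesis unfolding forms_iff mvar_def keys_single by simp
qed

lemma forms_cmult: "p \<in> forms m k \<Longrightarrow> mconst c * p \<in> forms m k"
  using forms_mult[OF forms_mconst, of p m k] by simp

lemma forms_uminus: "p \<in> forms m k \<Longrightarrow> - p \<in> forms m k"
  by (simp add: forms_def)

lemma forms_diff: "p \<in> forms m k \<Longrightarrow> q \<in> forms m k \<Longrightarrow> p - q \<in> forms m k"
  using forms_add[OF _ forms_uminus, of p m k q] by simp

section \<open>Counting monomials\<close>

lemma bij_betw_monomials_lists:
  "bij_betw (\<lambda>\<alpha>. map (Poly_Mapping.lookup \<alpha>) [0..<m]) (monomials m k)
     {l. length l = m \<and> sum_list l = k}"
proof (rule bij_betw_byWitness[where f' = Poly_Mapping.nth])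
  show "\<forall>\<alpha>\<in>monomials m k. Poly_Mapping.nth (map (Poly_Mapping.lookup \<alpha>) [0..<m]) = \<alpha>"
  proof (intro ballI poly_mapping_eqI)
    fix \<alpha> i assume "\<alpha> \<in> monomials m k"
    then have "Poly_Mapping.lookup \<alpha> i = 0" if "i \<ge> m" 
      using that by (auto simp: monomials_def in_keys_iff)
    then show "Poly_Mapping.lookup (Poly_Mapping.nth (map (Poly_Mapping.lookup \<alpha>) [0..<m])) i = Poly_Mapping.lookup \<alpha> i"
      by (auto simp: nth_default_def)
  qed
  show "\<forall>l\<in>{l. length l = m \<and> sum_list l = k}. map (Poly_Mapping.lookup (Poly_Mapping.nth l)) [0..<m] = l"
    by (auto intro!: nth_equalityI simp: nth_default_def)
  show "(\<lambda>\<alpha>. map (Poly_Mapping.lookup \<alpha>) [0..<m]) ` monomials m k \<subseteq> {l. length l = m \<and> sum_list l = k}"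
    by (auto simp: monomials_def sum_keys_eq[where m = m] interv_sum_list_conv_sum_set_nat atLeast0LessThan)
  show "Poly_Mapping.nth ` {l. length l = m \<and> sum_list l = k} \<subseteq> monomials m k"
  proof safe
    fix l :: "nat list" assume l: "m = length l" "k = sum_list l"
    have k: "Poly_Mapping.keys (Poly_Mapping.nth l) \<subseteq> {..<length l}"
      by (rule subsetI, unfold in_keys_iff) (auto simp: nth_default_def split: if_splits)
    have "(\<Sum>i<length l. Poly_Mapping.lookup (Poly_Mapping.nth l) i) = sum_list l"
      unfolding sum_list_sum_nth atLeast0LessThan by (rule sum.cong) (auto simp: nth_default_def)
    with k show "Poly_Mapping.nth l \<in> monomials (length l) (sum_list l)" unfolding monomials_def mem_Collect_eq sum_keys_eq[OF k]
      by (simp add: monomials_def sum_keys_eq[where m = m])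
  qed
qed

lemma card_monomials: "card (monomials m k) = (k + m - 1) choose k"
  using bij_betw_same_card[OF bij_betw_monomials_lists] card_length_sum_list[of m k] by simp

lemma finite_monomials: "finite (monomials m k)"
proof -
  have "finite {l. length l = m \<and> sum_list l = k}"
    by (rule finite_subset[OF _ finite_lists_length_eq[of "{..k}" m]])
      (auto simp: member_le_sum_list)
  then show ?thesis using bij_betw_finite[OF bij_betw_monomials_lists] by blast
qed

lemma mpeval_form:
  assumes "p \<in> forms m k"
  shows "mpeval p x = (\<Sum>\<alpha>\<in>monomials m k. Poly_Mapping.lookup p \<alpha> * mon_eval (($) x) \<alpha>)"
  using assms unfolding mpeval_eq_subst forms_iff
  by (intro subst_superset finite_monomials) auto

lemma card_monomials_mono:
  assumes "m > 0" "k \<le> l"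
  shows "card (monomials m k) \<le> card (monomials m l)"
proof -
  have "(k + m - 1) choose (m - 1) \<le> (l + m - 1) choose (m - 1)"
    by (rule binomial_right_mono) (use assms in auto)
  with assms show ?thesis
    using binomial_symmetric[of k "k + m - 1"] binomial_symmetric[of l "l + m - 1"]
    by (simp add: card_monomials)
qed

text \<open>
  The quotient of the two dimensions is $(m + 2y - 1) / (2y)$, which exceeds $5y$ exactly under the
  hypothesis on $m$.
\<close>

lemma card_monomials_gap:
  assumes "m > 0" "y > 0" and m: "int m > 10 * (int y)^2 - 2 * int y + 1"
  shows "5 * y * card (monomials m (2 * y - 1)) < card (monomials m (2 * y))"
proof -
  obtain K where K: "2 * y = Suc K" using assms(2) by (cases "2 * y") auto
  obtain M where M: "m = Suc M" using assms(1) by (cases m) auto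
  have pos: "card (monomials m K) > 0"
    by (simp add: card_monomials M)
  have "Suc K * (Suc (K + M) choose Suc K) = Suc (K + M) * ((K + M) choose K)"
    by (rule Suc_times_binomial)
  then have eq: "Suc K * card (monomials m (Suc K)) = (K + m) * card (monomials m K)"
    by (simp add: card_monomials M)
  have "int (K + m) > 10 * (int y)^2" using m K by linarith
  then have "K + m > Suc K * (5 * y)"
    unfolding K[symmetric] by (simp add: power2_eq_square flip: of_nat_less_iff[where ?'a = int])
  then have "Suc K * (5 * y * card (monomials m K)) < (K + m) * card (monomials m K)"
    using pos by (metis mult.assoc mult_less_mono1)
  then have "Suc K * (5 * y * card (monomials m K)) < Suc K * card (monomials m (Suc K))"
    unfolding eq .
  then have "5 * y * card (monomials m K) < card (monomials m (Suc K))"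
    unfolding nat_mult_less_cancel_disj by blast
  then show ?thesis using K by simp
qed

section \<open>Interpolation at lattice points\<close>

text \<open>
  A homogeneous Lagrange basis for the lattice points of the simplex $\sum_i x_i = K$.  On this
  simplex the factor belonging to $j$ is $x_i - j$, so at a lattice point $\gamma$ the product is
  $\prod_i \gamma_i (\gamma_i - 1) \cdots (\gamma_i - \beta_i + 1)$.
\<close>

definition lagrange_form :: "nat \<Rightarrow> nat \<Rightarrow> (nat \<Rightarrow>\<^sub>0 nat) \<Rightarrow> mpoly" where
  "lagrange_form m K \<beta> = (\<Prod>i<m. \<Prod>j<Poly_Mapping.lookup \<beta> i.
     mvar i - mconst (real j / real K) * (\<Sum>l<m. mvar l))"

definition mon_point :: "nat \<Rightarrow> (nat \<Rightarrow>\<^sub>0 nat) \<Rightarrow> real vec" where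
  "mon_point m \<gamma> = vec m (\<lambda>i. real (Poly_Mapping.lookup \<gamma> i))"

lemma mon_point_carrier [simp]: "mon_point m \<gamma> \<in> carrier_vec m"
  by (simp add: mon_point_def)

lemma lagrange_form_mem:
  assumes "\<beta> \<in> monomials m K"
  shows "lagrange_form m K \<beta> \<in> forms m K"
proof -
  have "lagrange_form m K \<beta> \<in> forms m (\<Sum>i<m. \<Sum>j<Poly_Mapping.lookup \<beta> i. 1)"
    unfolding lagrange_form_def
    by (intro forms_prod forms_diff forms_mvar forms_cmult forms_sum) auto
  also have "(\<Sum>i<m. \<Sum>j<Poly_Mapping.lookup \<beta> i. 1) = K"
    using assms sum_keys_eq[of \<beta> m] by (auto simp: monomials_def)
  finally show ?thesis .
qed

lemma lagrange_form_eval: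
  assumes "\<gamma> \<in> monomials m K" "K > 0"
  shows "mpeval (lagrange_form m K \<beta>) (mon_point m \<gamma>) =
    (\<Prod>i<m. \<Prod>j<Poly_Mapping.lookup \<beta> i. real (Poly_Mapping.lookup \<gamma> i) - real j)"
proof -
  have "(\<Sum>i<m. Poly_Mapping.lookup \<gamma> i) = K"
    using assms sum_keys_eq[of \<gamma> m] by (auto simp: monomials_def)
  then have "(\<Sum>i<m. real (Poly_Mapping.lookup \<gamma> i)) = real K"
    by (metis of_nat_sum)
  then have S: "(\<Sum>i<m. mon_point m \<gamma> $ i) = real K"
    by (simp add: mon_point_def)
  show ?thesis
    unfolding mpeval_eq_subst lagrange_form_def mpeval_simps S
    by (intro prod.cong refl) (use assms in \<open>auto simp: mon_point_def\<close>)
qed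

lemma monomials_eqI:
  assumes "\<beta> \<in> monomials m K" "\<gamma> \<in> monomials m K"
    and le: "\<And>i. i < m \<Longrightarrow> Poly_Mapping.lookup \<beta> i \<le> Poly_Mapping.lookup \<gamma> i"
  shows "\<beta> = \<gamma>"
proof (rule poly_mapping_eqI)
  fix i
  have s: "(\<Sum>i<m. Poly_Mapping.lookup \<beta> i) = (\<Sum>i<m. Poly_Mapping.lookup \<gamma> i)"
    using assms sum_keys_eq[of \<beta> m] sum_keys_eq[of \<gamma> m] by (auto simp: monomials_def)
  show "Poly_Mapping.lookup \<beta> i = Poly_Mapping.lookup \<gamma> i"
  proof (cases "i < m")
    case True
    have "(\<Sum>i<m. Poly_Mapping.lookup \<gamma> i - Poly_Mapping.lookup \<beta> i) = 0"
      using s le by (subst sum_subtractf_nat) auto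
    then have "Poly_Mapping.lookup \<gamma> i - Poly_Mapping.lookup \<beta> i = 0" using True by simp
    with le[OF True] show ?thesis by simp
  next
    case False
    then have "i \<notin> Poly_Mapping.keys \<beta>" "i \<notin> Poly_Mapping.keys \<gamma>"
      using assms by (auto simp: monomials_def)
    then show ?thesis by (simp add: in_keys_iff)
  qed
qed

text \<open>
  Two distinct exponents of the same degree differ in both directions, so some
  $\gamma_i < \beta_i$ and the falling factorial for $i$ vanishes.
\<close>

lemma lagrange_form_eval_neq:
  assumes "\<beta> \<in> monomials m K" "\<gamma> \<in> monomials m K" "\<beta> \<noteq> \<gamma>" "K > 0"
  shows "mpeval (lagrange_form m K \<beta>) (mon_point m \<gamma>) = 0"
proof -
  obtain i where i: "i < m" "Poly_Mapping.lookup \<gamma> i < Poly_Mapping.lookup \<beta> i"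
    using monomials_eqI[OF assms(1,2)] assms(3) not_le by blast
  have "(\<Prod>j<Poly_Mapping.lookup \<beta> i. real (Poly_Mapping.lookup \<gamma> i) - real j) = 0"
    using i by (auto simp: prod_zero_iff)
  then show ?thesis
    unfolding lagrange_form_eval[OF assms(2,4)] using i(1) by (auto simp: prod_zero_iff)
qed

lemma lagrange_form_eval_eq:
  assumes "\<beta> \<in> monomials m K" "K > 0"
  shows "mpeval (lagrange_form m K \<beta>) (mon_point m \<beta>) \<noteq> 0"
  unfolding lagrange_form_eval[OF assms] by (auto simp: prod_zero_iff)

section \<open>Polynomial maps into a space of higher dimension\<close>

text \<open>
  Gaussian elimination: use one equation to eliminate one unknown.
\<close>

lemma underdetermined_system:
  fixes M :: "'a \<Rightarrow> 'b \<Rightarrow> real"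
  assumes "finite B" "finite A" "card B < card A"
  shows "\<exists>c. (\<exists>a\<in>A. c a \<noteq> 0) \<and> (\<forall>b\<in>B. (\<Sum>a\<in>A. c a * M a b) = 0)"
  using assms
proof (induction B arbitrary: A M rule: finite_induct)
  case empty
  then obtain a where "a \<in> A" by (auto simp: card_gt_0_iff)
  then show ?case by (intro exI[of _ "\<lambda>_. 1"]) auto
next
  case (insert b B)
  show ?case
  proof (cases "\<forall>a\<in>A. M a b = 0")
    case True
    obtain c where "\<exists>a\<in>A. c a \<noteq> 0" "\<forall>b\<in>B. (\<Sum>a\<in>A. c a * M a b) = 0"
      using insert.IH[of A M] insert.prems insert.hyps by auto
    with True show ?thesis by (intro exI[of _ c]) auto
  next
    case False
    then obtain a0 where a0: "a0 \<in> A" "M a0 b \<noteq> 0" by blast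
    define M' where "M' = (\<lambda>a b'. M a b' - M a b / M a0 b * M a0 b')"
    have "card B < card (A - {a0})" using insert a0 by simp
    then obtain c where c: "\<exists>a\<in>A - {a0}. c a \<noteq> 0"
        "\<And>b'. b' \<in> B \<Longrightarrow> (\<Sum>a\<in>A - {a0}. c a * M' a b') = 0"
      using insert.IH[of "A - {a0}" M'] insert.prems by auto
    define s where "s = (\<Sum>a\<in>A - {a0}. c a * M a b)"
    define c' where "c' = c(a0 := - s / M a0 b)"
    have sum: "(\<Sum>a\<in>A. c' a * M a b') = - s / M a0 b * M a0 b' + (\<Sum>a\<in>A - {a0}. c a * M a b')" for b'
      unfolding sum.remove[OF insert.prems(1) a0(1)]
      by (intro arg_cong2[of _ _ _ _ "(+)"] sum.cong) (auto simp: c'_def)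
    have "(\<Sum>a\<in>A. c' a * M a b') = 0" if "b' \<in> B" for b'
    proof -
      have "(\<Sum>a\<in>A - {a0}. c a * M' a b') = (\<Sum>a\<in>A - {a0}. c a * M a b') - s / M a0 b * M a0 b'"
        by (simp add: M'_def s_def algebra_simps sum_subtractf sum_distrib_left sum_divide_distrib)
      then show ?thesis using c(2)[OF that] by (simp add: sum)
    qed
    moreover have "(\<Sum>a\<in>A. c' a * M a b) = 0"
      unfolding sum using a0(2) by (simp add: s_def)
    moreover have "\<exists>a\<in>A. c' a \<noteq> 0" using c(1) by (auto simp: c'_def)
    ultimately show ?thesis by (intro exI[of _ c']) auto
  qed
qed

lemma sum_lessThan_mult_nat:
  fixes f :: "nat \<Rightarrow> 'a::comm_monoid_add"
  shows "(\<Sum>n<B * L. f n) = (\<Sum>l<L. \<Sum>n<B. f (n + B * l))"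
proof (induction L)
  case (Suc L)
  have "{..<B * Suc L} = {..<B * L} \<union> (\<lambda>n. n + B * L) ` {..<B}"
  proof (intro equalityI subsetI)
    fix x assume "x \<in> {..<B * Suc L}"
    then show "x \<in> {..<B * L} \<union> (\<lambda>n. n + B * L) ` {..<B}"
      by (cases "x < B * L") (auto intro!: image_eqI[of _ _ "x - B * L"])
  qed auto
  then have "(\<Sum>n<B * Suc L. f n) = (\<Sum>n<B * L. f n) + (\<Sum>n\<in>(\<lambda>n. n + B * L) ` {..<B}. f n)"
    by (simp only:) (rule sum.union_disjoint; auto)
  also have "(\<Sum>n\<in>(\<lambda>n. n + B * L) ` {..<B}. f n) = (\<Sum>n<B. f (n + B * L))"
    by (subst sum.reindex) (auto simp: inj_on_def)
  finally show ?case using Suc by simp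
qed simp

text \<open>
  Exponent vectors with entries below $R$ are encoded as numbers $n < R^D$; the digits of $n$ in base
  $R$ are the exponents.  The sum is then a polynomial in $D$ variables, and the induction fixes the
  variables one after the other.
\<close>

lemma nonzero_polynomial_on_grid:
  fixes c :: "nat \<Rightarrow> real"
  assumes "\<exists>n<R ^ D. c n \<noteq> 0" "\<And>i. i < D \<Longrightarrow> infinite (A i)"
  shows "\<exists>w. (\<forall>i<D. w i \<in> A i) \<and> (\<Sum>n<R ^ D. c n * (\<Prod>i<D. w i ^ (n div R ^ i mod R))) \<noteq> 0"
  using assms
proof (induction D arbitrary: c)
  case (Suc D)
  obtain n where n: "n < R ^ D * R" "c n \<noteq> 0" using Suc.prems(1) by (auto simp: mult.commute)
  then have R: "R > 0" by (cases R) auto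
  have n_eq: "n mod R ^ D + R ^ D * (n div R ^ D) = n" by simp
  have l0: "n div R ^ D < R" "n mod R ^ D < R ^ D"
    using n R by (auto simp: less_mult_imp_div_less mult.commute)
  have "\<exists>k<R ^ D. c (k + R ^ D * (n div R ^ D)) \<noteq> 0"
    using l0(2) n(2) n_eq by metis
  then obtain w where w: "\<forall>i<D. w i \<in> A i"
      "(\<Sum>k<R ^ D. c (k + R ^ D * (n div R ^ D)) * (\<Prod>i<D. w i ^ (k div R ^ i mod R))) \<noteq> 0"
    using Suc.IH[of "\<lambda>k. c (k + R ^ D * (n div R ^ D))"] Suc.prems(2) by auto
  define P where "P = (\<lambda>l. \<Sum>k<R ^ D. c (k + R ^ D * l) * (\<Prod>i<D. w i ^ (k div R ^ i mod R)))"
  define Q where "Q = (\<Sum>l<R. monom (P l) l)"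
  have "coeff Q (n div R ^ D) \<noteq> 0"
    using w(2) l0(1) by (simp add: Q_def P_def coeff_sum)
  then have "Q \<noteq> 0" by auto
  then have "finite {z. poly Q z = 0}" by (rule poly_roots_finite)
  then obtain z where z: "z \<in> A D" "poly Q z \<noteq> 0"
    using Suc.prems(2)[of D] finite_subset[of "A D" "{z. poly Q z = 0}"] by auto
  have dig: "(k + R ^ D * l) div R ^ i mod R = k div R ^ i mod R" if "i < D" for i k l
  proof -
    have "R ^ D = R ^ i * (R * R ^ (D - Suc i))"
      using that by (simp flip: power_Suc power_add)
    then have "(k + R ^ D * l) div R ^ i = k div R ^ i + R * (R ^ (D - Suc i) * l)"
      using R by (simp add: mult.assoc)
    then show ?thesis by simp
  qed
  have top: "(k + R ^ D * l) div R ^ D mod R = l" if "k < R ^ D" "l < R" for k l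
    using that R by simp
  have "(\<Sum>k<R ^ Suc D. c k * (\<Prod>i<Suc D. (w(D := z)) i ^ (k div R ^ i mod R)))
      = (\<Sum>l<R. \<Sum>k<R ^ D. c (k + R ^ D * l) * (\<Prod>i<Suc D. (w(D := z)) i ^ ((k + R ^ D * l) div R ^ i mod R)))"
    unfolding power_Suc2 by (rule sum_lessThan_mult_nat)
  also have "\<dots> = (\<Sum>l<R. \<Sum>k<R ^ D. c (k + R ^ D * l) * (\<Prod>i<D. w i ^ (k div R ^ i mod R)) * z ^ l)"
    by (intro sum.cong refl) (simp add: dig top)
  also have "\<dots> = poly Q z"
    by (simp add: Q_def P_def poly_sum poly_monom sum_distrib_right)
  finally show ?case using z w(1)
    by (intro exI[of _ "w(D := z)"]) (auto simp: less_Suc_eq)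
qed auto

lemma card_bounded_monomials:
  assumes "\<And>\<alpha>. \<alpha> \<in> U \<Longrightarrow> Poly_Mapping.keys \<alpha> \<subseteq> {..<N} \<and> (\<forall>i. Poly_Mapping.lookup \<alpha> i \<le> B)"
  shows "finite U" "card U \<le> (B + 1) ^ N"
proof -
  let ?f = "\<lambda>\<alpha> :: nat \<Rightarrow>\<^sub>0 nat. map (Poly_Mapping.lookup \<alpha>) [0..<N]"
  let ?L = "{l. set l \<subseteq> {..B} \<and> length l = N}"
  have inj: "inj_on ?f U"
  proof (rule inj_onI)
    fix a b assume ab: "a \<in> U" "b \<in> U" "?f a = ?f b"
    show "a = b"
    proof (rule poly_mapping_eqI)
      fix i
      show "Poly_Mapping.lookup a i = Poly_Mapping.lookup b i"
      proof (cases "i < N")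
        case True
        then show ?thesis using ab(3) by (auto simp: map_eq_conv)
      next
        case False
        then show ?thesis using assms[OF ab(1)] assms[OF ab(2)] by (metis in_keys_iff lessThan_iff subsetD)
      qed
    qed
  qed
  have sub: "?f ` U \<subseteq> ?L" using assms by auto
  have fin: "finite ?L" by (rule finite_lists_length_eq) simp
  show "finite U" using inj_on_finite[OF inj sub fin] .
  show "card U \<le> (B + 1) ^ N"
    using card_inj_on_le[OF inj sub fin] by (simp add: card_lists_length_eq)
qed

lemma lookup_mconst_mult: "Poly_Mapping.lookup (mconst c * p) \<alpha> = c * Poly_Mapping.lookup p \<alpha>"
  by (simp add: mconst_def flip: mult_map_scale_conv_mult) (simp add: Poly_Mapping.map.rep_eq when_def)

text \<open>
  A dimension count replaces transcendence degree.  There are $(r + 1)^D$ monomials in $D$ variables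
  with exponents at most $r$; composed with one of the maps they lie in a space of polynomials in
  $N$ variables of degree at most $eDr$, of dimension at most $(eDr + 1)^N$.  As $N < D$, for large
  $r$ some nonzero combination of the monomials vanishes on all images, but it cannot vanish on the
  whole product of the infinite sets $A_i$.
\<close>

lemma polynomial_maps_miss_point:
  assumes J: "finite J" and ND: "N < D"
    and \<Phi>: "\<And>j i. j \<in> J \<Longrightarrow> i < D \<Longrightarrow> \<Phi> j i \<in> forms N e"
    and A: "\<And>i. i < D \<Longrightarrow> infinite (A i)"
  shows "\<exists>w. (\<forall>i<D. w i \<in> A i) \<and> (\<forall>j\<in>J. \<forall>\<theta>. \<exists>i<D. mpeval (\<Phi> j i) \<theta> \<noteq> w i)"
proof -
  \<comment> \<open>chosen so that $|J| (eDr + 1)^N \le r (r + 1)^N < (r + 1)^{N + 1}$\<close>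
  define r where "r = card J * (e * D + 1) ^ N"
  define B where "B = e * D * r"
  define dig where "dig = (\<lambda>n i. n div (r + 1) ^ i mod (r + 1))"
  define X where "X = (\<lambda>n j. \<Prod>i<D. \<Phi> j i ^ dig n i)"
  define U where "U = (\<Union>n<(r + 1) ^ D. \<Union>j\<in>J. Poly_Mapping.keys (X n j))"
  have U: "Poly_Mapping.keys \<alpha> \<subseteq> {..<N} \<and> (\<forall>i. Poly_Mapping.lookup \<alpha> i \<le> B)" if "\<alpha> \<in> U" for \<alpha>
  proof -
    from that obtain n j where nj: "j \<in> J" "\<alpha> \<in> Poly_Mapping.keys (X n j)" by (auto simp: U_def)
    have "X n j \<in> forms N (\<Sum>i<D. e * dig n i)"
      unfolding X_def using nj by (intro forms_prod forms_power \<Phi>) auto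
    then have \<alpha>: "\<alpha> \<in> monomials N (\<Sum>i<D. e * dig n i)" using nj by (auto simp: forms_iff)
    have "(\<Sum>i<D. e * dig n i) \<le> (\<Sum>i<D. e * r)"
      by (intro sum_mono mult_left_mono) (auto simp: dig_def less_Suc_eq_le[symmetric])
    also have "\<dots> = B" by (simp add: B_def)
    finally have le: "(\<Sum>i<D. e * dig n i) \<le> B" .
    have "Poly_Mapping.lookup \<alpha> i \<le> B" for i
    proof (cases "i \<in> Poly_Mapping.keys \<alpha>")
      case True
      then have "Poly_Mapping.lookup \<alpha> i \<le> (\<Sum>i\<in>Poly_Mapping.keys \<alpha>. Poly_Mapping.lookup \<alpha> i)"
        by (intro member_le_sum) auto
      with \<alpha> le show ?thesis by (simp add: monomials_def)
    qed (simp add: in_keys_iff)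
    with \<alpha> show ?thesis by (simp add: monomials_def)
  qed
  have "card (J \<times> U) \<le> card J * (B + 1) ^ N"
    using card_bounded_monomials[OF U] by (simp add: card_cartesian_product)
  also have "\<dots> \<le> card J * ((e * D + 1) * (r + 1)) ^ N"
    by (intro mult_left_mono power_mono) (auto simp: B_def algebra_simps)
  also have "\<dots> = r * (r + 1) ^ N" unfolding power_mult_distrib by (simp add: r_def)
  also have "\<dots> < (r + 1) ^ Suc N" by simp
  also have "\<dots> \<le> (r + 1) ^ D" using ND by (intro power_increasing) auto
  finally have "card (J \<times> U) < card {..<(r + 1) ^ D}" by simp
  moreover have "finite (J \<times> U)" using J card_bounded_monomials(1)[OF U] by blast
  ultimately obtain c where c: "\<exists>n\<in>{..<(r + 1) ^ D}. c n \<noteq> 0"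
      "\<And>b. b \<in> J \<times> U \<Longrightarrow> (\<Sum>n\<in>{..<(r + 1) ^ D}. c n * Poly_Mapping.lookup (X n (fst b)) (snd b)) = 0"
    using underdetermined_system[of "J \<times> U" "{..<(r + 1) ^ D}" "\<lambda>n b. Poly_Mapping.lookup (X n (fst b)) (snd b)"]
    by blast
  obtain w where w: "\<forall>i<D. w i \<in> A i" "(\<Sum>n<(r + 1) ^ D. c n * (\<Prod>i<D. w i ^ dig n i)) \<noteq> 0"
    using nonzero_polynomial_on_grid[of "r + 1" D c A] c(1) A unfolding dig_def by auto
  have "\<exists>i<D. mpeval (\<Phi> j i) \<theta> \<noteq> w i" if j: "j \<in> J" for j \<theta>
  proof (rule ccontr)
    assume "\<not> ?thesis"
    then have eq: "w i = mpeval (\<Phi> j i) \<theta>" if "i < D" for i using that by auto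
    have "(\<Sum>n<(r + 1) ^ D. mconst (c n) * X n j) = 0"
    proof (rule poly_mapping_eqI)
      fix \<alpha>
      have "Poly_Mapping.lookup (\<Sum>n<(r + 1) ^ D. mconst (c n) * X n j) \<alpha>
        = (\<Sum>n<(r + 1) ^ D. c n * Poly_Mapping.lookup (X n j) \<alpha>)"
        by (simp add: lookup_sum lookup_mconst_mult)
      also have "\<dots> = 0"
      proof (cases "\<alpha> \<in> U")
        case True
        then show ?thesis using c(2)[of "(j, \<alpha>)"] j by simp
      next
        case False
        then show ?thesis using j by (intro sum.neutral) (auto simp: U_def in_keys_iff)
      qed
      finally show "Poly_Mapping.lookup (\<Sum>n<(r + 1) ^ D. mconst (c n) * X n j) \<alpha> = Poly_Mapping.lookup 0 \<alpha>"
        by simp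
    qed
    then have "mpeval (\<Sum>n<(r + 1) ^ D. mconst (c n) * X n j) \<theta> = 0"
      by (simp add: mpeval_def)
    moreover have "mpeval (\<Sum>n<(r + 1) ^ D. mconst (c n) * X n j) \<theta>
        = (\<Sum>n<(r + 1) ^ D. c n * (\<Prod>i<D. w i ^ dig n i))"
      by (simp add: mpeval_eq_subst mpeval_simps X_def eq)
    ultimately show False using w(2) by simp
  qed
  with w(1) show ?thesis by blast
qed

section \<open>Roots of complex polynomials under a homotopy\<close>

lemma poly_eq_sum_le:
  fixes p :: "'a::comm_semiring_1 poly"
  assumes "degree p \<le> d"
  shows "poly p t = (\<Sum>i\<le>d. coeff p i * t ^ i)"
  using arg_cong[OF poly_as_sum_of_monoms'[OF assms], of "\<lambda>p. poly p t"]
  by (simp add: poly_sum poly_monom)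

lemma coeff_bound_imp_root_bound:
  fixes p :: "complex poly"
  assumes deg: "degree p \<le> d" and lead: "coeff p d = c" "c \<noteq> 0"
    and M: "\<And>i. i < d \<Longrightarrow> norm (coeff p i) \<le> M" and root: "poly p t = 0"
  shows "norm t \<le> max 1 (real d * M / norm c)"
proof (rule ccontr)
  assume "\<not> ?thesis"
  then have t: "norm t > 1" "norm t > real d * M / norm c" by auto
  show False
  proof (cases d)
    case 0
    then have "poly p t = c" using deg lead(1) by (auto elim!: degree_eq_zeroE)
    with root lead(2) show False by simp
  next
    case (Suc e)
    have "poly p t = (\<Sum>i\<le>d. coeff p i * t ^ i)"
      using deg by (rule poly_eq_sum_le)
    also have "\<dots> = (\<Sum>i<d. coeff p i * t ^ i) + c * t ^ d"
      using lead by (simp add: lessThan_Suc_atMost[symmetric])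
    finally have "c * t ^ d = - (\<Sum>i<d. coeff p i * t ^ i)"
      using root by (simp add: eq_neg_iff_add_eq_0 add.commute)
    then have "norm c * norm t ^ d = norm (\<Sum>i<d. coeff p i * t ^ i)"
      by (metis norm_minus_cancel norm_mult norm_power)
    also have "\<dots> \<le> (\<Sum>i<d. norm (coeff p i * t ^ i))" by (rule norm_sum)
    also have "\<dots> \<le> (\<Sum>i<d. M * norm t ^ e)"
    proof (rule sum_mono)
      fix i assume i: "i \<in> {..<d}"
      then have "norm t ^ i \<le> norm t ^ e" using t Suc by (intro power_increasing) auto
      moreover have "0 \<le> M" using M[of i] i norm_ge_zero order_trans by blast
      ultimately show "norm (coeff p i * t ^ i) \<le> M * norm t ^ e"
        unfolding norm_mult norm_power using M[of i] i by (intro mult_mono) auto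
    qed
    also have "\<dots> = real d * M * norm t ^ e" by simp
    finally have "norm c * norm t * norm t ^ e \<le> real d * M * norm t ^ e"
      by (simp add: Suc mult.assoc)
    moreover have "norm t ^ e > 0" using t(1) by (intro zero_less_power) linarith
    ultimately have "norm c * norm t \<le> real d * M" by simp
    with t(2) lead(2) show False by (simp add: field_simps)
  qed
qed

text \<open>
  The modulus of $p(t)$ is $|c|$ times the product of the distances from $t$ to the roots.  If it is
  less than $|c| (\mathrm{Im}\, t)^d$, some root is closer to $t$ than the real axis is.
\<close>

lemma upper_root_of_small_value:
  fixes p :: "complex poly"
  assumes "degree p = d" "coeff p d = c" "norm (poly p t) < norm c * Im t ^ d" "Im t > 0"
  shows "\<exists>s. Im s > 0 \<and> poly p s = 0"
proof -
  obtain r where r: "Polynomial.smult (lead_coeff p) (\<Prod>i<degree p. [:- r i, 1:]) = p"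
    by (rule complex_poly_decompose')
  have ev: "poly p s = c * (\<Prod>i<d. s - r i)" for s
  proof -
    have "poly p s = poly (Polynomial.smult (lead_coeff p) (\<Prod>i<degree p. [:- r i, 1:])) s"
      by (simp only: r)
    also have "\<dots> = c * (\<Prod>i<d. s - r i)"
      using assms by (simp add: poly_prod)
    finally show ?thesis .
  qed
  have "\<exists>i<d. Im (r i) > 0"
  proof (rule ccontr)
    assume "\<not> ?thesis"
    then have le: "Im (r i) \<le> 0" if "i < d" for i using that by force
    have "(\<Prod>i<d. Im t) \<le> (\<Prod>i<d. norm (t - r i))"
    proof (rule prod_mono)
      fix i assume "i \<in> {..<d}"
      then have "Im t \<le> Im (t - r i)" using le[of i] by simp
      also have "\<dots> \<le> norm (t - r i)" using abs_Im_le_cmod[of "t - r i"] by linarith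
      finally show "0 \<le> Im t \<and> Im t \<le> norm (t - r i)" using assms by simp
    qed
    then have "norm c * Im t ^ d \<le> norm (poly p t)"
      unfolding ev norm_mult prod_norm[symmetric] by (intro mult_left_mono) auto
    with assms(3) show False by simp
  qed
  then obtain i where i: "i < d" "Im (r i) > 0" by blast
  have "poly p (r i) = 0" unfolding ev using i(1) by (auto simp: prod_zero_iff)
  with i show ?thesis by blast
qed

text \<open>
  Roots move continuously and never meet the real axis, and the constant leading coefficient keeps
  them bounded, so none can enter the upper half plane.  Formally, the set of parameters for which
  there is a root in the closed upper half plane is closed by compactness, open by the previous
  lemma, and does not contain 0.
\<close>

lemma homotopy_no_upper_roots:
  fixes h :: "real \<Rightarrow> complex poly"
  assumes cont: "\<And>i. continuous_on {0..1} (\<lambda>\<kappa>. coeff (h \<kappa>) i)"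
    and deg: "\<And>\<kappa>. degree (h \<kappa>) \<le> d"
    and lead: "\<And>\<kappa>. coeff (h \<kappa>) d = c" "c \<noteq> 0"
    and real: "\<And>\<kappa> t. \<kappa> \<in> {0..1} \<Longrightarrow> Im t = 0 \<Longrightarrow> poly (h \<kappa>) t \<noteq> 0"
    and init: "\<And>t. Im t \<ge> 0 \<Longrightarrow> poly (h 0) t \<noteq> 0"
    and t: "Im t \<ge> 0"
  shows "poly (h 1) t \<noteq> 0"
proof -
  define S where "S = {\<kappa>\<in>{0..1}. \<exists>t. Im t \<ge> 0 \<and> poly (h \<kappa>) t = 0}"
  have deg_eq: "degree (h \<kappa>) = d" for \<kappa>
    using deg[of \<kappa>] lead by (metis le_antisym le_degree)
  have eval: "poly (h \<kappa>) t = (\<Sum>i\<le>d. coeff (h \<kappa>) i * t ^ i)" for \<kappa> t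
    using deg by (rule poly_eq_sum_le)
  have "\<exists>M. \<forall>\<kappa>\<in>{0..1}. norm (coeff (h \<kappa>) i) \<le> M" for i
    using compact_continuous_image[OF cont[of i] compact_Icc]
    by (auto dest!: compact_imp_bounded simp: bounded_iff)
  then obtain M where M: "\<And>i \<kappa>. \<kappa> \<in> {0..1} \<Longrightarrow> norm (coeff (h \<kappa>) i) \<le> M i" by metis
  define R where "R = max 1 (real d * (\<Sum>i<d. M i) / norm c)"
  have bound: "norm t \<le> R" if "\<kappa> \<in> {0..1}" "poly (h \<kappa>) t = 0" for \<kappa> t
    unfolding R_def
  proof (rule coeff_bound_imp_root_bound[OF deg lead _ that(2)])
    fix i assume "i < d"
    have nonneg: "M j \<ge> 0" for j using M[OF that(1), of j] norm_ge_zero order_trans by blast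
    have "M i \<le> (\<Sum>i<d. M i)"
      using \<open>i < d\<close> nonneg by (intro member_le_sum) auto
    with M[OF that(1), of i] show "norm (coeff (h \<kappa>) i) \<le> (\<Sum>i<d. M i)" by linarith
  qed
  define Z where "Z = {z \<in> {0..1} \<times> (cball 0 R \<inter> {t. Im t \<ge> 0}). poly (h (fst z)) (snd z) = 0}"
  have "continuous_on ({0..1} \<times> (cball 0 R \<inter> {t. Im t \<ge> 0})) (\<lambda>z. poly (h (fst z)) (snd z))"
    unfolding eval
    by (intro continuous_intros continuous_on_compose2[OF cont]) auto
  moreover have "compact (cball 0 R \<inter> {t. Im t \<ge> 0})"
    by (intro compact_Int_closed compact_cball closed_Collect_le continuous_intros)
  then have K: "compact ({0..1::real} \<times> (cball 0 R \<inter> {t. Im t \<ge> 0}))"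
    by (intro compact_Times compact_Icc)
  ultimately have "closed Z"
    unfolding Z_def using continuous_closed_preimage_constant compact_imp_closed by blast
  moreover have "({0..1} \<times> (cball 0 R \<inter> {t. Im t \<ge> 0})) \<inter> Z = Z" by (auto simp: Z_def)
  ultimately have "compact Z" using compact_Int_closed[OF K, of Z] by simp
  then have "compact (fst ` Z)"
    by (intro compact_continuous_image continuous_intros)
  moreover have "fst ` Z = S"
  proof (intro equalityI subsetI)
    fix \<kappa> assume "\<kappa> \<in> S"
    then obtain t where t: "\<kappa> \<in> {0..1}" "Im t \<ge> 0" "poly (h \<kappa>) t = 0" by (auto simp: S_def)
    then have "(\<kappa>, t) \<in> Z" using bound[OF t(1,3)] by (simp add: Z_def)
    then show "\<kappa> \<in> fst ` Z" by (rule image_eqI[rotated]) simp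
  qed (auto simp: Z_def S_def)
  ultimately have closed: "closedin (top_of_set {0..1}) S"
    by (intro closed_subset) (auto simp: S_def intro: compact_imp_closed)
  have "openin (top_of_set {0..1}) S"
    unfolding openin_euclidean_subtopology_iff
  proof (intro conjI ballI)
    fix \<kappa>0 assume "\<kappa>0 \<in> S"
    then obtain t0 where t0: "\<kappa>0 \<in> {0..1}" "Im t0 \<ge> 0" "poly (h \<kappa>0) t0 = 0"
      by (auto simp: S_def)
    then have Im: "Im t0 > 0" using real[OF t0(1), of t0] by force
    have "continuous_on {0..1} (\<lambda>\<kappa>. poly (h \<kappa>) t0)"
      unfolding eval by (intro continuous_intros cont)
    moreover have "norm c * Im t0 ^ d > 0" using Im lead(2) by simp
    ultimately obtain e where e: "e > 0" "\<And>\<kappa>. \<kappa> \<in> {0..1} \<Longrightarrow> dist \<kappa> \<kappa>0 < e \<Longrightarrow>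
        dist (poly (h \<kappa>) t0) (poly (h \<kappa>0) t0) < norm c * Im t0 ^ d"
      using t0(1) unfolding continuous_on_iff by blast
    have "\<kappa> \<in> S" if \<kappa>: "\<kappa> \<in> {0..1}" "dist \<kappa> \<kappa>0 < e" for \<kappa>
    proof -
      have "norm (poly (h \<kappa>) t0) < norm c * Im t0 ^ d" using e(2)[OF \<kappa>] t0(3) by simp
      then obtain s where "Im s > 0" "poly (h \<kappa>) s = 0"
        using upper_root_of_small_value[OF deg_eq lead(1)] Im by blast
      then show ?thesis using \<kappa>(1) unfolding S_def by force
    qed
    with e(1) show "\<exists>e>0. \<forall>x'\<in>{0..1}. dist x' \<kappa>0 < e \<longrightarrow> x' \<in> S" by blast
  qed (auto simp: S_def)
  with closed have "S = {} \<or> S = {0..1}"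
    using connected_clopen[of "{0..1::real}"] by auto
  moreover have "0 \<notin> S" using init by (auto simp: S_def)
  ultimately have "S = {}" by (metis atLeastAtMost_iff order_refl zero_le_one)
  with t show ?thesis by (auto simp: S_def)
qed

text \<open>
  If $s_j$ are the roots of $w$, then $w'(0) / w(0) = -\sum_j 1 / s_j$, and
  $\mathrm{Im}(-1/s_j) = \mathrm{Im}(s_j) / |s_j|^2 < 0$.
\<close>

lemma Im_log_derivative_nonpos:
  fixes w :: "complex poly"
  assumes "\<And>s. Im s \<ge> 0 \<Longrightarrow> poly w s \<noteq> 0"
  shows "Im (coeff w 1 / coeff w 0) \<le> 0"
proof -
  obtain r where r: "Polynomial.smult (lead_coeff w) (\<Prod>i<degree w. [:- r i, 1:]) = w"
    by (rule complex_poly_decompose')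
  have w0: "lead_coeff w \<noteq> 0" using assms[of 0] by auto
  have neg: "Im (r i) < 0" if "i < degree w" for i
  proof (rule ccontr)
    assume "\<not> Im (r i) < 0"
    then have "poly (Polynomial.smult (lead_coeff w) (\<Prod>i<degree w. [:- r i, 1:])) (r i) \<noteq> 0"
      unfolding r using assms by simp
    then show False using that by (auto simp: poly_prod prod_zero_iff)
  qed
  have "coeff (\<Prod>i<n. [:- r i, 1:]) 0 \<noteq> 0 \<and>
      Im (coeff (\<Prod>i<n. [:- r i, 1:]) 1 / coeff (\<Prod>i<n. [:- r i, 1:]) 0) \<le> 0"
    if "n \<le> degree w" for n
    using that
  proof (induction n)
    case (Suc n)
    define A where "A = (\<Prod>i<n. [:- r i, 1:])"
    have A: "coeff A 0 \<noteq> 0" "Im (coeff A 1 / coeff A 0) \<le> 0" using Suc by (auto simp: A_def)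
    have rn: "Im (r n) < 0" using neg[of n] Suc.prems by simp
    then have rn0: "r n \<noteq> 0" by auto
    have P: "(\<Prod>i<Suc n. [:- r i, 1:]) = [:- r n, 1:] * A" by (simp add: A_def mult.commute)
    have c0: "coeff ([:- r n, 1:] * A) 0 = - r n * coeff A 0" by simp
    have c1: "coeff ([:- r n, 1:] * A) 1 = coeff A 0 - r n * coeff A 1" by (simp add: coeff_pCons)
    have "coeff ([:- r n, 1:] * A) 1 / coeff ([:- r n, 1:] * A) 0 = coeff A 1 / coeff A 0 - 1 / r n"
      unfolding c0 c1 using A(1) rn0 by (simp add: field_simps)
    moreover have "Im (1 / r n) \<ge> 0" using rn by (simp add: Im_divide divide_nonpos_nonneg)
    ultimately show ?case using A rn0 unfolding P c0 by simp
  qed (simp add: coeff_1)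
  from this[OF order_refl] have "Im (coeff (Polynomial.smult (lead_coeff w) (\<Prod>i<degree w. [:- r i, 1:])) 1
      / coeff (Polynomial.smult (lead_coeff w) (\<Prod>i<degree w. [:- r i, 1:])) 0) \<le> 0"
    using w0 unfolding coeff_smult by simp
  then show ?thesis unfolding r .
qed

section \<open>Partial fractions\<close>

abbreviation cpoly :: "real poly \<Rightarrow> complex poly" where
  "cpoly \<equiv> map_poly complex_of_real"

lemma cpoly_mult: "cpoly (p * q) = cpoly p * cpoly q"
  by (rule poly_eqI) (simp add: coeff_map_poly coeff_mult)

lemma cpoly_linear: "cpoly [:a, 1:] = [:of_real a, 1:]"
  by (simp add: map_poly_pCons)

lemma degree_cpoly: "degree (cpoly p) = degree p"
  by (rule degree_map_poly) simp

lemma cpoly_eq_0_iff: "cpoly p = 0 \<longleftrightarrow> p = 0"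
  by (rule map_poly_eq_0_iff) auto

lemma poly_cpoly_of_real: "poly (cpoly p) (of_real x) = of_real (poly p x)"
  by (induction p) (simp_all add: map_poly_pCons)

lemma cpoly_power: "cpoly (p ^ n) = cpoly p ^ n"
  by (induction n) (simp_all add: cpoly_mult)

text \<open>
  Let $g/f$ have non-positive imaginary part on the upper half plane.  Near a root $l$ of $f$ of order
  $k$ it behaves like $c\,(t - l)^{-k}$ with $c$ real and nonzero.  As $t - l$ runs through the
  directions of the upper half plane, the argument of $(t - l)^{-k}$ sweeps an interval of length
  $k\pi$, so the imaginary part takes both signs unless $k = 1$; for $k = 1$ the sign forces $c > 0$.
\<close>

lemma herglotz_residue_nonneg:
  fixes f g :: "real poly"
  assumes f: "f \<noteq> 0" "poly f l = 0" and g: "poly g l \<noteq> 0"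
    and herg: "\<And>t. Im t > 0 \<Longrightarrow> Im (poly (cpoly g) t * cnj (poly (cpoly f) t)) \<le> 0"
  shows "\<exists>q. f = [:- l, 1:] * q \<and> poly q l \<noteq> 0 \<and> poly g l / poly q l \<ge> 0"
proof -
  define k where "k = order l f"
  have k: "k > 0" using f by (simp add: k_def order_gt_0_iff)
  obtain q where q: "f = [:- l, 1:] ^ k * q" "\<not> [:- l, 1:] dvd q"
    using order_decomp[OF f(1), of l] by (auto simp: k_def)
  have ql: "poly q l \<noteq> 0" using q(2) by (simp add: poly_eq_0_iff_dvd)
  have F: "poly (cpoly f) t = (t - of_real l) ^ k * poly (cpoly q) t" for t
    unfolding q(1) by (simp add: cpoly_mult cpoly_power cpoly_linear)
  have sign: "Im (cnj \<omega> ^ k) * (poly g l * poly q l) \<le> 0" if \<omega>: "Im \<omega> > 0" for \<omega>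
  proof -
    define \<phi> where "\<phi> = (\<lambda>r::real. Im (cnj \<omega> ^ k * poly (cpoly g) (of_real l + of_real r * \<omega>)
        * cnj (poly (cpoly q) (of_real l + of_real r * \<omega>))))"
    have "\<phi> r \<le> 0" if r: "r > 0" for r
    proof -
      define t where "t = of_real l + of_real r * \<omega>"
      have "poly (cpoly g) t * cnj (poly (cpoly f) t)
          = of_real (r ^ k) * (cnj \<omega> ^ k * poly (cpoly g) t * cnj (poly (cpoly q) t))"
        unfolding F by (simp add: t_def power_mult_distrib)
      then have "Im (poly (cpoly g) t * cnj (poly (cpoly f) t)) = r ^ k * \<phi> r"
        by (simp only: \<phi>_def t_def[symmetric] Im_complex_of_real Re_complex_of_real times_complex.sel)
      moreover have "Im t > 0" using \<omega> r by (simp add: t_def)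
      ultimately have "r ^ k * \<phi> r \<le> 0" using herg by metis
      moreover have "r ^ k > 0" using r by simp
      ultimately show ?thesis by (meson mult_le_0_iff not_le)
    qed
    then have "eventually (\<lambda>r. \<phi> r \<le> 0) (at_right 0)"
      by (auto simp: eventually_at_right_less eventually_at_filter intro!: always_eventually)
    moreover have "(\<phi> \<longlongrightarrow> \<phi> 0) (at_right 0)"
      unfolding \<phi>_def by (intro tendsto_intros)
    ultimately have "\<phi> 0 \<le> 0"
      by (intro tendsto_upperbound[of \<phi> "\<phi> 0" "at_right 0"]) auto
    then show ?thesis by (simp add: \<phi>_def poly_cpoly_of_real mult.assoc)
  qed
  \<comment> \<open>the directions $\theta = \pi / (2k)$ and $3\pi / (2k)$ make $k\theta$ equal to $\pi / 2$ and $3\pi / 2$\<close>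
  have cis_pow: "Im (cnj (cis \<theta>) ^ k) = - sin (real k * \<theta>)" for \<theta>
    by (simp add: cis_cnj DeMoivre)
  have kpos: "real k > 0" using k by simp
  have pos: "poly g l * poly q l \<ge> 0"
  proof -
    have "sin (pi / (2 * real k)) > 0"
    proof (rule sin_gt_zero)
      have "pi / (2 * real k) \<le> pi / 2" using k by (intro divide_left_mono) auto
      then show "pi / (2 * real k) < pi" using pi_gt_zero by linarith
    qed (use k in auto)
    then have "Im (cis (pi / (2 * real k))) > 0" by simp
    from sign[OF this] show ?thesis unfolding cis_pow using kpos by simp
  qed
  moreover have "poly g l * poly q l \<noteq> 0" using g ql by simp
  ultimately have pos': "poly g l * poly q l > 0" by linarith
  have "k = 1"
  proof (rule ccontr)
    assume "k \<noteq> 1"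
    then have k2: "real k \<ge> 2" using k by linarith
    have "sin (3 * pi / (2 * real k)) > 0"
    proof (rule sin_gt_zero)
      have "3 * pi / (2 * real k) \<le> 3 * pi / 4" using k2 by (intro divide_left_mono) auto
      then show "3 * pi / (2 * real k) < pi" using pi_gt_zero by linarith
    qed (use k in auto)
    then have "Im (cis (3 * pi / (2 * real k))) > 0" by simp
    from sign[OF this] have "- sin (3 * pi / 2) * (poly g l * poly q l) \<le> 0"
      unfolding cis_pow using kpos by simp
    moreover have "sin (3 * pi / 2) = sin (pi / 2 + pi)" by (rule arg_cong[of _ _ sin]) simp
    then have "sin (3 * pi / 2) = - 1" by (simp only: sin_periodic_pi sin_pi_half)
    ultimately show False using pos' by simp
  qed
  with q(1) ql pos' show ?thesis
    by (intro exI[of _ q]) (auto simp: zero_le_divide_iff zero_less_mult_iff)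
qed

text \<open>
  Written without denominators: $q_l = f / (t - l)$.  Common roots of $f$ and $g$ are cancelled first,
  because they can be multiple.  Once $f$ and $g$ are coprime, all roots of $f$ are simple, and both
  sides have degree below the number of roots and agree at every root.
\<close>

lemma herglotz_partial_fractions:
  fixes f g :: "real poly"
  assumes "f \<noteq> 0" "g = 0 \<or> degree g < degree f"
    and "\<And>z. poly (cpoly f) z = 0 \<Longrightarrow> z \<in> \<real>"
    and "\<And>t. Im t > 0 \<Longrightarrow> Im (poly (cpoly g) t * cnj (poly (cpoly f) t)) \<le> 0"
  shows "\<exists>Z m q. finite Z \<and> (\<forall>l\<in>Z. m l \<ge> 0 \<and> f = [:- l, 1:] * q l) \<and>
    g = (\<Sum>l\<in>Z. Polynomial.smult (m l) (q l))"
  using assms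
proof (induction "degree f" arbitrary: f g rule: less_induct)
  case (less f g)
  show ?case
  proof (cases "\<exists>l. poly f l = 0 \<and> poly g l = 0")
    case True
    then obtain l f' g' where l: "f = [:- l, 1:] * f'" "g = [:- l, 1:] * g'"
      by (metis dvd_def poly_eq_0_iff_dvd)
    have f': "f' \<noteq> 0" using less.prems(1) l by auto
    have df: "degree f = Suc (degree f')" unfolding l(1) using f' by (subst degree_mult_eq) auto
    have dg: "g' = 0 \<or> degree g' < degree f'"
    proof (cases "g' = 0")
      case False
      then have "degree g = Suc (degree g')" unfolding l(2) by (subst degree_mult_eq) auto
      moreover have "g \<noteq> 0" unfolding l(2) using False by (simp del: mult_pCons_left)
      ultimately show ?thesis using less.prems(2) df by simp
    qed simp
    have real: "z \<in> \<real>" if "poly (cpoly f') z = 0" for z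
      by (rule less.prems(3)) (simp add: l(1) cpoly_mult that del: mult_pCons_left)
    have herg: "Im (poly (cpoly g') t * cnj (poly (cpoly f') t)) \<le> 0" if t: "Im t > 0" for t
    proof -
      have "poly (cpoly g) t * cnj (poly (cpoly f) t)
          = ((t - of_real l) * cnj (t - of_real l)) * (poly (cpoly g') t * cnj (poly (cpoly f') t))"
        by (simp add: l cpoly_mult cpoly_linear del: mult_pCons_left)
      also have "(t - of_real l) * cnj (t - of_real l) = of_real ((norm (t - of_real l))\<^sup>2)"
        by (rule complex_norm_square[symmetric])
      finally have "Im (poly (cpoly g) t * cnj (poly (cpoly f) t))
          = (norm (t - of_real l))\<^sup>2 * Im (poly (cpoly g') t * cnj (poly (cpoly f') t))"
        by (simp only: Im_complex_of_real Re_complex_of_real times_complex.sel)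
      then have "(norm (t - of_real l))\<^sup>2 * Im (poly (cpoly g') t * cnj (poly (cpoly f') t)) \<le> 0"
        using less.prems(4)[OF t] by simp
      moreover have "(norm (t - of_real l))\<^sup>2 > 0" using t by auto
      ultimately show ?thesis by (meson mult_le_0_iff not_le)
    qed
    obtain Z m q where IH: "finite Z" "\<forall>l\<in>Z. m l \<ge> 0 \<and> f' = [:- l, 1:] * q l"
        "g' = (\<Sum>l\<in>Z. Polynomial.smult (m l) (q l))"
      using less.hyps[OF _ f' dg real herg] df by auto
    show ?thesis
    proof (intro exI[of _ Z] exI[of _ m] exI[of _ "\<lambda>i. [:- l, 1:] * q i"] conjI ballI)
      fix i assume "i \<in> Z"
      then have "f' = [:- i, 1:] * q i" using IH by blast
      then show "f = [:- i, 1:] * ([:- l, 1:] * q i)" unfolding l(1) by (simp only: mult.left_commute)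
    next
      show "g = (\<Sum>i\<in>Z. Polynomial.smult (m i) ([:- l, 1:] * q i))"
        unfolding l(2) IH(3) sum_distrib_left by (simp only: mult_smult_right)
    qed (use IH in auto)
  next
    case False
    define Z where "Z = {l. poly f l = 0}"
    have Z: "finite Z" using less.prems(1) by (simp add: Z_def poly_roots_finite)
    have "\<forall>l\<in>Z. \<exists>q. f = [:- l, 1:] * q \<and> poly q l \<noteq> 0 \<and> poly g l / poly q l \<ge> 0"
      using herglotz_residue_nonneg[OF less.prems(1) _ _ less.prems(4)] False by (auto simp: Z_def)
    then obtain q where q: "\<And>l. l \<in> Z \<Longrightarrow> f = [:- l, 1:] * q l"
        "\<And>l. l \<in> Z \<Longrightarrow> poly (q l) l \<noteq> 0" "\<And>l. l \<in> Z \<Longrightarrow> poly g l / poly (q l) l \<ge> 0"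
      by metis
    define m where "m = (\<lambda>l. poly g l / poly (q l) l)"
    define D where "D = g - (\<Sum>l\<in>Z. Polynomial.smult (m l) (q l))"
    have F0: "cpoly f \<noteq> 0" using less.prems(1) by (simp add: cpoly_eq_0_iff)
    have roots: "set_mset (proots (cpoly f)) = of_real ` Z"
    proof (intro equalityI subsetI)
      fix z assume "z \<in> set_mset (proots (cpoly f))"
      then have z: "poly (cpoly f) z = 0" using F0 by simp
      then obtain x where "z = of_real x" using less.prems(3) by (auto elim: Reals_cases)
      with z show "z \<in> of_real ` Z" by (auto simp: Z_def poly_cpoly_of_real)
    qed (use F0 in \<open>auto simp: Z_def poly_cpoly_of_real\<close>)
    have order1: "order (of_real l) (cpoly f) = 1" if "l \<in> Z" for l
    proof -
      have eq: "cpoly f = [:- of_real l, 1:] * cpoly (q l)"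
        by (subst q(1)[OF that]) (simp add: cpoly_mult cpoly_linear del: mult_pCons_left)
      have "order (of_real l) (cpoly f) = order (of_real l) [:- complex_of_real l, 1:] + order (of_real l) (cpoly (q l))"
        using F0 unfolding eq by (rule order_mult)
      also have "order (of_real l) [:- complex_of_real l, 1:] = 1"
        using order_power_n_n[of "of_real l :: complex" 1] by simp
      also have "order (of_real l) (cpoly (q l)) = 0"
        using q(2)[OF that] by (intro order_0I) (simp add: poly_cpoly_of_real)
      finally show ?thesis by simp
    qed
    have "degree f = size (proots (cpoly f))" by (simp add: size_proots_complex degree_cpoly)
    also have "\<dots> = (\<Sum>z\<in>complex_of_real ` Z. count (proots (cpoly f)) z)"
      unfolding size_multiset_overloaded_eq roots ..
    also have "\<dots> = (\<Sum>z\<in>complex_of_real ` Z. 1)"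
      by (intro sum.cong refl) (use F0 order1 in auto)
    also have "\<dots> = card Z" by (simp add: card_image inj_on_def)
    finally have card: "degree f = card Z" .
    have "poly D x = 0" if x: "x \<in> Z" for x
    proof -
      have "poly (q l) x = 0" if "l \<in> Z" "l \<noteq> x" for l
      proof -
        have "poly f x = poly [:- l, 1:] x * poly (q l) x"
          using q(1)[OF that(1)] by (metis poly_mult)
        then show ?thesis using that x by (simp add: Z_def)
      qed
      then have "(\<Sum>l\<in>Z. m l * poly (q l) x) = (\<Sum>l\<in>{x}. m l * poly (q l) x)"
        using x Z by (intro sum.mono_neutral_right) auto
      also have "\<dots> = poly g x" using q(2)[OF x] by (simp add: m_def)
      finally show ?thesis by (simp add: D_def poly_sum)
    qed
    then have sub: "Z \<subseteq> {x. poly D x = 0}" by auto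
    have "D = 0"
    proof (rule ccontr)
      assume D: "D \<noteq> 0"
      have pos: "degree f > 0"
      proof (rule ccontr)
        assume "\<not> degree f > 0"
        then have "g = 0" "Z = {}" using less.prems(2) card Z by auto
        then show False using D by (simp add: D_def)
      qed
      have "degree D < degree f"
      proof -
        have "degree (\<Sum>l\<in>Z. Polynomial.smult (m l) (q l)) < degree f"
        proof (rule degree_sum_less[OF _ pos])
          fix l assume l: "l \<in> Z"
          then have "q l \<noteq> 0" using q(2) by fastforce
          then have "degree f = Suc (degree (q l))" by (subst q(1)[OF l], subst degree_mult_eq) auto
          then show "degree (Polynomial.smult (m l) (q l)) < degree f"
            using degree_smult_le[of "m l" "q l"] by linarith
        qed
        moreover have "degree g < degree f" using less.prems(2) pos by auto
        ultimately show ?thesis unfolding D_def by (rule degree_diff_less[rotated])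
      qed
      moreover have "card Z \<le> degree D"
        using card_mono[OF poly_roots_finite[OF D] sub] card_poly_roots_bound[OF D] by simp
      ultimately show False using card by simp
    qed
    then have g: "g = (\<Sum>l\<in>Z. Polynomial.smult (m l) (q l))" by (simp add: D_def)
    show ?thesis
    proof (intro exI conjI ballI)
      show "g = (\<Sum>l\<in>Z. Polynomial.smult (m l) (q l))" by (rule g)
      show "finite Z" by (rule Z)
      show "m l \<ge> 0" if "l \<in> Z" for l unfolding m_def using that by (rule q(3))
      show "f = [:- l, 1:] * q l" if "l \<in> Z" for l using that by (rule q(1))
    qed
  qed
qed

section \<open>Bezoutians\<close>

lemma bezoutian_eqI:
  assumes "degree f \<le> d" "degree g \<le> d" "C \<in> carrier_mat d d"
    and "\<And>t s. t \<noteq> s \<Longrightarrow> poly f t * poly g s - poly f s * poly g t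
          = (t - s) * (\<Sum>j<d. \<Sum>l<d. C $$ (j, l) * t ^ j * s ^ l)"
  shows "bezoutian d f g = C"
  unfolding bezoutian_def using assms
  by (intro the1_equality ex1_bezoutian) auto

lemma quadratic_form_eq_sum:
  fixes C :: "real mat"
  assumes "C \<in> carrier_mat d d" "\<xi> \<in> carrier_vec d"
  shows "\<xi> \<bullet> (C *\<^sub>v \<xi>) = (\<Sum>j<d. \<Sum>l<d. C $$ (j, l) * \<xi> $ j * \<xi> $ l)"
  using assms by (auto simp: scalar_prod_def sum_distrib_left atLeast0LessThan intro!: sum.cong)

text \<open>
  With $f = (t - l) q_l$ one has $f(t) q_l(s) - f(s) q_l(t) = (t - s) q_l(t) q_l(s)$, so the Bezoutian
  is the sum over $l$ of $m_l$ times the rank one matrix of the coefficient vector of $q_l$.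
\<close>

lemma bezoutian_psd_of_partial_fractions:
  fixes f g :: "real poly"
  assumes f: "f \<noteq> 0" "degree f \<le> d" and Z: "finite Z"
    and q: "\<And>l. l \<in> Z \<Longrightarrow> m l \<ge> 0 \<and> f = [:- l, 1:] * q l"
    and g: "g = (\<Sum>l\<in>Z. Polynomial.smult (m l) (q l))"
    and \<xi>: "\<xi> \<in> carrier_vec d"
  shows "0 \<le> \<xi> \<bullet> (bezoutian d f g *\<^sub>v \<xi>)"
proof -
  define C where "C = mat d d (\<lambda>(j, k). \<Sum>l\<in>Z. m l * coeff (q l) j * coeff (q l) k)"
  have deg: "degree (q l) < d" if "l \<in> Z" for l
  proof -
    have "q l \<noteq> 0" using q[OF that] f(1) by auto
    then have "degree f = Suc (degree (q l))" using q[OF that] by (simp add: degree_mult_eq del: mult_pCons_left)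
    with f(2) show ?thesis by simp
  qed
  have ev: "poly (q l) t = (\<Sum>j<d. coeff (q l) j * t ^ j)" if "l \<in> Z" for l t
  proof -
    have "poly (q l) t = (\<Sum>j\<le>degree (q l). coeff (q l) j * t ^ j)" by (rule poly_altdef)
    also have "\<dots> = (\<Sum>j<d. coeff (q l) j * t ^ j)"
      using deg[OF that] by (intro sum.mono_neutral_left) (auto simp: coeff_eq_0)
    finally show ?thesis .
  qed
  have "degree g \<le> d"
    unfolding g using deg by (intro degree_sum_le Z) (meson degree_smult_le le_trans less_imp_le)
  then have "bezoutian d f g = C"
  proof (rule bezoutian_eqI[OF f(2)])
    fix t s :: real
    have "poly f t * poly g s - poly f s * poly g t
        = (\<Sum>l\<in>Z. m l * (poly f t * poly (q l) s - poly f s * poly (q l) t))"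
      by (simp add: g poly_sum sum_distrib_left sum_subtractf right_diff_distrib ac_simps)
    also have "\<dots> = (\<Sum>l\<in>Z. (t - s) * (m l * (poly (q l) t * poly (q l) s)))"
    proof (intro sum.cong refl)
      fix l assume "l \<in> Z"
      then have "f = [:- l, 1:] * q l" using q by blast
      then have "poly f x = poly [:- l, 1:] x * poly (q l) x" for x by (metis poly_mult)
      then have fx: "poly f x = (x - l) * poly (q l) x" for x by simp
      show "m l * (poly f t * poly (q l) s - poly f s * poly (q l) t) = (t - s) * (m l * (poly (q l) t * poly (q l) s))"
        unfolding fx by (simp add: algebra_simps)
    qed
    also have "\<dots> = (t - s) * (\<Sum>l\<in>Z. \<Sum>j<d. \<Sum>k<d. m l * coeff (q l) j * coeff (q l) k * t ^ j * s ^ k)"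
      unfolding sum_distrib_left[symmetric]
      by (intro arg_cong2[of _ _ _ _ "(*)"] sum.cong refl)
        (simp add: ev sum_product sum_distrib_left ac_simps)
    also have "(\<Sum>l\<in>Z. \<Sum>j<d. \<Sum>k<d. m l * coeff (q l) j * coeff (q l) k * t ^ j * s ^ k)
        = (\<Sum>j<d. \<Sum>k<d. \<Sum>l\<in>Z. m l * coeff (q l) j * coeff (q l) k * t ^ j * s ^ k)"
      by (subst sum.swap, intro sum.cong refl, rule sum.swap)
    also have "\<dots> = (\<Sum>j<d. \<Sum>k<d. C $$ (j, k) * t ^ j * s ^ k)"
      by (intro sum.cong refl) (simp add: C_def sum_distrib_right)
    finally show "poly f t * poly g s - poly f s * poly g t = (t - s) * (\<Sum>j<d. \<Sum>k<d. C $$ (j, k) * t ^ j * s ^ k)" .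
  qed (simp add: C_def)
  then have "\<xi> \<bullet> (bezoutian d f g *\<^sub>v \<xi>) = (\<Sum>j<d. \<Sum>k<d. C $$ (j, k) * \<xi> $ j * \<xi> $ k)"
    using quadratic_form_eq_sum[OF _ \<xi>, of C] by (simp add: C_def)
  also have "\<dots> = (\<Sum>j<d. \<Sum>k<d. \<Sum>l\<in>Z. m l * (coeff (q l) j * \<xi> $ j) * (coeff (q l) k * \<xi> $ k))"
    by (intro sum.cong refl) (simp add: C_def sum_distrib_left sum_distrib_right ac_simps)
  also have "\<dots> = (\<Sum>l\<in>Z. \<Sum>j<d. \<Sum>k<d. m l * (coeff (q l) j * \<xi> $ j) * (coeff (q l) k * \<xi> $ k))"
    by (subst (2) sum.swap, subst sum.swap) simp
  also have "\<dots> = (\<Sum>l\<in>Z. m l * (\<Sum>j<d. coeff (q l) j * \<xi> $ j)\<^sup>2)"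
    by (simp add: power2_eq_square sum_product sum_distrib_left ac_simps)
  also have "\<dots> \<ge> 0" using q by (intro sum_nonneg mult_nonneg_nonneg) auto
  finally show ?thesis .
qed

text \<open>
  The entry with index $(j, l)$ of the Bezoutian of $t^a$ and $t^b$.  It vanishes unless
  $j + l + 1 = a + b$, which makes the entries of a parameterized Bezoutian homogeneous.
\<close>

definition bez_coeff :: "nat \<Rightarrow> nat \<Rightarrow> nat \<Rightarrow> nat \<Rightarrow> real" where
  "bez_coeff j l a b = (if j + l + 1 = a + b
     then (if b \<le> j \<and> j < a then 1 else 0) - (if a \<le> j \<and> j < b then 1 else 0) else 0)"

lemma bez_coeff_monomials:
  fixes t s :: real
  assumes "a \<le> d" "b \<le> d"
  shows "t ^ a * s ^ b - s ^ a * t ^ b = (t - s) * (\<Sum>j<d. \<Sum>l<d. bez_coeff j l a b * t ^ j * s ^ l)"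
proof -
  have ge: "t ^ a * s ^ b - s ^ a * t ^ b = (t - s) * (\<Sum>j<d. \<Sum>l<d. bez_coeff j l a b * t ^ j * s ^ l)"
    if ab: "b \<le> a" "a \<le> d" for a b
  proof -
    have inner: "(\<Sum>l<d. bez_coeff j l a b * t ^ j * s ^ l)
        = (if b \<le> j \<and> j < a then t ^ j * s ^ (a + b - Suc j) else 0)" for j
    proof (cases "b \<le> j \<and> j < a")
      case True
      then have "(\<Sum>l<d. bez_coeff j l a b * t ^ j * s ^ l)
          = (\<Sum>l<d. if l = a + b - Suc j then t ^ j * s ^ (a + b - Suc j) else 0)"
        by (intro sum.cong refl) (auto simp: bez_coeff_def)
      then show ?thesis using True ab by (subst (asm) sum.delta) auto
    next
      case False
      then show ?thesis using ab by (intro trans[OF sum.neutral]) (auto simp: bez_coeff_def)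
    qed
    have "(\<Sum>j<d. \<Sum>l<d. bez_coeff j l a b * t ^ j * s ^ l) = (\<Sum>j\<in>{b..<a}. t ^ j * s ^ (a + b - Suc j))"
      unfolding inner using ab by (intro sum.mono_neutral_cong_right) auto
    also have "(t - s) * \<dots> = (\<Sum>j\<in>{b..<a}. t ^ Suc j * s ^ (a + b - Suc j) - t ^ j * s ^ (a + b - j))"
    proof (unfold sum_distrib_left, intro sum.cong refl)
      fix j assume "j \<in> {b..<a}"
      then have "a + b - j = Suc (a + b - Suc j)" by auto
      then show "(t - s) * (t ^ j * s ^ (a + b - Suc j)) = t ^ Suc j * s ^ (a + b - Suc j) - t ^ j * s ^ (a + b - j)"
        by (simp add: algebra_simps)
    qed
    also have "\<dots> = t ^ a * s ^ (a + b - a) - t ^ b * s ^ (a + b - b)"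
      using sum_Suc_diff'[of b a "\<lambda>j. t ^ j * s ^ (a + b - j)"] ab by simp
    finally show ?thesis by (simp add: mult.commute)
  qed
  have anti: "bez_coeff j l a b = - bez_coeff j l b a" for j l
    by (simp add: bez_coeff_def add.commute)
  show ?thesis
  proof (cases "b \<le> a")
    case False
    then have "t ^ b * s ^ a - s ^ b * t ^ a = (t - s) * (\<Sum>j<d. \<Sum>l<d. bez_coeff j l b a * t ^ j * s ^ l)"
      using ge[of a b] assms by simp
    then show ?thesis
      unfolding anti[of _ _] by (simp add: sum_negf algebra_simps)
  qed (use ge assms in blast)
qed

lemma bezoutian_index:
  assumes "degree f \<le> d" "degree g \<le> d" "j < d" "l < d"
  shows "bezoutian d f g $$ (j, l) = (\<Sum>a\<le>d. \<Sum>b\<le>d. bez_coeff j l a b * coeff f a * coeff g b)"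
proof -
  define C where "C = mat d d (\<lambda>(j, l). \<Sum>a\<le>d. \<Sum>b\<le>d. bez_coeff j l a b * coeff f a * coeff g b)"
  have "bezoutian d f g = C"
  proof (rule bezoutian_eqI[OF assms(1,2)])
    fix t s :: real
    have "poly f t * poly g s - poly f s * poly g t =
       (\<Sum>a\<le>d. \<Sum>b\<le>d. (coeff f a * coeff g b) * (t ^ a * s ^ b - s ^ a * t ^ b))"
      unfolding poly_eq_sum_le[OF assms(1)] poly_eq_sum_le[OF assms(2)]
      by (simp add: sum_product right_diff_distrib sum_subtractf ac_simps)
    also have "\<dots> = (\<Sum>a\<le>d. \<Sum>b\<le>d. (coeff f a * coeff g b) * ((t - s) * (\<Sum>j<d. \<Sum>l<d. bez_coeff j l a b * t ^ j * s ^ l)))"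
      by (intro sum.cong refl) (simp add: bez_coeff_monomials)
    also have "\<dots> = (t - s) * (\<Sum>a\<le>d. \<Sum>b\<le>d. \<Sum>j<d. \<Sum>l<d. bez_coeff j l a b * coeff f a * coeff g b * t ^ j * s ^ l)"
      by (simp add: sum_distrib_left ac_simps)
    also have "(\<Sum>a\<le>d. \<Sum>b\<le>d. \<Sum>j<d. \<Sum>l<d. bez_coeff j l a b * coeff f a * coeff g b * t ^ j * s ^ l)
        = (\<Sum>a\<le>d. \<Sum>j<d. \<Sum>b\<le>d. \<Sum>l<d. bez_coeff j l a b * coeff f a * coeff g b * t ^ j * s ^ l)"
      by (rule sum.cong[OF refl], rule sum.swap)
    also have "\<dots> = (\<Sum>j<d. \<Sum>a\<le>d. \<Sum>b\<le>d. \<Sum>l<d. bez_coeff j l a b * coeff f a * coeff g b * t ^ j * s ^ l)"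
      by (rule sum.swap)
    also have "\<dots> = (\<Sum>j<d. \<Sum>a\<le>d. \<Sum>l<d. \<Sum>b\<le>d. bez_coeff j l a b * coeff f a * coeff g b * t ^ j * s ^ l)"
      by (rule sum.cong[OF refl], rule sum.cong[OF refl], rule sum.swap)
    also have "\<dots> = (\<Sum>j<d. \<Sum>l<d. \<Sum>a\<le>d. \<Sum>b\<le>d. bez_coeff j l a b * coeff f a * coeff g b * t ^ j * s ^ l)"
      by (rule sum.cong[OF refl], rule sum.swap)
    also have "\<dots> = (\<Sum>j<d. \<Sum>l<d. C $$ (j, l) * t ^ j * s ^ l)"
      by (intro sum.cong refl) (simp add: C_def sum_distrib_right)
    finally show "poly f t * poly g s - poly f s * poly g t = (t - s) * (\<Sum>j<d. \<Sum>l<d. C $$ (j, l) * t ^ j * s ^ l)" .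
  qed (simp add: C_def)
  with assms(3,4) show ?thesis by (simp add: C_def)
qed

section \<open>Restriction to lines and planes\<close>

lemma subst_homogeneous:
  assumes "p \<in> forms n d"
  shows "subst h (\<lambda>i. c * \<sigma> i) p = c ^ d * subst h \<sigma> p"
proof -
  have "mon_eval (\<lambda>i. c * \<sigma> i) \<alpha> = c ^ d * mon_eval \<sigma> \<alpha>" if "\<alpha> \<in> Poly_Mapping.keys p" for \<alpha>
  proof -
    have "mon_eval (\<lambda>i. c * \<sigma> i) \<alpha> = (\<Prod>i\<in>Poly_Mapping.keys \<alpha>. c ^ Poly_Mapping.lookup \<alpha> i) * mon_eval \<sigma> \<alpha>"
      by (simp add: mon_eval_def power_mult_distrib prod.distrib)
    also have "(\<Prod>i\<in>Poly_Mapping.keys \<alpha>. c ^ Poly_Mapping.lookup \<alpha> i) = c ^ d"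
      using assms that by (auto simp: forms_def simp flip: power_sum)
    finally show ?thesis .
  qed
  then show ?thesis
    by (simp add: subst_def sum_distrib_left mult.left_commute)
qed

text \<open>
  A property of families of ring elements that is preserved by sums and products is inherited by
  evaluation.  It serves to show that coefficients depend continuously on parameters.
\<close>

lemma subst_closed:
  fixes P :: "('e \<Rightarrow> 'a::comm_ring_1) \<Rightarrow> bool"
  assumes "P (\<lambda>_. 0)" "P (\<lambda>_. 1)" and add: "\<And>a b. P a \<Longrightarrow> P b \<Longrightarrow> P (\<lambda>e. a e + b e)"
    and mult: "\<And>a b. P a \<Longrightarrow> P b \<Longrightarrow> P (\<lambda>e. a e * b e)"
    and h: "\<And>c. P (\<lambda>_. h c)" and \<sigma>: "\<And>i. P (\<lambda>e. \<sigma> e i)"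
  shows "P (\<lambda>e. subst h (\<sigma> e) p)"
proof -
  have sum: "P (\<lambda>e. \<Sum>i\<in>A. f e i)" if "\<And>i. P (\<lambda>e. f e i)" for f and A :: "(nat \<Rightarrow>\<^sub>0 nat) set"
    by (induction A rule: infinite_finite_induct) (auto intro!: assms that)
  have prod: "P (\<lambda>e. \<Prod>i\<in>A. f e i)" if "\<And>i. P (\<lambda>e. f e i)" for f and A :: "nat set"
    by (induction A rule: infinite_finite_induct) (auto intro!: assms that)
  have pow: "P (\<lambda>e. f e ^ k)" if "P f" for f k
    by (induction k) (auto intro!: assms that)
  show ?thesis
    unfolding subst_def mon_eval_def by (intro sum mult prod pow h \<sigma>)
qed

lemma coeff_mult_closed:
  fixes P :: "('e \<Rightarrow> 'a::comm_ring_1) \<Rightarrow> bool"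
  assumes "P (\<lambda>_. 0)" and add: "\<And>a b. P a \<Longrightarrow> P b \<Longrightarrow> P (\<lambda>e. a e + b e)"
    and mult: "\<And>a b. P a \<Longrightarrow> P b \<Longrightarrow> P (\<lambda>e. a e * b e)"
    and A: "\<And>i. P (\<lambda>e. coeff (A e) i)" and B: "\<And>i. P (\<lambda>e. coeff (B e) i)"
  shows "P (\<lambda>e. coeff (A e * B e) k)"
proof -
  have sum: "P (\<lambda>e. \<Sum>i\<in>S. f e i)" if "\<And>i. P (\<lambda>e. f e i)" for f and S :: "nat set"
    by (induction S rule: infinite_finite_induct) (auto intro!: assms that)
  show ?thesis unfolding coeff_mult by (intro sum mult A B)
qed

lemma continuous_on_coeff_subst:
  fixes h :: "real \<Rightarrow> 'a::real_normed_field" and \<sigma> :: "'e::topological_space \<Rightarrow> nat \<Rightarrow> 'a poly"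
  assumes "\<And>i j. continuous_on S (\<lambda>e. coeff (\<sigma> e i) j)"
  shows "continuous_on S (\<lambda>e. coeff (subst (\<lambda>c. [:h c:]) (\<sigma> e) p) j)"
proof -
  have "\<forall>j. continuous_on S (\<lambda>e. coeff (subst (\<lambda>c. [:h c:]) (\<sigma> e) p) j)"
  proof (rule subst_closed[where P = "\<lambda>A :: 'e \<Rightarrow> 'a poly. \<forall>j. continuous_on S (\<lambda>e. coeff (A e) j)"])
    fix a b :: "'e \<Rightarrow> 'a poly" assume "\<forall>j. continuous_on S (\<lambda>e. coeff (a e) j)" "\<forall>j. continuous_on S (\<lambda>e. coeff (b e) j)"
    then show "\<forall>j. continuous_on S (\<lambda>e. coeff (a e * b e) j)"
      by (intro allI coeff_mult_closed[where P = "continuous_on S"]) (auto intro: continuous_intros)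
  qed (use assms in \<open>auto intro!: continuous_intros\<close>)
  then show ?thesis by blast
qed

lemma continuous_on_coeff_coeff_subst:
  fixes h :: "real \<Rightarrow> 'a::real_normed_field" and \<sigma> :: "'e::topological_space \<Rightarrow> nat \<Rightarrow> 'a poly poly"
  assumes "\<And>i j k. continuous_on S (\<lambda>e. coeff (coeff (\<sigma> e i) j) k)"
  shows "continuous_on S (\<lambda>e. coeff (coeff (subst (\<lambda>c. [:[:h c:]:]) (\<sigma> e) p) j) k)"
proof -
  let ?P = "\<lambda>A :: 'e \<Rightarrow> 'a poly. \<forall>k. continuous_on S (\<lambda>e. coeff (A e) k)"
  have mult: "?P (\<lambda>e. a e * b e)" if "?P a" "?P b" for a b :: "'e \<Rightarrow> 'a poly"
    using that by (intro allI coeff_mult_closed[where P = "continuous_on S"]) (auto intro: continuous_intros)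
  have "\<forall>j. ?P (\<lambda>e. coeff (subst (\<lambda>c. [:[:h c:]:]) (\<sigma> e) p) j)"
  proof (rule subst_closed[where P = "\<lambda>A :: 'e \<Rightarrow> 'a poly poly. \<forall>j. ?P (\<lambda>e. coeff (A e) j)"])
    fix a b :: "'e \<Rightarrow> 'a poly poly" assume ab: "\<forall>j. ?P (\<lambda>e. coeff (a e) j)" "\<forall>j. ?P (\<lambda>e. coeff (b e) j)"
    show "\<forall>j. ?P (\<lambda>e. coeff (a e * b e) j)"
    proof (rule allI, rule coeff_mult_closed[where P = "?P"])
      show "?P (\<lambda>e. x e * y e)" if "?P x" "?P y" for x y :: "'e \<Rightarrow> 'a poly" using mult that .
    qed (use ab in \<open>auto intro: continuous_intros\<close>)
  qed (use assms in \<open>auto intro!: continuous_intros simp: coeff_pCons split: nat.splits\<close>)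
  then show ?thesis by blast
qed

lemma graded_ring_UNIV: "graded_ring (\<lambda>_. UNIV)"
  by unfold_locales auto

lemma coeff_mult_top:
  fixes A B :: "'a::comm_ring_1 poly"
  assumes "degree A \<le> k" "degree B \<le> l"
  shows "coeff (A * B) (k + l) = coeff A k * coeff B l"
proof -
  have "coeff (A * B) (k + l) = (\<Sum>i\<le>k + l. coeff A i * coeff B (k + l - i))" by (rule coeff_mult)
  also have "\<dots> = (\<Sum>i\<in>{k}. coeff A i * coeff B (k + l - i))"
  proof (rule sum.mono_neutral_right)
    show "\<forall>i\<in>{..k + l} - {k}. coeff A i * coeff B (k + l - i) = 0"
    proof
      fix i assume "i \<in> {..k + l} - {k}"
      then consider "i > k" | "k + l - i > l" by force
      then show "coeff A i * coeff B (k + l - i) = 0"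
        by cases (use assms in \<open>auto simp: coeff_eq_0\<close>)
    qed
  qed auto
  finally show ?thesis by simp
qed

text \<open>
  Only the top coefficient $u_i$ of each factor $x_i + tu_i$ contributes to $t^d$.
\<close>

lemma subst_line_top:
  fixes h :: "real \<Rightarrow> 'a::comm_ring_1"
  assumes p: "p \<in> forms n d"
  shows "degree (subst (\<lambda>c. [:h c:]) (\<lambda>i. [:x i, u i:]) p) \<le> d"
    and "coeff (subst (\<lambda>c. [:h c:]) (\<lambda>i. [:x i, u i:]) p) d = subst h u p"
proof -
  let ?L = "\<lambda>i. [:x i, u i:]"
  have "subst (\<lambda>c. [:h c:]) ?L p \<in> graded_poly (\<lambda>_. UNIV) d"
    by (rule graded_ring.subst_graded[OF graded_ring_poly[OF graded_ring_UNIV] p])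
      (auto simp: graded_poly_def coeff_pCons split: nat.splits)
  then show "degree (subst (\<lambda>c. [:h c:]) ?L p) \<le> d"
    by (intro degree_le) (auto simp: graded_poly_def)
  have pow: "degree (?L i ^ k) \<le> k \<and> coeff (?L i ^ k) k = u i ^ k" for i k
  proof (induction k)
    case (Suc k)
    have 1: "degree (?L i) \<le> 1" by simp
    have "coeff (?L i * ?L i ^ k) (1 + k) = coeff (?L i) 1 * coeff (?L i ^ k) k"
      by (rule coeff_mult_top) (use Suc in auto)
    moreover have "degree (?L i * ?L i ^ k) \<le> 1 + k"
      using degree_mult_le[of "?L i" "?L i ^ k"] 1 Suc by linarith
    ultimately show ?case using Suc by simp
  qed simp
  have prod: "degree (\<Prod>i\<in>A. ?L i ^ a i) \<le> (\<Sum>i\<in>A. a i) \<and>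
      coeff (\<Prod>i\<in>A. ?L i ^ a i) (\<Sum>i\<in>A. a i) = (\<Prod>i\<in>A. u i ^ a i)" if "finite A" for A a
    using that
  proof (induction A)
    case (insert j A)
    have "coeff (?L j ^ a j * (\<Prod>i\<in>A. ?L i ^ a i)) (a j + (\<Sum>i\<in>A. a i))
        = coeff (?L j ^ a j) (a j) * coeff (\<Prod>i\<in>A. ?L i ^ a i) (\<Sum>i\<in>A. a i)"
      by (rule coeff_mult_top) (use insert pow in auto)
    moreover have "degree (?L j ^ a j * (\<Prod>i\<in>A. ?L i ^ a i)) \<le> a j + (\<Sum>i\<in>A. a i)"
      using degree_mult_le[of "?L j ^ a j" "\<Prod>i\<in>A. ?L i ^ a i"] pow[of j "a j"] insert by linarith
    ultimately show ?case using insert pow by simp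
  qed simp
  have "coeff (mon_eval ?L \<alpha>) d = mon_eval u \<alpha>" if "\<alpha> \<in> Poly_Mapping.keys p" for \<alpha>
    using prod[of "Poly_Mapping.keys \<alpha>" "Poly_Mapping.lookup \<alpha>"] p that
    by (auto simp: mon_eval_def forms_def)
  then show "coeff (subst (\<lambda>c. [:h c:]) ?L p) d = subst h u p"
    by (simp add: subst_def coeff_sum)
qed

lemma poly_subst: "poly (subst (\<lambda>c. [:h c:]) \<sigma> p) t = subst h (\<lambda>i. poly (\<sigma> i) t) p"
  using subst_hom[of "\<lambda>q. poly q t" "\<lambda>c. [:h c:]" \<sigma> p] by simp

text \<open>
  $p(x + tu + sv)$ as a polynomial in $s$ whose coefficients are polynomials in $t$.  Its coefficients
  of $s^0$ and $s^1$ are $p(x + tu)$ and $D_vp(x + tu)$.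
\<close>

definition plane_poly :: "(nat \<Rightarrow> real) \<Rightarrow> (nat \<Rightarrow> real) \<Rightarrow> (nat \<Rightarrow> real) \<Rightarrow> mpoly \<Rightarrow> real poly poly" where
  "plane_poly x u v p = subst (\<lambda>c. [:[:c:]:]) (\<lambda>i. [:[:x i, u i:], [:v i:]:]) p"

lemma map_poly_hom_mult:
  assumes "F 0 = 0" "\<And>a b. F (a + b) = F a + F b" "\<And>a b. F (a * b) = F a * F b"
  shows "map_poly F (A * B) = map_poly F A * map_poly F B"
proof -
  have sum: "F (\<Sum>i\<in>S. f i) = (\<Sum>i\<in>S. F (f i))" for f and S :: "nat set"
    by (induction S rule: infinite_finite_induct) (auto simp: assms)
  show ?thesis by (rule poly_eqI) (simp add: coeff_map_poly coeff_mult sum assms)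
qed

lemma map_poly_subst:
  assumes F: "F 0 = 0" "F 1 = 1" "\<And>a b. F (a + b) = F a + F b" "\<And>a b. F (a * b) = F a * F b"
  shows "map_poly F (subst h \<sigma> p) = subst (\<lambda>c. map_poly F (h c)) (\<lambda>i. map_poly F (\<sigma> i)) p"
proof (rule subst_hom)
  show "map_poly F (a + b) = map_poly F a + map_poly F b" for a b
    by (rule poly_eqI) (simp add: coeff_map_poly F)
  show "map_poly F (a * b) = map_poly F a * map_poly F b" for a b
    by (rule map_poly_hom_mult) (auto simp: F)
qed (auto simp: F map_poly_1')

lemma map_plane_poly:
  assumes F: "F 0 = 0" "F 1 = 1" "\<And>a b. F (a + b) = F a + F b" "\<And>a b. F (a * b) = F a * F b"
  shows "map_poly F (plane_poly x u v p)
    = subst (\<lambda>c. [:F [:c:]:]) (\<lambda>i. [:F [:x i, u i:], F [:v i:]:]) p"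
  unfolding plane_poly_def
  by (subst map_poly_subst) (auto simp: F map_poly_pCons)

lemma line_poly_mpeval_eq:
  assumes "p \<in> forms n d" "x \<in> carrier_vec n" "u \<in> carrier_vec n"
  shows "line_poly (mpeval p) x u = subst (\<lambda>c. [:c:]) (\<lambda>i. [:x $ i, u $ i:]) p"
proof (rule line_poly_eqI)
  fix t
  show "poly (subst (\<lambda>c. [:c:]) (\<lambda>i. [:x $ i, u $ i:]) p) t = mpeval p (x + t \<cdot>\<^sub>v u)"
    unfolding poly_subst mpeval_eq_subst
    by (rule subst_cong[OF assms(1)]) (use assms in auto)
qed

lemma line_poly_dir_deriv_eq:
  assumes p: "p \<in> forms n d" and x: "x \<in> carrier_vec n" and u: "u \<in> carrier_vec n" and v: "v \<in> carrier_vec n"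
  shows "line_poly (dir_deriv v (mpeval p)) x u = coeff (plane_poly (($) x) (($) u) (($) v) p) 1"
proof (rule line_poly_eqI)
  fix t
  define W where "W = subst (\<lambda>c. [:c:]) (\<lambda>i. [:x $ i + t * u $ i, v $ i:]) p"
  have "mpeval p (x + t \<cdot>\<^sub>v u + s \<cdot>\<^sub>v v) = poly W s" for s
    unfolding W_def poly_subst mpeval_eq_subst
    by (rule subst_cong[OF p]) (use x u v in auto)
  then have "dir_deriv v (mpeval p) (x + t \<cdot>\<^sub>v u) = deriv (poly W) 0"
    by (simp add: dir_deriv_def)
  also have "\<dots> = coeff W 1"
    using DERIV_imp_deriv[OF poly_DERIV[of W 0]] by (simp add: poly_0_coeff_0 coeff_pderiv)
  also have "W = map_poly (\<lambda>q. poly q t) (plane_poly (($) x) (($) u) (($) v) p)"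
    by (subst map_plane_poly) (auto simp: W_def)
  also have "coeff \<dots> 1 = poly (coeff (plane_poly (($) x) (($) u) (($) v) p) 1) t"
    by (simp add: coeff_map_poly)
  finally show "poly (coeff (plane_poly (($) x) (($) u) (($) v) p) 1) t = dir_deriv v (mpeval p) (x + t \<cdot>\<^sub>v u)" ..
qed

lemma coeff_plane_poly_0: "coeff (plane_poly x u v p) 0 = subst (\<lambda>c. [:c:]) (\<lambda>i. [:x i, u i:]) p"
proof -
  have "poly (plane_poly x u v p) 0 = subst (\<lambda>c. [:c:]) (\<lambda>i. [:x i, u i:]) p"
    unfolding plane_poly_def using poly_subst[of "\<lambda>c. [:c:]" "\<lambda>i. [:[:x i, u i:], [:v i:]:]" p 0] by simp
  then show ?thesis by (simp add: poly_0_coeff_0)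
qed

section \<open>Hyperbolicity and positivity of the Bezoutian\<close>

lemma continuous_on_coeff_linear:
  assumes "continuous_on S A" "continuous_on S B"
  shows "continuous_on S (\<lambda>e. coeff [:A e, B e:] j)"
proof -
  have "coeff [:A e, B e:] j = (if j = 0 then A e else if j = 1 then B e else 0)" for e
    by (auto simp: coeff_pCons split: nat.splits)
  then show ?thesis using assms by (cases "j = 0"; cases "j = 1") simp_all
qed

lemma continuous_on_coeff_coeff_linear:
  assumes "continuous_on S A" "continuous_on S B" "continuous_on S C"
  shows "continuous_on S (\<lambda>e. coeff (coeff [:[:A e, B e:], [:C e:]:] j) k)"
proof -
  have "coeff (coeff [:[:A e, B e:], [:C e:]:] j) k = (if j = 0 then coeff [:A e, B e:] k
      else if j = 1 then (if k = 0 then C e else 0) else 0)" for e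
    by (auto simp: coeff_pCons split: nat.splits)
  then show ?thesis using assms continuous_on_coeff_linear[OF assms(1,2), of k]
    by (cases "j = 0"; cases "j = 1"; cases "k = 0") simp_all
qed

abbreviation ceval :: "mpoly \<Rightarrow> (nat \<Rightarrow> complex) \<Rightarrow> complex" where
  "ceval p z \<equiv> subst complex_of_real z p"

lemma ceval_of_real: "ceval p (\<lambda>i. of_real (x i)) = of_real (subst (\<lambda>c. c) x p)"
  by (subst subst_hom[of complex_of_real]) auto

lemma poly_cpoly_subst:
  "poly (cpoly (subst (\<lambda>c. [:c:]) (\<lambda>i. [:x i, u i:]) p)) z = ceval p (\<lambda>i. of_real (x i) + z * of_real (u i))"
proof -
  have "poly (cpoly (subst (\<lambda>c. [:c:]) (\<lambda>i. [:x i, u i:]) p)) z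
      = subst (\<lambda>c. poly (cpoly [:c:]) z) (\<lambda>i. poly (cpoly [:x i, u i:]) z) p"
  proof (rule subst_hom)
    show "poly (cpoly (a + b)) z = poly (cpoly a) z + poly (cpoly b) z" for a b
    proof -
      have "cpoly (a + b) = cpoly a + cpoly b" by (rule poly_eqI) (simp add: coeff_map_poly)
      then show ?thesis by simp
    qed
  qed (auto simp: cpoly_mult map_poly_1')
  then show ?thesis by (simp add: map_poly_pCons)
qed

locale hyperbolic =
  fixes p :: mpoly and n d :: nat and e :: "nat \<Rightarrow> real"
  assumes form: "p \<in> forms n d"
    and real_roots: "\<And>x z. ceval p (\<lambda>i. of_real (x i) + z * of_real (e i)) = 0 \<Longrightarrow> z \<in> \<real>"
begin

text \<open>
  For $a$ in the closed hyperbolicity cone and $\epsilon > 0$, the point $a + \epsilon e$ satisfies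
  this condition.
\<close>

definition interior_cone :: "(nat \<Rightarrow> real) \<Rightarrow> bool" where
  "interior_cone a \<longleftrightarrow> (\<forall>t\<ge>0. subst (\<lambda>c. c) (\<lambda>i. a i + t * e i) p \<noteq> 0)"

lemma interior_cone_nonzero:
  assumes "interior_cone a"
  shows "subst (\<lambda>c. c) a p \<noteq> 0"
proof -
  have "subst (\<lambda>c. c) (\<lambda>i. a i + 0 * e i) p \<noteq> 0"
    using assms unfolding interior_cone_def by blast
  then show ?thesis by simp
qed

lemma ceval_imaginary_shift:
  assumes "\<alpha> > 0"
  shows "ceval p (\<lambda>i. of_real (x i) + \<i> * of_real \<alpha> * of_real (e i)) \<noteq> 0"
proof
  assume "ceval p (\<lambda>i. of_real (x i) + \<i> * of_real \<alpha> * of_real (e i)) = 0"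
  then have "\<i> * of_real \<alpha> \<in> \<real>" by (rule real_roots)
  then have "Im (\<i> * of_real \<alpha>) = 0" by (simp add: complex_is_Real_iff)
  with assms show False by simp
qed

text \<open>
  This is Garding's argument.  Scale $x$ from 0 to its actual value.  A real root $t$ would contradict
  hyperbolicity in direction $e$, because $i\alpha$ is not real.  For $x = 0$ homogeneity turns a root
  $t$ into the real root $i\alpha / t$ of $p(a + re)$, which is negative, so $\mathrm{Im}\, t < 0$.
\<close>

lemma no_upper_roots_one_direction:
  assumes a: "interior_cone a" and \<alpha>: "\<alpha> > 0" and t: "Im t \<ge> 0"
  shows "ceval p (\<lambda>i. of_real (x i) + \<i> * of_real \<alpha> * of_real (e i) + t * of_real (a i)) \<noteq> 0"
proof -
  define h where "h = (\<lambda>\<kappa>::real. subst (\<lambda>c. [:complex_of_real c:])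
    (\<lambda>i. [:of_real (\<kappa> * x i) + \<i> * of_real \<alpha> * of_real (e i), of_real (a i):]) p)"
  have eval: "poly (h \<kappa>) t = ceval p (\<lambda>i. of_real (\<kappa> * x i) + \<i> * of_real \<alpha> * of_real (e i) + t * of_real (a i))" for \<kappa> t
    unfolding h_def poly_subst by simp
  have "poly (h 1) t \<noteq> 0"
  proof (rule homotopy_no_upper_roots[OF _ _ _ _ _ _ t])
    show "continuous_on {0..1} (\<lambda>\<kappa>. coeff (h \<kappa>) i)" for i
      unfolding h_def
      by (intro continuous_on_coeff_subst continuous_on_coeff_linear continuous_intros)
    show "degree (h \<kappa>) \<le> d" "coeff (h \<kappa>) d = of_real (subst (\<lambda>c. c) a p)" for \<kappa>
      unfolding h_def subst_line_top(2)[OF form] by (rule subst_line_top(1)[OF form]) (rule ceval_of_real)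
    show "complex_of_real (subst (\<lambda>c. c) a p) \<noteq> 0" using interior_cone_nonzero[OF a] by simp
    show "poly (h \<kappa>) t \<noteq> 0" if "Im t = 0" for \<kappa> t
    proof -
      have "t = of_real (Re t)" using that by (simp add: complex_eq_iff)
      then have "poly (h \<kappa>) t = ceval p (\<lambda>i. of_real (\<kappa> * x i + Re t * a i) + \<i> * of_real \<alpha> * of_real (e i))"
        unfolding eval by (intro arg_cong2[of _ _ _ _ "subst complex_of_real"] ext refl) (simp add: algebra_simps)
      then show ?thesis by (simp only: ceval_imaginary_shift[OF \<alpha>] not_False_eq_True)
    qed
    show "poly (h 0) t \<noteq> 0" if t: "Im t \<ge> 0" for t
    proof
      assume 0: "poly (h 0) t = 0"
      have "t \<noteq> 0"
      proof
        assume "t = 0"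
        with 0 ceval_imaginary_shift[OF \<alpha>, of "\<lambda>_. 0"] show False unfolding eval by simp
      qed
      have "ceval p (\<lambda>i. t * (of_real (a i) + (\<i> * of_real \<alpha> / t) * of_real (e i))) = 0"
        using 0 \<open>t \<noteq> 0\<close> unfolding eval by (simp add: algebra_simps)
      then have z: "ceval p (\<lambda>i. of_real (a i) + (\<i> * of_real \<alpha> / t) * of_real (e i)) = 0"
        using \<open>t \<noteq> 0\<close> by (simp add: subst_homogeneous[OF form])
      then have "\<i> * of_real \<alpha> / t \<in> \<real>" by (rule real_roots)
      then obtain r where r: "\<i> * of_real \<alpha> / t = of_real r" by (elim Reals_cases)
      have "ceval p (\<lambda>i. of_real (a i + r * e i)) = 0" using z unfolding r by simp
      then have "subst (\<lambda>c. c) (\<lambda>i. a i + r * e i) p = 0" unfolding ceval_of_real by simp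
      then have "r < 0" using a unfolding interior_cone_def by (meson not_le)
      have "\<i> * of_real \<alpha> = of_real r * t" using r \<open>t \<noteq> 0\<close> by (simp add: field_simps)
      then have "\<alpha> = r * Im t" by (metis Im_i_times Re_complex_of_real Im_complex_of_real times_complex.sel(2) mult_zero_left add_0_right)
      moreover have "r * Im t \<le> 0" using \<open>r < 0\<close> t by (simp add: mult_nonpos_nonneg)
      ultimately show False using \<alpha> by linarith
    qed
  qed
  then show ?thesis unfolding eval by simp
qed

text \<open>
  The same homotopy in the direction $b$: real roots $s$ are now excluded by the statement for the
  single direction $a$, and the initial situation is the statement for the single direction $b$.
\<close>

lemma no_upper_roots_two_directions:
  assumes a: "interior_cone a" and b: "interior_cone b" and \<alpha>: "\<alpha> > 0" and t: "Im t \<ge> 0" and s: "Im s \<ge> 0"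
  shows "ceval p (\<lambda>i. of_real (x i) + \<i> * of_real \<alpha> * of_real (e i) + t * of_real (a i) + s * of_real (b i)) \<noteq> 0"
proof -
  define h where "h = (\<lambda>\<kappa>::real. subst (\<lambda>c. [:complex_of_real c:])
    (\<lambda>i. [:of_real \<kappa> * (of_real (x i) + t * of_real (a i)) + \<i> * of_real \<alpha> * of_real (e i), of_real (b i):]) p)"
  have eval: "poly (h \<kappa>) s = ceval p (\<lambda>i. of_real \<kappa> * (of_real (x i) + t * of_real (a i)) + \<i> * of_real \<alpha> * of_real (e i) + s * of_real (b i))" for \<kappa> s
    unfolding h_def poly_subst by simp
  have "poly (h 1) s \<noteq> 0"
  proof (rule homotopy_no_upper_roots[OF _ _ _ _ _ _ s])
    show "continuous_on {0..1} (\<lambda>\<kappa>. coeff (h \<kappa>) i)" for i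
      unfolding h_def
      by (intro continuous_on_coeff_subst continuous_on_coeff_linear continuous_intros)
    show "degree (h \<kappa>) \<le> d" "coeff (h \<kappa>) d = of_real (subst (\<lambda>c. c) b p)" for \<kappa>
      unfolding h_def subst_line_top(2)[OF form] by (rule subst_line_top(1)[OF form]) (rule ceval_of_real)
    show "complex_of_real (subst (\<lambda>c. c) b p) \<noteq> 0" using interior_cone_nonzero[OF b] by simp
    show "poly (h \<kappa>) s \<noteq> 0" if "\<kappa> \<in> {0..1}" "Im s = 0" for \<kappa> s
    proof -
      have "s = of_real (Re s)" using that by (simp add: complex_eq_iff)
      then have "poly (h \<kappa>) s = ceval p (\<lambda>i. of_real (\<kappa> * x i + Re s * b i) + \<i> * of_real \<alpha> * of_real (e i)
          + (of_real \<kappa> * t) * of_real (a i))"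
        unfolding eval by (intro arg_cong2[of _ _ _ _ "subst complex_of_real"] ext refl) (simp add: algebra_simps)
      moreover have "Im (of_real \<kappa> * t) \<ge> 0" using t that by simp
      ultimately show ?thesis
        by (simp only: no_upper_roots_one_direction[OF a \<alpha>] not_False_eq_True)
    qed
    show "poly (h 0) s \<noteq> 0" if s: "Im s \<ge> 0" for s
      using no_upper_roots_one_direction[OF b \<alpha> s, of "\<lambda>_. 0"] unfolding eval by simp
  qed
  then show ?thesis unfolding eval by (simp add: ac_simps)
qed

text \<open>
  The component $\beta e$ of the first direction supplies the imaginary shift by a multiple of $e$.
\<close>

lemma stable_pencil:
  assumes a: "interior_cone a" and b: "interior_cone b" and \<beta>: "\<beta> > 0" and t: "Im t > 0" and s: "Im s \<ge> 0"
  shows "ceval p (\<lambda>i. of_real (x i) + t * of_real (a i + \<beta> * e i) + s * of_real (b i)) \<noteq> 0"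
proof -
  have "ceval p (\<lambda>i. of_real (x i) + t * of_real (a i + \<beta> * e i) + s * of_real (b i))
      = ceval p (\<lambda>i. of_real (x i + Re t * \<beta> * e i) + \<i> * of_real (Im t * \<beta>) * of_real (e i)
          + t * of_real (a i) + s * of_real (b i))"
    by (intro arg_cong2[of _ _ _ _ "subst complex_of_real"] ext refl)
      (simp add: complex_eq_iff algebra_simps)
  also have "\<dots> \<noteq> 0"
    by (rule no_upper_roots_two_directions[OF a b]) (use \<beta> t s in auto)
  finally show ?thesis .
qed

text \<open>
  For $\mathrm{Im}\, t > 0$ the polynomial $s \mapsto p(x + tu + sb)$ has no roots in the closed upper
  half plane, so its logarithmic derivative at $s = 0$, which is $g(t)/f(t)$, has non-positive
  imaginary part.  Partial fractions then exhibit the Bezoutian as a sum of squares.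
\<close>

lemma bezoutian_psd_interior:
  fixes x :: "nat \<Rightarrow> real"
  assumes a: "interior_cone a" and b: "interior_cone b" and \<beta>: "\<beta> > 0" and \<xi>: "\<xi> \<in> carrier_vec d"
    and f_def: "f = coeff (plane_poly x (\<lambda>i. a i + \<beta> * e i) b p) 0"
    and g_def: "g = coeff (plane_poly x (\<lambda>i. a i + \<beta> * e i) b p) 1"
  shows "0 \<le> \<xi> \<bullet> (bezoutian d f g *\<^sub>v \<xi>)"
proof -
  define u where "u = (\<lambda>i. a i + \<beta> * e i)"
  define V where "V = plane_poly x u b p"
  define W where "W = (\<lambda>t. subst (\<lambda>c. [:complex_of_real c:]) (\<lambda>i. [:of_real (x i) + t * of_real (u i), of_real (b i):]) p)"
  have cadd: "cpoly (a + b) = cpoly a + cpoly b" for a b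
    by (rule poly_eqI) (simp add: coeff_map_poly)
  have map_V: "map_poly (\<lambda>q. poly (cpoly q) t) V = W t" for t
    unfolding V_def W_def
    by (subst map_plane_poly) (auto simp: cadd cpoly_mult map_poly_1' map_poly_pCons)
  have fW: "poly (cpoly f) t = coeff (W t) 0" for t
    using arg_cong[OF map_V[of t], of "\<lambda>q. coeff q 0"] by (simp add: coeff_map_poly f_def V_def u_def)
  have gW: "poly (cpoly g) t = coeff (W t) 1" for t
    using arg_cong[OF map_V[of t], of "\<lambda>q. coeff q 1"] by (simp add: coeff_map_poly g_def V_def u_def)
  have W: "poly (W t) s \<noteq> 0" if "Im t > 0" "Im s \<ge> 0" for t s
    unfolding W_def poly_subst using stable_pencil[OF a b \<beta> that, of x] by (simp add: u_def)
  have f_up: "poly (cpoly f) t \<noteq> 0" if "Im t > 0" for t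
    using W[OF that, of 0] unfolding fW by (simp add: poly_0_coeff_0)
  have "interior_cone u"
    unfolding interior_cone_def
  proof (intro allI impI)
    fix t :: real assume "t \<ge> 0"
    then have "subst (\<lambda>c. c) (\<lambda>i. a i + (\<beta> + t) * e i) p \<noteq> 0"
      using a \<beta> unfolding interior_cone_def by simp
    then show "subst (\<lambda>c. c) (\<lambda>i. u i + t * e i) p \<noteq> 0"
      by (simp add: u_def algebra_simps)
  qed
  then have lead: "coeff f d \<noteq> 0"
    using interior_cone_nonzero unfolding f_def u_def[symmetric] coeff_plane_poly_0 subst_line_top(2)[OF form] by simp
  have degf: "degree f \<le> d"
    unfolding f_def u_def[symmetric] coeff_plane_poly_0 by (rule subst_line_top(1)[OF form])
  then have degf': "degree f = d" using lead le_degree le_antisym by blast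
  have f0: "f \<noteq> 0" using lead by auto
  have V: "V \<in> graded_poly (graded_poly (\<lambda>_. UNIV)) d"
    unfolding V_def plane_poly_def
    by (rule graded_ring.subst_graded[OF graded_ring_poly[OF graded_ring_poly[OF graded_ring_UNIV]] form])
      (auto simp: graded_poly_def coeff_pCons split: nat.splits)
  have degg: "g = 0 \<or> degree g < degree f"
  proof (cases d)
    case 0
    then show ?thesis using V unfolding g_def V_def u_def by (auto simp: graded_poly_def)
  next
    case (Suc k)
    then have "g \<in> graded_poly (\<lambda>_. UNIV) k" using V unfolding g_def V_def u_def by (auto simp: graded_poly_def)
    then have "degree g \<le> k" by (intro degree_le) (auto simp: graded_poly_def)
    then show ?thesis using Suc degf' by simp
  qed
  have cnj_poly: "poly (cpoly f) (cnj z) = cnj (poly (cpoly f) z)" for z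
    by (induction f) (simp_all add: map_poly_pCons)
  have real: "z \<in> \<real>" if "poly (cpoly f) z = 0" for z
  proof -
    have "\<not> Im z > 0" using f_up that by blast
    moreover have "\<not> Im (cnj z) > 0" using f_up[of "cnj z"] that cnj_poly by force
    ultimately show ?thesis by (simp add: complex_is_Real_iff)
  qed
  have herg: "Im (poly (cpoly g) t * cnj (poly (cpoly f) t)) \<le> 0" if t: "Im t > 0" for t
  proof -
    have "Im (coeff (W t) 1 / coeff (W t) 0) \<le> 0"
      by (rule Im_log_derivative_nonpos) (rule W[OF t])
    then have "Im (poly (cpoly g) t / poly (cpoly f) t) \<le> 0" by (simp add: fW gW)
    moreover have "poly (cpoly g) t * cnj (poly (cpoly f) t)
        = of_real ((norm (poly (cpoly f) t))\<^sup>2) * (poly (cpoly g) t / poly (cpoly f) t)"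
      using f_up[OF t] by (simp only: complex_norm_square) (simp add: field_simps)
    then have "Im (poly (cpoly g) t * cnj (poly (cpoly f) t))
        = (norm (poly (cpoly f) t))\<^sup>2 * Im (poly (cpoly g) t / poly (cpoly f) t)"
      by (simp only: Im_complex_of_real Re_complex_of_real times_complex.sel)
    ultimately show ?thesis by (simp add: mult_nonneg_nonpos)
  qed
  obtain Z m q where Z: "finite Z" "\<forall>l\<in>Z. m l \<ge> 0 \<and> f = [:- l, 1:] * q l"
      "g = (\<Sum>l\<in>Z. Polynomial.smult (m l) (q l))"
    using herglotz_partial_fractions[OF f0 degg real herg] by blast
  show ?thesis
    by (rule bezoutian_psd_of_partial_fractions[OF f0 degf Z(1) _ Z(3) \<xi>]) (use Z(2) in blast)
qed

end

lemma par_bezoutian_eq: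
  assumes "p \<in> forms n d" "x \<in> carrier_vec n" "u \<in> carrier_vec n" "v \<in> carrier_vec n"
  shows "par_bezoutian d p u v x = bezoutian d (coeff (plane_poly (($) x) (($) u) (($) v) p) 0)
    (coeff (plane_poly (($) x) (($) u) (($) v) p) 1)"
  unfolding par_bezoutian_def line_poly_mpeval_eq[OF assms(1-3)] line_poly_dir_deriv_eq[OF assms] coeff_plane_poly_0 ..

lemma coeff_plane_poly_degrees:
  assumes "p \<in> forms n d"
  shows "degree (coeff (plane_poly x u v p) 0) \<le> d" "degree (coeff (plane_poly x u v p) 1) \<le> d"
proof -
  have V: "plane_poly x u v p \<in> graded_poly (graded_poly (\<lambda>_. UNIV)) d"
    unfolding plane_poly_def
    by (rule graded_ring.subst_graded[OF graded_ring_poly[OF graded_ring_poly[OF graded_ring_UNIV]] assms])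
      (auto simp: graded_poly_def coeff_pCons split: nat.splits)
  then show "degree (coeff (plane_poly x u v p) 0) \<le> d"
    by (intro degree_le) (auto simp: graded_poly_def)
  show "degree (coeff (plane_poly x u v p) 1) \<le> d"
  proof (cases "d \<ge> 1")
    case True
    then show ?thesis using V by (intro degree_le) (auto simp: graded_poly_def)
  qed (use V in \<open>auto simp: graded_poly_def\<close>)
qed

lemma par_bezoutian_carrier:
  assumes "p \<in> forms n d" "x \<in> carrier_vec n" "u \<in> carrier_vec n" "v \<in> carrier_vec n"
  shows "par_bezoutian d p u v x \<in> carrier_mat d d"
  using theI'[OF ex1_bezoutian[OF coeff_plane_poly_degrees[OF assms(1)]]]
  unfolding par_bezoutian_eq[OF assms] bezoutian_def by blast

text \<open>
  The boundary case of the cone follows by continuity from $u + 2\epsilon e$ and $v + \epsilon e$.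
\<close>

lemma par_bezoutian_psd:
  assumes p: "p \<in> Hyp n d e" and e: "e \<in> carrier_vec n"
    and u: "u \<in> hyp_cone n p e" and v: "v \<in> hyp_cone n p e"
    and x: "x \<in> carrier_vec n" and \<xi>: "\<xi> \<in> carrier_vec d"
  shows "0 \<le> \<xi> \<bullet> (par_bezoutian d p u v x *\<^sub>v \<xi>)"
proof -
  have form: "p \<in> forms n d" using p by (simp add: Hyp_def)
  have uc: "u \<in> carrier_vec n" and vc: "v \<in> carrier_vec n" using u v by (auto simp: hyp_cone_def)
  interpret hyperbolic p n d "($) e"
  proof
    show "p \<in> forms n d" by (rule form)
    fix w :: "nat \<Rightarrow> real" and z :: complex
    assume 0: "ceval p (\<lambda>i. of_real (w i) + z * of_real (e $ i)) = 0"
    define y where "y = vec n (\<lambda>i. - w i)"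
    have y: "y \<in> carrier_vec n" "- y \<in> carrier_vec n" by (auto simp: y_def)
    have "poly (cpoly (line_poly (mpeval p) (- y) e)) z = ceval p (\<lambda>i. of_real ((- y) $ i) + z * of_real (e $ i))"
      unfolding line_poly_mpeval_eq[OF form y(2) e] by (rule poly_cpoly_subst)
    also have "\<dots> = ceval p (\<lambda>i. of_real (w i) + z * of_real (e $ i))"
      by (rule subst_cong[OF form]) (simp add: y_def)
    finally have root: "poly (cpoly (line_poly (mpeval p) (- y) e)) z = 0" using 0 by simp
    have "\<forall>y\<in>carrier_vec n. \<forall>z. poly (cpoly (line_poly (mpeval p) (- y) e)) z = 0 \<longrightarrow> z \<in> \<real>"
      using p by (simp add: Hyp_def)
    from this[rule_format, OF y(1) root] show "z \<in> \<real>" .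
  qed
  have cone: "interior_cone (\<lambda>i. w $ i + \<epsilon> * e $ i)" if w: "w \<in> hyp_cone n p e" and \<epsilon>: "\<epsilon> > 0" for w \<epsilon>
    unfolding interior_cone_def
  proof (intro allI impI notI)
    fix t :: real assume t: "t \<ge> 0" and 0: "subst (\<lambda>c. c) (\<lambda>i. w $ i + \<epsilon> * e $ i + t * e $ i) p = 0"
    have wc: "w \<in> carrier_vec n" "- w \<in> carrier_vec n" using w by (auto simp: hyp_cone_def)
    have "subst (\<lambda>c. c) (\<lambda>i. w $ i + \<epsilon> * e $ i + t * e $ i) p
        = subst (\<lambda>c. c) (\<lambda>i. (- 1) * ((- w) $ i + (- (\<epsilon> + t)) * e $ i)) p"
      by (rule subst_cong[OF form]) (use wc in \<open>simp add: algebra_simps\<close>)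
    also have "\<dots> = (- 1) ^ d * poly (line_poly (mpeval p) (- w) e) (- (\<epsilon> + t))"
      unfolding subst_homogeneous[OF form] line_poly_mpeval_eq[OF form wc(2) e] poly_subst by simp
    finally have "poly (line_poly (mpeval p) (- w) e) (- (\<epsilon> + t)) = 0" using 0 by simp
    then have "- (\<epsilon> + t) \<ge> 0" using w unfolding hyp_cone_def by blast
    with t \<epsilon> show False by simp
  qed
  \<comment> \<open>one multiple of $\epsilon e$ moves $u$ into the interior of the cone, the other one is the shift $\beta e$\<close>
  define V where "V = (\<lambda>\<epsilon>. plane_poly (($) x) (\<lambda>i. u $ i + \<epsilon> * e $ i + \<epsilon> * e $ i) (\<lambda>i. v $ i + \<epsilon> * e $ i) p)"
  define \<phi> where "\<phi> = (\<lambda>\<epsilon>. \<xi> \<bullet> (bezoutian d (coeff (V \<epsilon>) 0) (coeff (V \<epsilon>) 1) *\<^sub>v \<xi>))"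
  have carrier: "bezoutian d (coeff (V \<epsilon>) 0) (coeff (V \<epsilon>) 1) \<in> carrier_mat d d" for \<epsilon>
    using theI'[OF ex1_bezoutian[OF coeff_plane_poly_degrees[OF form]]]
    unfolding V_def bezoutian_def by blast
  have "\<phi> \<epsilon> \<ge> 0" if "\<epsilon> > 0" for \<epsilon>
    unfolding \<phi>_def
  proof (rule bezoutian_psd_interior[OF cone[OF u that] cone[OF v that] that \<xi>])
    show "coeff (V \<epsilon>) 0 = coeff (plane_poly (($) x) (\<lambda>i. u $ i + \<epsilon> * e $ i + \<epsilon> * e $ i) (\<lambda>i. v $ i + \<epsilon> * e $ i) p) 0"
      "coeff (V \<epsilon>) 1 = coeff (plane_poly (($) x) (\<lambda>i. u $ i + \<epsilon> * e $ i + \<epsilon> * e $ i) (\<lambda>i. v $ i + \<epsilon> * e $ i) p) 1"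
      by (simp_all only: V_def)
  qed
  then have "eventually (\<lambda>\<epsilon>. \<phi> \<epsilon> \<ge> 0) (at_right 0)"
    by (auto simp: eventually_at_filter intro!: always_eventually)
  moreover have "(\<phi> \<longlongrightarrow> \<phi> 0) (at_right 0)"
  proof -
    have "\<phi> \<epsilon> = (\<Sum>j<d. \<Sum>l<d. (\<Sum>a\<le>d. \<Sum>b\<le>d. bez_coeff j l a b * coeff (coeff (V \<epsilon>) 0) a * coeff (coeff (V \<epsilon>) 1) b) * \<xi> $ j * \<xi> $ l)" for \<epsilon>
      unfolding \<phi>_def quadratic_form_eq_sum[OF carrier \<xi>]
      by (intro sum.cong refl)
        (use coeff_plane_poly_degrees[OF form] in \<open>simp add: V_def bezoutian_index\<close>)
    moreover have "continuous_on UNIV (\<lambda>\<epsilon>. coeff (coeff (V \<epsilon>) j) k)" for j k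
      unfolding V_def plane_poly_def
      by (intro continuous_on_coeff_coeff_subst continuous_on_coeff_coeff_linear continuous_intros)
    ultimately have "continuous_on UNIV \<phi>"
      by (simp add: continuous_intros)
    then have "isCont \<phi> 0" by (simp add: continuous_on_eq_continuous_at)
    then show ?thesis unfolding isCont_def by (rule tendsto_mono[rotated]) (simp add: at_le)
  qed
  ultimately have "\<phi> 0 \<ge> 0"
    by (intro tendsto_lowerbound[of \<phi> "\<phi> 0" "at_right 0"]) auto
  then show ?thesis
    unfolding \<phi>_def V_def par_bezoutian_eq[OF form x uc vc] by simp
qed

section \<open>Bezoutian entries as forms\<close>

lemma map_poly_map_poly_subst:
  assumes F: "F 0 = 0" "F 1 = 1" "\<And>a b. F (a + b) = F a + F b" "\<And>a b. F (a * b) = F a * F b"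
  shows "map_poly (map_poly F) (subst (\<lambda>c. [:[:h c:]:]) (\<lambda>i. [:[:x i, u i:], [:v i:]:]) p)
    = subst (\<lambda>c. [:[:F (h c):]:]) (\<lambda>i. [:[:F (x i), F (u i):], [:F (v i):]:]) p"
proof -
  have "map_poly F (a + b) = map_poly F a + map_poly F b" for a b
    by (rule poly_eqI) (simp add: coeff_map_poly F)
  then show ?thesis
    by (subst map_poly_subst) (auto simp: F map_poly_pCons map_poly_1' map_poly_hom_mult)
qed

text \<open>
  The polynomial $p(\phi(x) + tu + sv)$ is homogeneous when $t$ and $s$ get the degree $k$ of the
  components of $\phi$.  Only the degrees of its coefficients matter from here on, not the number $n$
  of variables of $p$.
\<close>

lemma par_bezoutian_forms:
  assumes p: "p \<in> forms n d" and u: "u \<in> carrier_vec n" and v: "v \<in> carrier_vec n"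
    and \<phi>: "\<phi> \<in> form_tuples n m k" and d: "d > 0"
  obtains A B where "\<And>i. i \<le> d \<Longrightarrow> A i \<in> forms m (k * (d - i))"
    and "\<And>i. i < d \<Longrightarrow> B i \<in> forms m (k * (d - 1 - i))"
    and "\<And>x j l. j < d \<Longrightarrow> l < d \<Longrightarrow> par_bezoutian d p u v (mpeval_tuple \<phi> x) $$ (j, l)
       = (\<Sum>a\<le>d. \<Sum>b<d. bez_coeff j l a b * mpeval (A a) x * mpeval (B b) x)"
proof -
  define \<Psi> where "\<Psi> = subst (\<lambda>c. [:[:mconst c:]:]) (\<lambda>i. [:[:\<phi> $ i, mconst (u $ i):], [:mconst (v $ i):]:]) p"
  define A where "A = coeff (coeff \<Psi> 0)"
  define B where "B = coeff (coeff \<Psi> 1)"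
  let ?G = "\<lambda>e. forms m (k * e)"
  have gr: "graded_ring (graded_poly ?G)" by (intro graded_ring_poly graded_ring_forms)
  have \<Psi>: "\<Psi> \<in> graded_poly (graded_poly ?G) d"
    unfolding \<Psi>_def
  proof (rule graded_ring.subst_graded[OF graded_ring_poly[OF gr] p])
    fix i assume "i < n"
    then have "\<phi> $ i \<in> ?G 1" using \<phi> by (auto simp: form_tuples_def)
    then show "[:[:\<phi> $ i, mconst (u $ i):], [:mconst (v $ i):]:] \<in> graded_poly (graded_poly ?G) 1"
      by (intro linear_mem_graded_poly const_mem_graded_poly graded_ring_forms) auto
  next
    fix c show "[:[:mconst c:]:] \<in> graded_poly (graded_poly ?G) 0"
      by (intro const_mem_graded_poly gr graded_ring_forms) auto
  qed
  have A: "A i \<in> forms m (k * (d - i))" if "i \<le> d" for i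
    using \<Psi> that by (auto simp: graded_poly_def A_def)
  have B1: "coeff \<Psi> 1 \<in> graded_poly ?G (d - 1)"
    using \<Psi> d by (auto simp: graded_poly_def[of "graded_poly ?G"])
  then have B: "B i \<in> forms m (k * (d - 1 - i))" if "i < d" for i
    using that by (auto simp: graded_poly_def B_def)
  have B0: "B d = 0" using B1 d by (auto simp: graded_poly_def B_def)
  show thesis
  proof (rule that[OF A B])
    fix x j l assume jl: "j < d" "l < d"
    have \<phi>c: "\<phi> \<in> carrier_vec n" using \<phi> by (simp add: form_tuples_def)
    then have c: "mpeval_tuple \<phi> x \<in> carrier_vec n" by (simp add: mpeval_tuple_def)
    define V where "V = plane_poly (($) (mpeval_tuple \<phi> x)) (($) u) (($) v) p"
    have "map_poly (map_poly (\<lambda>q. mpeval q x)) \<Psi>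
        = plane_poly (\<lambda>i. mpeval (\<phi> $ i) x) (($) u) (($) v) p"
      unfolding \<Psi>_def plane_poly_def
      by (subst map_poly_map_poly_subst) (simp_all add: mpeval_eq_subst mpeval_simps)
    also have "\<dots> = V"
      unfolding V_def plane_poly_def
      by (rule subst_cong[OF p]) (use \<phi>c in \<open>simp add: mpeval_tuple_def\<close>)
    finally have eq: "V = map_poly (map_poly (\<lambda>q. mpeval q x)) \<Psi>" ..
    have co: "coeff (coeff V r) i = mpeval (coeff (coeff \<Psi> r) i) x" for r i
      unfolding eq by (simp add: coeff_map_poly mpeval_eq_subst mpeval_simps)
    have "par_bezoutian d p u v (mpeval_tuple \<phi> x) $$ (j, l)
        = (\<Sum>a\<le>d. \<Sum>b\<le>d. bez_coeff j l a b * coeff (coeff V 0) a * coeff (coeff V 1) b)"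
      unfolding par_bezoutian_eq[OF p c u v] V_def
      by (rule bezoutian_index[OF coeff_plane_poly_degrees[OF p] jl])
    also have "\<dots> = (\<Sum>a\<le>d. \<Sum>b\<le>d. bez_coeff j l a b * mpeval (A a) x * mpeval (B b) x)"
      unfolding co A_def B_def ..
    also have "\<dots> = (\<Sum>a\<le>d. \<Sum>b<d. bez_coeff j l a b * mpeval (A a) x * mpeval (B b) x)"
      using B0 by (simp add: lessThan_Suc_atMost[symmetric] mpeval_eq_subst mpeval_simps)
    finally show "par_bezoutian d p u v (mpeval_tuple \<phi> x) $$ (j, l)
       = (\<Sum>a\<le>d. \<Sum>b<d. bez_coeff j l a b * mpeval (A a) x * mpeval (B b) x)" .
  qed
qed

text \<open>
  The same computation with the components of $\phi$ as independent variables of degree 1.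
\<close>

lemma par_bezoutian_entry_form:
  assumes p: "p \<in> forms n d" and u: "u \<in> carrier_vec n" and v: "v \<in> carrier_vec n" and d: "d > 0"
    and jl: "j < d" "l < d"
  obtains P where "P \<in> forms n (2 * d - 2 - j - l)"
    and "\<And>x. x \<in> carrier_vec n \<Longrightarrow> par_bezoutian d p u v x $$ (j, l) = mpeval P x"
proof -
  define \<phi> where "\<phi> = vec n mvar"
  have \<phi>: "\<phi> \<in> form_tuples n n 1" by (auto simp: \<phi>_def form_tuples_def intro: forms_mvar[simplified])
  obtain A B where A: "\<And>i. i \<le> d \<Longrightarrow> A i \<in> forms n (1 * (d - i))"
    and B: "\<And>i. i < d \<Longrightarrow> B i \<in> forms n (1 * (d - 1 - i))"
    and C: "\<And>x j l. j < d \<Longrightarrow> l < d \<Longrightarrow> par_bezoutian d p u v (mpeval_tuple \<phi> x) $$ (j, l)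
       = (\<Sum>a\<le>d. \<Sum>b<d. bez_coeff j l a b * mpeval (A a) x * mpeval (B b) x)"
    using par_bezoutian_forms[OF p u v \<phi> d] by blast
  define P where "P = (\<Sum>a\<le>d. \<Sum>b<d. mconst (bez_coeff j l a b) * (A a * B b))"
  show thesis
  proof (rule that)
    show "P \<in> forms n (2 * d - 2 - j - l)"
      unfolding P_def
    proof (intro forms_sum)
      fix a b assume ab: "a \<in> {..d}" "b \<in> {..<d}"
      show "mconst (bez_coeff j l a b) * (A a * B b) \<in> forms n (2 * d - 2 - j - l)"
      proof (cases "bez_coeff j l a b = 0")
        case True
        then show ?thesis by (simp add: mconst_def)
      next
        case False
        then have "j + l + 1 = a + b" by (auto simp: bez_coeff_def split: if_splits)
        then have deg: "1 * (d - a) + 1 * (d - 1 - b) = 2 * d - 2 - j - l" using ab by auto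
        have "A a * B b \<in> forms n (1 * (d - a) + 1 * (d - 1 - b))"
          using ab by (intro forms_mult A B) auto
        then show ?thesis unfolding deg by (rule forms_cmult)
      qed
    qed
    fix x :: "real vec" assume x: "x \<in> carrier_vec n"
    have "mpeval_tuple \<phi> x = x"
      using x by (intro eq_vecI) (auto simp: \<phi>_def mpeval_tuple_def mpeval_eq_subst mpeval_simps)
    then show "par_bezoutian d p u v x $$ (j, l) = mpeval P x"
      using C[OF jl, of x] by (simp add: P_def mpeval_eq_subst mpeval_simps mult.assoc)
  qed
qed

section \<open>Hyperzouts of size two\<close>

text \<open>
  The parallelogram law characterises quadratic forms; for non-negative $Q$ it gives
  $Q(g + h) \le 2 Q(g) + 2 Q(h)$, which is iterated.
\<close>

lemma parallelogram_sum_bound: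
  fixes Q :: "('i \<Rightarrow> real) \<Rightarrow> real"
  assumes nonneg: "\<And>g. Q g \<ge> 0"
    and par: "\<And>g h. Q (\<lambda>i. g i + h i) + Q (\<lambda>i. g i - h i) = 2 * Q g + 2 * Q h"
    and c: "\<And>s. s \<in> S \<Longrightarrow> c s = 1 \<or> c s = - 1" and S: "finite S"
  shows "Q (\<lambda>i. \<Sum>s\<in>S. c s * G s i) \<le> 2 ^ card S * (\<Sum>s\<in>S. Q (G s))"
  using S c
proof (induction S rule: finite_induct)
  case empty
  have "Q (\<lambda>_. 0) = 0" using par[of "\<lambda>_. 0" "\<lambda>_. 0"] by simp
  then show ?case by simp
next
  case (insert s S)
  have Q0: "Q (\<lambda>_. 0) = 0" using par[of "\<lambda>_. 0" "\<lambda>_. 0"] by simp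
  have Qm: "Q (\<lambda>i. - h i) = Q h" for h using par[of "\<lambda>_. 0" h] Q0 by simp
  let ?R = "\<lambda>i. \<Sum>s\<in>S. c s * G s i"
  have "Q (\<lambda>i. \<Sum>s\<in>insert s S. c s * G s i) = Q (\<lambda>i. c s * G s i + ?R i)"
    using insert.hyps by simp
  also have "\<dots> \<le> 2 * Q (\<lambda>i. c s * G s i) + 2 * Q ?R"
    using par[of "\<lambda>i. c s * G s i" ?R] nonneg[of "\<lambda>i. c s * G s i - ?R i"] by linarith
  also have "Q (\<lambda>i. c s * G s i) = Q (G s)"
    using insert.prems[of s] Qm[of "G s"] by auto
  also have "2 * Q (G s) + 2 * Q ?R \<le> 2 * Q (G s) + 2 * (2 ^ card S * (\<Sum>s\<in>S. Q (G s)))"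
    using insert by simp
  also have "\<dots> \<le> 2 ^ card (insert s S) * Q (G s) + 2 ^ card (insert s S) * (\<Sum>s\<in>S. Q (G s))"
  proof -
    have "(1::real) \<le> 2 ^ card S" by simp
    then have "1 * Q (G s) \<le> 2 ^ card S * Q (G s)" by (intro mult_right_mono nonneg)
    then show ?thesis using insert.hyps by (simp add: mult.assoc)
  qed
  also have "\<dots> = 2 ^ card (insert s S) * (\<Sum>s\<in>insert s S. Q (G s))"
    using insert.hyps by (simp add: distrib_left)
  finally show ?case .
qed

text \<open>
  Forms of degree 0, 1 and 2 are constant, additive, and satisfy the parallelogram law.  In each case
  this is read off the polynomial $t \mapsto f(g + th)$, whose constant and top coefficients are
  $f(g)$ and $f(h)$.
\<close>

lemma form_0_constant:
  assumes "f \<in> forms n 0"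
  shows "subst (\<lambda>c. c) g f = subst (\<lambda>c. c) h f"
proof -
  let ?L = "subst (\<lambda>c. [:c:]) (\<lambda>i. [:g i, h i:]) f"
  have "coeff ?L 0 = subst (\<lambda>c. c) h f" by (rule subst_line_top(2)[OF assms])
  moreover have "coeff ?L 0 = subst (\<lambda>c. c) g f"
    unfolding poly_0_coeff_0[symmetric] poly_subst by simp
  ultimately show ?thesis by simp
qed

lemma form_1_additive:
  assumes "f \<in> forms n 1"
  shows "subst (\<lambda>c. c) (\<lambda>i. g i + h i) f = subst (\<lambda>c. c) g f + subst (\<lambda>c. c) h f"
    and "subst (\<lambda>c. c) (\<lambda>i. g i - h i) f = subst (\<lambda>c. c) g f - subst (\<lambda>c. c) h f"
proof -
  let ?L = "subst (\<lambda>c. [:c:]) (\<lambda>i. [:g i, h i:]) f"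
  have top: "coeff ?L 1 = subst (\<lambda>c. c) h f" "degree ?L \<le> 1" by (rule subst_line_top[OF assms])+
  have bot: "coeff ?L 0 = subst (\<lambda>c. c) g f"
    unfolding poly_0_coeff_0[symmetric] poly_subst by simp
  have "poly ?L t = subst (\<lambda>c. c) g f + t * subst (\<lambda>c. c) h f" for t
    using poly_eq_sum_le[OF top(2), of t] top(1) bot by simp
  from this[of 1] this[of "-1"]
  show "subst (\<lambda>c. c) (\<lambda>i. g i + h i) f = subst (\<lambda>c. c) g f + subst (\<lambda>c. c) h f"
    "subst (\<lambda>c. c) (\<lambda>i. g i - h i) f = subst (\<lambda>c. c) g f - subst (\<lambda>c. c) h f"
    unfolding poly_subst by simp_all
qed

lemma form_2_parallelogram:
  assumes "f \<in> forms n 2"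
  shows "subst (\<lambda>c. c) (\<lambda>i. g i + h i) f + subst (\<lambda>c. c) (\<lambda>i. g i - h i) f
    = 2 * subst (\<lambda>c. c) g f + 2 * subst (\<lambda>c. c) h f"
proof -
  let ?L = "subst (\<lambda>c. [:c:]) (\<lambda>i. [:g i, h i:]) f"
  have top: "coeff ?L 2 = subst (\<lambda>c. c) h f" "degree ?L \<le> 2" by (rule subst_line_top[OF assms])+
  have bot: "coeff ?L 0 = subst (\<lambda>c. c) g f"
    unfolding poly_0_coeff_0[symmetric] poly_subst by simp
  have "poly ?L t = subst (\<lambda>c. c) g f + coeff ?L 1 * t + t\<^sup>2 * subst (\<lambda>c. c) h f" for t
    using poly_eq_sum_le[OF top(2), of t] top(1) bot by (simp add: numeral_2_eq_2)
  from this[of 1] this[of "-1"] have "poly ?L 1 + poly ?L (-1) = 2 * subst (\<lambda>c. c) g f + 2 * subst (\<lambda>c. c) h f"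
    by simp
  then show ?thesis unfolding poly_subst by simp
qed

lemma sum_lessThan_last_block:
  fixes f :: "nat \<Rightarrow> 'a::comm_monoid_add"
  assumes "\<And>j. j < d - \<mu> \<Longrightarrow> f j = 0" "\<mu> \<le> d"
  shows "(\<Sum>j<d. f j) = (\<Sum>i<\<mu>. f (d - \<mu> + i))"
proof -
  have "(\<Sum>j<d. f j) = (\<Sum>j\<in>{d - \<mu>..<d}. f j)"
    using assms(1) by (intro sum.mono_neutral_right) auto
  also have "\<dots> = (\<Sum>i<\<mu>. f (d - \<mu> + i))"
    by (rule sum.reindex_bij_witness[of _ "\<lambda>i. d - \<mu> + i" "\<lambda>j. j - (d - \<mu>)"]) (use assms(2) in auto)
  finally show ?thesis .
qed

text \<open>
  Only the last two entries of $\xi$ are nonzero, and the first of them is a constant $\gamma$.  Hence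
  $q(x) = Q(\phi(x), \xi_{d-1}(x))$ with
  $Q(X, c) = \gamma^2 P_{00}(X) + \gamma c\,(P_{01} + P_{10})(X) + c^2 P_{11}$, where $P_{00}$, $P_{01}$,
  $P_{10}$ and $P_{11}$ have degrees $2, 1, 1, 0$.  So $Q$ is a quadratic form, and it is non-negative
  because the Bezoutian is positive semidefinite.  A linear relation between the values of forms of
  degree $y$ is a linear relation between the arguments of $Q$.
\<close>

lemma hyperzout_size_two_bound:
  assumes p: "p \<in> Hyp n d e" and e: "e \<in> carrier_vec n"
    and u: "u \<in> hyp_cone n p e" and v: "v \<in> hyp_cone n p e"
    and \<phi>: "\<phi> \<in> form_tuples n m y" and \<xi>: "\<xi> \<in> T_space m d 2 y" and d: "2 \<le> d"
    and q: "\<And>x. x \<in> carrier_vec m \<Longrightarrow> mpeval q x = mpeval_tuple \<xi> x \<bullet>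
               (par_bezoutian d p u v (mpeval_tuple \<phi> x) *\<^sub>v mpeval_tuple \<xi> x)"
    and S: "finite S" and c: "\<And>s. s \<in> S \<Longrightarrow> c s = 1 \<or> c s = - 1"
    and z: "\<And>s. s \<in> S \<Longrightarrow> z s \<in> carrier_vec m" "z0 \<in> carrier_vec m"
    and rel: "\<And>h. h \<in> forms m y \<Longrightarrow> mpeval h z0 = (\<Sum>s\<in>S. c s * mpeval h (z s))"
  shows "mpeval q z0 \<le> 2 ^ card S * (\<Sum>s\<in>S. mpeval q (z s))"
proof -
  have form: "p \<in> forms n d" using p by (simp add: Hyp_def)
  have uc: "u \<in> carrier_vec n" and vc: "v \<in> carrier_vec n" using u v by (auto simp: hyp_cone_def)
  have d0: "d > 0" using d by simp
  define i0 where "i0 = d - 2"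
  define i1 where "i1 = d - 1"
  have i: "i0 < d" "i1 < d" "i0 \<noteq> i1" using d by (auto simp: i0_def i1_def)
  define \<gamma> where "\<gamma> = mpeval (\<xi> $ i0) z0"
  \<comment> \<open>the argument $g$ holds $X$ in its entries below $n$ and $c$ in entry $n$\<close>
  define Xi where "Xi = (\<lambda>g :: nat \<Rightarrow> real. vec d (\<lambda>j. if j = i0 then \<gamma> else if j = i1 then g n else 0))"
  define Q where "Q = (\<lambda>g. Xi g \<bullet> (par_bezoutian d p u v (vec n g) *\<^sub>v Xi g))"
  have Xi: "Xi g \<in> carrier_vec d" for g by (simp add: Xi_def)
  have carrier: "par_bezoutian d p u v x \<in> carrier_mat d d" if "x \<in> carrier_vec n" for x
    using par_bezoutian_carrier[OF form that uc vc] .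
  have Q_nonneg: "Q g \<ge> 0" for g
    unfolding Q_def by (rule par_bezoutian_psd[OF p e u v _ Xi]) simp
  obtain P00 where P00: "P00 \<in> forms n (2 * d - 2 - i0 - i0)"
      "\<And>x. x \<in> carrier_vec n \<Longrightarrow> par_bezoutian d p u v x $$ (i0, i0) = mpeval P00 x"
    using par_bezoutian_entry_form[OF form uc vc d0 i(1) i(1)] by blast
  obtain P01 where P01: "P01 \<in> forms n (2 * d - 2 - i0 - i1)"
      "\<And>x. x \<in> carrier_vec n \<Longrightarrow> par_bezoutian d p u v x $$ (i0, i1) = mpeval P01 x"
    using par_bezoutian_entry_form[OF form uc vc d0 i(1) i(2)] by blast
  obtain P10 where P10: "P10 \<in> forms n (2 * d - 2 - i1 - i0)"
      "\<And>x. x \<in> carrier_vec n \<Longrightarrow> par_bezoutian d p u v x $$ (i1, i0) = mpeval P10 x"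
    using par_bezoutian_entry_form[OF form uc vc d0 i(2) i(1)] by blast
  obtain P11 where P11: "P11 \<in> forms n (2 * d - 2 - i1 - i1)"
      "\<And>x. x \<in> carrier_vec n \<Longrightarrow> par_bezoutian d p u v x $$ (i1, i1) = mpeval P11 x"
    using par_bezoutian_entry_form[OF form uc vc d0 i(2) i(2)] by blast
  have deg: "2 * d - 2 - i0 - i0 = 2" "2 * d - 2 - i0 - i1 = 1" "2 * d - 2 - i1 - i0 = 1" "2 * d - 2 - i1 - i1 = 0"
    using d by (auto simp: i0_def i1_def)
  note F = P00(1)[unfolded deg] P01(1)[unfolded deg] P10(1)[unfolded deg] P11(1)[unfolded deg]
  let ?s = "\<lambda>P g. subst (\<lambda>c. c) g P"
  have ev: "mpeval P (vec n g) = ?s P g" if "P \<in> forms n k" for P g k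
    unfolding mpeval_eq_subst by (rule subst_cong[OF that]) simp
  have Q_eq: "Q g = \<gamma>\<^sup>2 * ?s P00 g + \<gamma> * g n * (?s P01 g + ?s P10 g) + (g n)\<^sup>2 * ?s P11 g" for g
  proof -
    have "Q g = (\<Sum>j<d. \<Sum>l<d. par_bezoutian d p u v (vec n g) $$ (j, l) * Xi g $ j * Xi g $ l)"
      unfolding Q_def by (rule quadratic_form_eq_sum[OF carrier Xi]) simp
    also have "\<dots> = (\<Sum>j\<in>{i0, i1}. \<Sum>l\<in>{i0, i1}. par_bezoutian d p u v (vec n g) $$ (j, l) * Xi g $ j * Xi g $ l)"
    proof (rule sum.mono_neutral_cong_right)
      show "\<forall>j\<in>{..<d} - {i0, i1}. (\<Sum>l<d. par_bezoutian d p u v (vec n g) $$ (j, l) * Xi g $ j * Xi g $ l) = 0"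
        by (auto simp: Xi_def intro!: sum.neutral)
      show "(\<Sum>l<d. par_bezoutian d p u v (vec n g) $$ (j, l) * Xi g $ j * Xi g $ l)
          = (\<Sum>l\<in>{i0, i1}. par_bezoutian d p u v (vec n g) $$ (j, l) * Xi g $ j * Xi g $ l)" for j
        using i by (intro sum.mono_neutral_right) (auto simp: Xi_def)
    qed (use i in auto)
    also have "\<dots> = \<gamma>\<^sup>2 * ?s P00 g + \<gamma> * g n * (?s P01 g + ?s P10 g) + (g n)\<^sup>2 * ?s P11 g"
      using i by (simp add: Xi_def P00(2) P01(2) P10(2) P11(2) ev[OF F(1)] ev[OF F(2)] ev[OF F(3)] ev[OF F(4)]
          power2_eq_square algebra_simps)
    finally show ?thesis .
  qed
  have Q_par: "Q (\<lambda>i. g i + h i) + Q (\<lambda>i. g i - h i) = 2 * Q g + 2 * Q h" for g h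
  proof -
    define k where "k = ?s P11 (\<lambda>_. 0)"
    have k: "?s P11 g = k" for g unfolding k_def by (rule form_0_constant[OF F(4)])
    have a: "?s P00 (\<lambda>i. g i + h i) = 2 * ?s P00 g + 2 * ?s P00 h - ?s P00 (\<lambda>i. g i - h i)"
      using form_2_parallelogram[OF F(1), of g h] by simp
    show ?thesis
      unfolding Q_eq k a form_1_additive[OF F(2)] form_1_additive[OF F(3)]
      by (simp add: power2_eq_square algebra_simps)
  qed
  define G where "G = (\<lambda>x i. if i < n then mpeval (\<phi> $ i) x else if i = n then mpeval (\<xi> $ i1) x else 0)"
  have \<phi>c: "\<phi> \<in> carrier_vec n" and \<xi>c: "\<xi> \<in> carrier_vec d"
    using \<phi> \<xi> by (auto simp: form_tuples_def T_space_def)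
  have \<xi>0: "\<xi> $ i0 \<in> forms m 0"
    using \<xi> unfolding T_space_def i0_def by (auto dest!: spec[of _ 0] split: if_splits)
  have \<xi>1: "\<xi> $ i1 \<in> forms m y"
  proof -
    have "\<xi> $ (d - 2 + 1) \<in> forms m (1 * y)" using \<xi> unfolding T_space_def by (simp only: mem_Collect_eq)
    moreover have "d - 2 + 1 = i1" using d by (simp add: i1_def)
    ultimately show ?thesis by simp
  qed
  have q_Q: "mpeval q x = Q (G x)" if x: "x \<in> carrier_vec m" for x
  proof -
    have "vec n (G x) = mpeval_tuple \<phi> x"
      using \<phi>c by (intro eq_vecI) (auto simp: G_def mpeval_tuple_def)
    moreover have "Xi (G x) = mpeval_tuple \<xi> x"
    proof (rule eq_vecI)
      fix j assume "j < dim_vec (mpeval_tuple \<xi> x)"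
      then have j: "j < d" using \<xi>c by (simp add: mpeval_tuple_def)
      consider "j = i0" | "j = i1" | "j < d - 2" using j by (force simp: i0_def i1_def)
      then show "Xi (G x) $ j = mpeval_tuple \<xi> x $ j"
      proof cases
        case 1
        then show ?thesis using i \<xi>c form_0_constant[OF \<xi>0, of "($) x" "($) z0"]
          by (simp add: Xi_def mpeval_tuple_def \<gamma>_def mpeval_eq_subst)
      next
        case 2
        then show ?thesis using i \<xi>c by (simp add: Xi_def mpeval_tuple_def G_def)
      next
        case 3
        then have "\<xi> $ j = 0" using \<xi> by (simp add: T_space_def)
        then show ?thesis using 3 j i \<xi>c
          by (auto simp: Xi_def mpeval_tuple_def i0_def i1_def mpeval_eq_subst mpeval_simps)
      qed
    qed (use \<xi>c in \<open>simp add: Xi_def mpeval_tuple_def\<close>)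
    ultimately show ?thesis using q[OF x] by (simp add: Q_def)
  qed
  have "G z0 = (\<lambda>i. \<Sum>s\<in>S. c s * G (z s) i)"
    using \<phi> rel \<xi>1 by (auto simp: G_def form_tuples_def fun_eq_iff)
  then have "mpeval q z0 = Q (\<lambda>i. \<Sum>s\<in>S. c s * G (z s) i)" using q_Q[OF z(2)] by simp
  also have "\<dots> \<le> 2 ^ card S * (\<Sum>s\<in>S. Q (G (z s)))"
    by (rule parallelogram_sum_bound[OF Q_nonneg Q_par c S])
  also have "(\<Sum>s\<in>S. Q (G (z s))) = (\<Sum>s\<in>S. mpeval q (z s))"
    using q_Q z(1) by simp
  finally show ?thesis .
qed

section \<open>A separating non-negative form\<close>

definition cube_point :: "nat \<Rightarrow> nat set \<Rightarrow> real vec" where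
  "cube_point m S = vec m (\<lambda>i. if i = 0 \<or> i \<in> S then 1 else 0)"

lemma sum_Pow_insert:
  fixes f :: "'a set \<Rightarrow> 'b::comm_monoid_add"
  assumes "finite A" "i \<notin> A"
  shows "(\<Sum>S\<in>Pow (insert i A). f S) = (\<Sum>S\<in>Pow A. f S + f (insert i S))"
proof -
  have "(\<Sum>S\<in>Pow (insert i A). f S) = (\<Sum>S\<in>Pow A. f S) + (\<Sum>S\<in>insert i ` Pow A. f S)"
    unfolding Pow_insert using assms by (intro sum.union_disjoint) auto
  also have "(\<Sum>S\<in>insert i ` Pow A. f S) = (\<Sum>S\<in>Pow A. f (insert i S))"
    using assms by (subst sum.reindex) (auto simp: inj_on_def)
  finally show ?thesis by (simp add: sum.distrib)
qed

text \<open>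
  Finite differences: a monomial of degree $y$ omits one of the $y + 1$ variables, so its values at
  vertices that differ only in this coordinate cancel.
\<close>

lemma cube_alternating_sum:
  assumes h: "h \<in> forms m y"
  shows "(\<Sum>S\<in>Pow {1..Suc y}. (- 1) ^ card S * mpeval h (cube_point m S)) = 0"
proof -
  have mon: "(\<Sum>S\<in>Pow {1..Suc y}. (- 1) ^ card S * mon_eval (($) (cube_point m S)) \<alpha>) = 0"
    if \<alpha>: "\<alpha> \<in> monomials m y" for \<alpha>
  proof -
    have "card (Poly_Mapping.keys \<alpha>) = (\<Sum>i\<in>Poly_Mapping.keys \<alpha>. 1)" by simp
    also have "\<dots> \<le> (\<Sum>i\<in>Poly_Mapping.keys \<alpha>. Poly_Mapping.lookup \<alpha> i)"
      by (intro sum_mono) (simp add: in_keys_iff Suc_le_eq)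
    also have "\<dots> = y" using \<alpha> by (simp add: monomials_def)
    finally have "\<not> {1..Suc y} \<subseteq> Poly_Mapping.keys \<alpha>"
      using card_mono[of "Poly_Mapping.keys \<alpha>" "{1..Suc y}"] by auto
    then obtain i where i: "i \<in> {1..Suc y}" "i \<notin> Poly_Mapping.keys \<alpha>" by blast
    define A where "A = {1..Suc y} - {i}"
    have A: "finite A" "i \<notin> A" "{1..Suc y} = insert i A" using i by (auto simp: A_def)
    have "mon_eval (($) (cube_point m (insert i S))) \<alpha> = mon_eval (($) (cube_point m S)) \<alpha>" for S
      unfolding mon_eval_def
    proof (intro prod.cong refl)
      fix j assume "j \<in> Poly_Mapping.keys \<alpha>"
      then have "j < m" "j \<noteq> i" using \<alpha> i by (auto simp: monomials_def)
      then show "cube_point m (insert i S) $ j ^ Poly_Mapping.lookup \<alpha> j = cube_point m S $ j ^ Poly_Mapping.lookup \<alpha> j"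
        by (simp add: cube_point_def)
    qed
    then show ?thesis
      unfolding A(3) sum_Pow_insert[OF A(1,2)]
      using A(1,2) by (intro sum.neutral) (auto simp: card_insert_if finite_subset dest: subsetD)
  qed
  have "(\<Sum>S\<in>Pow {1..Suc y}. (- 1) ^ card S * mpeval h (cube_point m S))
      = (\<Sum>S\<in>Pow {1..Suc y}. \<Sum>\<alpha>\<in>monomials m y. Poly_Mapping.lookup h \<alpha> *
          ((- 1) ^ card S * mon_eval (($) (cube_point m S)) \<alpha>))"
    unfolding mpeval_form[OF h] sum_distrib_left by (simp add: mult.left_commute)
  also have "\<dots> = (\<Sum>\<alpha>\<in>monomials m y. Poly_Mapping.lookup h \<alpha> *
      (\<Sum>S\<in>Pow {1..Suc y}. (- 1) ^ card S * mon_eval (($) (cube_point m S)) \<alpha>))"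
    unfolding sum_distrib_left by (rule sum.swap)
  also have "\<dots> = 0" using mon by (intro sum.neutral) simp
  finally show ?thesis .
qed

lemma cube_vertex_relation:
  assumes h: "h \<in> forms m y"
  shows "mpeval h (cube_point m {1..Suc y}) =
    (\<Sum>S\<in>Pow {1..Suc y} - {{1..Suc y}}. (- 1) ^ (y + card S) * mpeval h (cube_point m S))"
proof -
  let ?F = "{1..Suc y}"
  have "0 = (- 1) ^ y * (\<Sum>S\<in>Pow ?F. (- 1) ^ card S * mpeval h (cube_point m S))"
    by (simp only: cube_alternating_sum[OF h] mult_zero_right)
  also have "\<dots> = (\<Sum>S\<in>Pow ?F. (- 1) ^ (y + card S) * mpeval h (cube_point m S))"
    by (simp add: sum_distrib_left power_add mult.assoc)
  also have "\<dots> = (- 1) ^ (y + card ?F) * mpeval h (cube_point m ?F)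
      + (\<Sum>S\<in>Pow ?F - {?F}. (- 1) ^ (y + card S) * mpeval h (cube_point m S))"
    by (rule sum.remove) auto
  also have "(- 1 :: real) ^ (y + card ?F) = - 1" by (simp add: power_add flip: power_mult_distrib)
  finally show ?thesis by simp
qed

text \<open>
  The Choi-Lam form $w^4 + a^2b^2 + b^2c^2 + c^2a^2 - 4abcw$, non-negative by the inequality between
  arithmetic and geometric mean and the classical example of such a quartic that is not a sum of
  squares.  The constant 4 is a parameter because the form is used over the reals and over
  polynomials, where 4 is the constant polynomial of the real number 4.
\<close>

definition choi_lam :: "'a::comm_ring_1 \<Rightarrow> 'a \<Rightarrow> 'a \<Rightarrow> 'a \<Rightarrow> 'a \<Rightarrow> 'a" where
  "choi_lam four a b c w = w ^ 4 + (a * b) ^ 2 + (b * c) ^ 2 + (c * a) ^ 2 - four * (a * b * (c * w))"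

lemma choi_lam_nonneg: "choi_lam 4 a b c (w :: real) \<ge> 0"
proof -
  define s where "s = \<bar>a * b\<bar>"
  have s: "s \<ge> 0" "s\<^sup>2 = (a * b)\<^sup>2" by (auto simp: s_def)
  have "choi_lam 4 a b c w = (w\<^sup>2 - s)\<^sup>2 + c\<^sup>2 * (\<bar>a\<bar> - \<bar>b\<bar>)\<^sup>2 + 2 * (s * (w\<^sup>2 + c\<^sup>2)) - 4 * (a * b * (c * w))"
    using s(2) by (simp add: choi_lam_def s_def abs_mult power2_diff power_mult_distrib algebra_simps flip: power_mult)
  moreover have "a * b * (c * w) \<le> s * \<bar>c * w\<bar>"
    unfolding s_def abs_mult[symmetric] by (rule abs_ge_self)
  moreover have "s * (2 * \<bar>c * w\<bar>) = 2 * (s * \<bar>c * w\<bar>)" by simp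
  moreover have "s * (2 * \<bar>c * w\<bar>) \<le> s * (w\<^sup>2 + c\<^sup>2)"
  proof (rule mult_left_mono[OF _ s(1)])
    have "0 \<le> (\<bar>c\<bar> - \<bar>w\<bar>)\<^sup>2" by simp
    then show "2 * \<bar>c * w\<bar> \<le> w\<^sup>2 + c\<^sup>2" by (simp add: power2_diff abs_mult)
  qed
  moreover have "(w\<^sup>2 - s)\<^sup>2 \<ge> 0" "c\<^sup>2 * (\<bar>a\<bar> - \<bar>b\<bar>)\<^sup>2 \<ge> 0" by auto
  ultimately show ?thesis by linarith
qed

text \<open>
  The three quadrics $aw - bc$, $bw - ca$, $cw - ab$ meet in eight points: the seven zeros of the
  Choi-Lam form and the point where only $w$ is nonzero.  The linear substitution moves them to the
  points $(1, \epsilon)$ with $\epsilon \in \{0, 1\}^3$, where $\epsilon = (1, 1, 1)$ corresponds to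
  the exceptional point.  The squares of the remaining variables make the form vanish at every vertex
  of the cube of dimension $y + 1$ except at the one opposite to the origin.
\<close>

definition separating_form :: "nat \<Rightarrow> mpoly" where
  "separating_form y = choi_lam (mconst 4) (mvar 0 - mvar 1 - mvar 2 + mvar 3)
     (mvar 0 - mvar 1 + mvar 2 - mvar 3) (mvar 0 + mvar 1 - mvar 2 - mvar 3)
     (mvar 0 - mvar 1 - mvar 2 - mvar 3) * (\<Prod>i\<in>{4..Suc y}. mvar i ^ 2)"

lemma forms_quartic:
  assumes "a \<in> forms m 1" "b \<in> forms m 1" "c \<in> forms m 1" "e \<in> forms m 1"
  shows "(a * b) * (c * e) \<in> forms m 4"
proof -
  have "(a * b) * (c * e) \<in> forms m ((1 + 1) + (1 + 1))"
    by (rule forms_mult[OF forms_mult[OF assms(1,2)] forms_mult[OF assms(3,4)]])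
  also have "(1 + 1) + (1 + 1) = (4 :: nat)" by simp
  finally show ?thesis .
qed

lemma separating_form_mem:
  assumes "m \<ge> y + 2" "y \<ge> 2"
  shows "separating_form y \<in> forms m (2 * y)"
proof -
  let ?a = "mvar 0 - mvar 1 - mvar 2 + mvar 3" let ?b = "mvar 0 - mvar 1 + mvar 2 - mvar 3"
  let ?c = "mvar 0 + mvar 1 - mvar 2 - mvar 3" let ?w = "mvar 0 - mvar 1 - mvar 2 - mvar 3"
  have mv: "mvar 0 \<in> forms m 1" "mvar 1 \<in> forms m 1" "mvar 2 \<in> forms m 1" "mvar 3 \<in> forms m 1"
    using assms by (auto simp del: One_nat_def intro: forms_mvar)
  have abc: "?a \<in> forms m 1" "?b \<in> forms m 1" "?c \<in> forms m 1" "?w \<in> forms m 1"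
    by (intro forms_add forms_diff mv)+
  have sq: "(f * g) ^ 2 \<in> forms m 4" if "f \<in> forms m 1" "g \<in> forms m 1" for f g
    unfolding power2_eq_square by (intro forms_quartic that)
  have abcw: "?a * ?b * (?c * ?w) \<in> forms m 4"
    by (rule forms_quartic[OF abc])
  have w4: "?w ^ 4 \<in> forms m 4" using forms_power[OF abc(4), of 4] unfolding mult_1 .
  have "choi_lam (mconst 4) ?a ?b ?c ?w \<in> forms m 4"
    unfolding choi_lam_def
    by (rule forms_diff[OF forms_add[OF forms_add[OF forms_add[OF w4 sq[OF abc(1,2)]]
          sq[OF abc(2,3)]] sq[OF abc(3,1)]] forms_cmult[OF abcw]])
  moreover have "(\<Prod>i\<in>{4..Suc y}. mvar i ^ 2) \<in> forms m (\<Sum>i\<in>{4..Suc y}. 1 * 2)"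
    using assms by (intro forms_prod forms_power forms_mvar) auto
  ultimately have "separating_form y \<in> forms m (4 + (\<Sum>i\<in>{4..Suc y}. 1 * 2))"
    unfolding separating_form_def by (rule forms_mult)
  also have "4 + (\<Sum>i\<in>{4..Suc y}. 1 * 2) = 2 * y" using assms by simp
  finally show ?thesis .
qed

lemma mpeval_separating_form:
  "mpeval (separating_form y) x = choi_lam 4 (x $ 0 - x $ 1 - x $ 2 + x $ 3)
     (x $ 0 - x $ 1 + x $ 2 - x $ 3) (x $ 0 + x $ 1 - x $ 2 - x $ 3)
     (x $ 0 - x $ 1 - x $ 2 - x $ 3) * (\<Prod>i\<in>{4..Suc y}. (x $ i) ^ 2)"
  by (simp add: separating_form_def choi_lam_def mpeval_eq_subst mpeval_simps)

lemma separating_form_nonneg: "mpeval (separating_form y) x \<ge> 0"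
  unfolding mpeval_separating_form by (intro mult_nonneg_nonneg choi_lam_nonneg prod_nonneg) auto

lemma separating_form_cube:
  assumes "m \<ge> y + 2" "y \<ge> 2"
  shows "mpeval (separating_form y) (cube_point m {1..Suc y}) = 16"
    and "S \<subset> {1..Suc y} \<Longrightarrow> mpeval (separating_form y) (cube_point m S) = 0"
proof -
  have x: "cube_point m T $ i = (if i = 0 \<or> i \<in> T then 1 else 0)" if "i \<le> Suc y" for T i
    using that assms by (simp add: cube_point_def)
  have "(\<Prod>i\<in>{4..Suc y}. (cube_point m {1..Suc y} $ i)\<^sup>2) = 1"
    using assms by (intro prod.neutral) (auto simp: x)
  then show "mpeval (separating_form y) (cube_point m {1..Suc y}) = 16"
    unfolding mpeval_separating_form using assms by (simp add: x choi_lam_def)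
  assume S: "S \<subset> {1..Suc y}"
  show "mpeval (separating_form y) (cube_point m S) = 0"
  proof (cases "{4..Suc y} \<subseteq> S")
    case True
    have "\<not> {1, 2, 3} \<subseteq> S"
    proof
      assume "{1, 2, 3} \<subseteq> S"
      moreover have "{1..Suc y} \<subseteq> {1, 2, 3} \<union> {4..Suc y}" by auto
      ultimately show False using S True by blast
    qed
    then have "1 \<notin> S \<or> 2 \<notin> S \<or> 3 \<notin> S" by blast
    then show ?thesis
      unfolding mpeval_separating_form using assms
      by (cases "1 \<in> S"; cases "2 \<in> S"; cases "3 \<in> S") (simp_all add: x choi_lam_def)
  next
    case False
    then obtain i where "i \<in> {4..Suc y}" "i \<notin> S" by blast
    then have "(\<Prod>i\<in>{4..Suc y}. (cube_point m S $ i)\<^sup>2) = 0"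
      by (intro prod_zero bexI[of _ i]) (auto simp: x)
    then show ?thesis unfolding mpeval_separating_form by simp
  qed
qed

text \<open>
  Bound every coordinate by the largest one in absolute value.
\<close>

lemma mon_eval_bound:
  fixes x :: "real vec"
  assumes \<alpha>: "\<alpha> \<in> monomials m (2 * y)" and y: "y > 0"
  shows "\<bar>mon_eval (($) x) \<alpha>\<bar> \<le> (\<Sum>i<m. (x $ i) ^ (2 * y))"
proof (cases "m = 0")
  case True
  then show ?thesis using \<alpha> y by (auto simp: monomials_def)
next
  case False
  define M where "M = Max ((\<lambda>i. \<bar>x $ i\<bar>) ` {..<m})"
  have M: "\<bar>x $ i\<bar> \<le> M" if "i < m" for i unfolding M_def using that by (intro Max_ge) auto
  have "M \<in> (\<lambda>i. \<bar>x $ i\<bar>) ` {..<m}" unfolding M_def using False by (intro Max_in) auto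
  then obtain j where j: "j < m" "M = \<bar>x $ j\<bar>" by auto
  have "\<bar>mon_eval (($) x) \<alpha>\<bar> = (\<Prod>i\<in>Poly_Mapping.keys \<alpha>. \<bar>x $ i\<bar> ^ Poly_Mapping.lookup \<alpha> i)"
    by (simp add: mon_eval_def abs_prod power_abs)
  also have "\<dots> \<le> (\<Prod>i\<in>Poly_Mapping.keys \<alpha>. M ^ Poly_Mapping.lookup \<alpha> i)"
    using \<alpha> M by (intro prod_mono conjI power_mono) (auto simp: monomials_def)
  also have "\<dots> = M ^ (2 * y)" using \<alpha> by (simp add: monomials_def flip: power_sum)
  also have "\<dots> = (x $ j) ^ (2 * y)" by (simp add: j(2) power_even_abs)
  also have "\<dots> \<le> (\<Sum>i<m. (x $ i) ^ (2 * y))"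
    using j(1) by (intro member_le_sum) auto
  finally show ?thesis .
qed

lemma form_bound:
  fixes x :: "real vec"
  assumes f: "f \<in> forms m (2 * y)" and y: "y > 0"
  shows "\<bar>mpeval f x\<bar> \<le> (\<Sum>\<alpha>\<in>monomials m (2 * y). \<bar>Poly_Mapping.lookup f \<alpha>\<bar>) * (\<Sum>i<m. (x $ i) ^ (2 * y))"
proof -
  have "\<bar>mpeval f x\<bar> \<le> (\<Sum>\<alpha>\<in>monomials m (2 * y). \<bar>Poly_Mapping.lookup f \<alpha> * mon_eval (($) x) \<alpha>\<bar>)"
    unfolding mpeval_form[OF f] by (rule sum_abs)
  also have "\<dots> \<le> (\<Sum>\<alpha>\<in>monomials m (2 * y). \<bar>Poly_Mapping.lookup f \<alpha>\<bar> * (\<Sum>i<m. (x $ i) ^ (2 * y)))"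
    unfolding abs_mult by (intro sum_mono mult_left_mono mon_eval_bound y) auto
  finally show ?thesis by (simp add: sum_distrib_right)
qed

section \<open>Counting parameters\<close>

definition mon_enum :: "nat \<Rightarrow> nat \<Rightarrow> nat \<Rightarrow> (nat \<Rightarrow>\<^sub>0 nat)" where
  "mon_enum m g = (SOME h. bij_betw h {..<card (monomials m g)} (monomials m g))"

lemma bij_betw_mon_enum: "bij_betw (mon_enum m g) {..<card (monomials m g)} (monomials m g)"
  unfolding mon_enum_def
  using someI_ex[OF ex_bij_betw_nat_finite[OF finite_monomials[of m g]]] by (simp add: atLeast0LessThan)

text \<open>
  The value at $x$ of the form of degree $g$ with indeterminate coefficients, as a linear form in these
  coefficients.  The block of variables with indices from $hM$ to $hM + M - 1$ is reserved for the
  coefficients of the form with number $h$.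
\<close>

definition generic_form :: "nat \<Rightarrow> nat \<Rightarrow> nat \<Rightarrow> nat \<Rightarrow> real vec \<Rightarrow> mpoly" where
  "generic_form m M g h x =
     (\<Sum>i<card (monomials m g). mconst (mon_eval (($) x) (mon_enum m g i)) * mvar (h * M + i))"

lemma generic_form_mem:
  assumes "h < H" "card (monomials m g) \<le> M"
  shows "generic_form m M g h x \<in> forms (H * M) 1"
  unfolding generic_form_def
proof (intro forms_sum forms_cmult forms_mvar)
  fix i assume "i \<in> {..<card (monomials m g)}"
  then have "h * M + i < Suc h * M" using assms(2) by simp
  also have "\<dots> \<le> H * M" using assms(1) by (intro mult_right_mono) auto
  finally show "h * M + i < H * M" .
qed

lemma generic_form_specialize:
  assumes P: "P h \<in> forms m (g h)" and h: "h < H" "card (monomials m (g h)) \<le> M"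
  shows "mpeval (generic_form m M (g h) h x)
     (vec (H * M) (\<lambda>r. Poly_Mapping.lookup (P (r div M)) (mon_enum m (g (r div M)) (r mod M)))) = mpeval (P h) x"
proof -
  let ?\<theta> = "vec (H * M) (\<lambda>r. Poly_Mapping.lookup (P (r div M)) (mon_enum m (g (r div M)) (r mod M)))"
  have "mpeval (generic_form m M (g h) h x) ?\<theta> =
      (\<Sum>i<card (monomials m (g h)). mon_eval (($) x) (mon_enum m (g h) i) * ?\<theta> $ (h * M + i))"
    by (simp add: generic_form_def mpeval_eq_subst mpeval_simps)
  also have "\<dots> = (\<Sum>i<card (monomials m (g h)). Poly_Mapping.lookup (P h) (mon_enum m (g h) i) * mon_eval (($) x) (mon_enum m (g h) i))"
  proof (intro sum.cong refl)
    fix i assume "i \<in> {..<card (monomials m (g h))}"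
    then have i: "i < M" using h(2) by simp
    then have "h * M + i < Suc h * M" by simp
    also have "\<dots> \<le> H * M" using h(1) by (intro mult_right_mono) auto
    finally have "?\<theta> $ (h * M + i) = Poly_Mapping.lookup (P h) (mon_enum m (g h) i)" using i by simp
    then show "mon_eval (($) x) (mon_enum m (g h) i) * ?\<theta> $ (h * M + i)
        = Poly_Mapping.lookup (P h) (mon_enum m (g h) i) * mon_eval (($) x) (mon_enum m (g h) i)" by simp
  qed
  also have "\<dots> = mpeval (P h) x"
    unfolding mpeval_form[OF P] by (rule sum.reindex_bij_betw[OF bij_betw_mon_enum])
  finally show ?thesis .
qed

text \<open>
  The numbers $0, \dots, d$ belong to the coefficients of $p(\phi(x) + tu)$, the next $d$ to those of
  $D_vp(\phi(x) + tu)$, and the remaining $\mu$ to the last $\mu$ entries of $\xi$.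
\<close>

definition slot_degree :: "nat \<Rightarrow> nat \<Rightarrow> nat \<Rightarrow> nat" where
  "slot_degree k d h = (if h \<le> d then k * (d - h) else if h \<le> 2 * d then k * (2 * d - h) else (h - 2 * d - 1) * k)"

definition generic_hyperzout :: "nat \<Rightarrow> nat \<Rightarrow> nat \<times> nat \<times> nat \<Rightarrow> real vec \<Rightarrow> mpoly" where
  "generic_hyperzout m M = (\<lambda>(\<mu>, k, d) x.
     let L = \<lambda>h. generic_form m M (slot_degree k d h) h x
     in \<Sum>i<\<mu>. \<Sum>i'<\<mu>. \<Sum>a\<le>d. \<Sum>b<d. mconst (bez_coeff (d - \<mu> + i) (d - \<mu> + i') a b) *
          ((L a * L (d + 1 + b)) * (L (2 * d + 1 + i) * L (2 * d + 1 + i'))))"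

context
  fixes m y \<mu> k d H M :: nat
  assumes m: "m > 0" and \<mu>: "\<mu> > 0" "\<mu> \<le> d" "d + 3 \<le> 2 * \<mu>" and k: "k > 0"
    and y: "y = (\<mu> - 1) * k"
    and H: "H = 5 * y" and M: "M = card (monomials m (2 * y - 1))"
begin

text \<open>
  The inequality $d \le 2\mu - 3$ gives $2d + 1 + \mu \le 5(\mu - 1) \le 5y$.
\<close>

lemma slot_count: "2 * d + \<mu> < H"
proof -
  have "2 * d + \<mu> < 5 * (\<mu> - 1)" using \<mu> by simp
  also have "\<dots> \<le> H" unfolding H y using k by simp
  finally show ?thesis .
qed

text \<open>
  Every degree is at most $kd \le k(2\mu - 3) = 2y - k$ or at most $y$.
\<close>

lemma slot_degree_bound:
  assumes "h \<le> 2 * d + \<mu>"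
  shows "card (monomials m (slot_degree k d h)) \<le> M"
proof -
  have y0: "y > 0" unfolding y using \<mu> k by auto
  have "k * d + 1 \<le> 2 * y"
  proof -
    have "k * d + k \<le> 2 * y"
    proof -
      have "d + 1 \<le> 2 * (\<mu> - 1)" using \<mu> by simp
      then have "k * (d + 1) \<le> k * (2 * (\<mu> - 1))" by (rule mult_left_mono) simp
      then show ?thesis by (simp add: y mult.commute mult.left_commute)
    qed
    with k show ?thesis by simp
  qed
  then have kd: "k * d \<le> 2 * y - 1" by linarith
  consider "h \<le> d" | "d < h" "h \<le> 2 * d" | "2 * d < h" by linarith
  then have "slot_degree k d h \<le> 2 * y - 1"
  proof cases
    case 1
    have "k * (d - h) \<le> k * d" by (rule mult_left_mono) simp_all
    moreover have "slot_degree k d h = k * (d - h)" using 1 by (simp add: slot_degree_def)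
    ultimately show ?thesis using kd by linarith
  next
    case 2
    have "k * (2 * d - h) \<le> k * d" by (rule mult_left_mono) (use 2 in simp_all)
    moreover have "slot_degree k d h = k * (2 * d - h)" using 2 by (simp add: slot_degree_def)
    ultimately show ?thesis using kd by linarith
  next
    case 3
    have "(h - 2 * d - 1) * k \<le> y" unfolding y by (rule mult_right_mono) (use assms in simp_all)
    moreover have "slot_degree k d h = (h - 2 * d - 1) * k" using 3 by (simp add: slot_degree_def)
    ultimately show ?thesis using y0 by linarith
  qed
  then show ?thesis unfolding M by (rule card_monomials_mono[OF m])
qed

lemma generic_hyperzout_mem: "generic_hyperzout m M (\<mu>, k, d) x \<in> forms (H * M) 4"
proof -
  have L: "generic_form m M (slot_degree k d h) h x \<in> forms (H * M) 1" if "h \<le> 2 * d + \<mu>" for h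
    using slot_count that by (intro generic_form_mem slot_degree_bound) auto
  show ?thesis
    unfolding generic_hyperzout_def Let_def prod.case
    by (intro forms_sum forms_cmult forms_quartic L) auto
qed

lemma hyperzout_in_generic_family:
  assumes d: "d > 0" and p: "p \<in> forms n d" and u: "u \<in> carrier_vec n" and v: "v \<in> carrier_vec n"
    and \<phi>: "\<phi> \<in> form_tuples n m k" and \<xi>: "\<xi> \<in> T_space m d \<mu> k"
    and q: "\<And>x. x \<in> carrier_vec m \<Longrightarrow> mpeval q x = mpeval_tuple \<xi> x \<bullet>
               (par_bezoutian d p u v (mpeval_tuple \<phi> x) *\<^sub>v mpeval_tuple \<xi> x)"
  shows "\<exists>\<theta>. \<forall>x\<in>carrier_vec m. mpeval (generic_hyperzout m M (\<mu>, k, d) x) \<theta> = mpeval q x"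
proof -
  obtain A B where A: "\<And>i. i \<le> d \<Longrightarrow> A i \<in> forms m (k * (d - i))"
    and B: "\<And>i. i < d \<Longrightarrow> B i \<in> forms m (k * (d - 1 - i))"
    and C: "\<And>x j l. j < d \<Longrightarrow> l < d \<Longrightarrow> par_bezoutian d p u v (mpeval_tuple \<phi> x) $$ (j, l)
       = (\<Sum>a\<le>d. \<Sum>b<d. bez_coeff j l a b * mpeval (A a) x * mpeval (B b) x)"
    using par_bezoutian_forms[OF p u v \<phi> d] by blast
  define P where "P = (\<lambda>h. if h \<le> d then A h else if h \<le> 2 * d then B (h - d - 1) else \<xi> $ (d - \<mu> + (h - 2 * d - 1)))"
  have P: "P h \<in> forms m (slot_degree k d h)" if h: "h \<le> 2 * d + \<mu>" for h
  proof -
    consider "h \<le> d" | "d < h" "h \<le> 2 * d" | "2 * d < h" by linarith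
    then show ?thesis
    proof cases
      case 1
      then show ?thesis using A by (simp add: P_def slot_degree_def)
    next
      case 2
      then have "B (h - d - 1) \<in> forms m (k * (d - 1 - (h - d - 1)))" by (intro B) auto
      moreover have "d - 1 - (h - d - 1) = 2 * d - h" using 2 by simp
      ultimately show ?thesis using 2 by (simp add: P_def slot_degree_def)
    next
      case 3
      define i where "i = h - 2 * d - 1"
      have h_eq: "h = 2 * d + 1 + i" and "i < \<mu>" using 3 h by (auto simp: i_def)
      then show ?thesis using \<xi> by (simp add: P_def slot_degree_def T_space_def)
    qed
  qed
  define \<theta> where "\<theta> = vec (H * M) (\<lambda>r. Poly_Mapping.lookup (P (r div M)) (mon_enum m (slot_degree k d (r div M)) (r mod M)))"
  have L: "mpeval (generic_form m M (slot_degree k d h) h x) \<theta> = mpeval (P h) x" if "h \<le> 2 * d + \<mu>" for h x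
    unfolding \<theta>_def using slot_count that by (intro generic_form_specialize P slot_degree_bound) auto
  have PA: "P a = A a" if "a \<le> d" for a using that by (simp add: P_def)
  have PB: "P (d + 1 + b) = B b" if "b < d" for b using that by (simp add: P_def)
  have P\<xi>: "P (2 * d + 1 + i) = \<xi> $ (d - \<mu> + i)" for i by (simp add: P_def)
  have \<xi>c: "\<xi> \<in> carrier_vec d" using \<xi> by (simp add: T_space_def)
  have \<xi>ev: "mpeval_tuple \<xi> x $ j = mpeval (\<xi> $ j) x" if "j < d" for j x
    using that \<xi>c by (simp add: mpeval_tuple_def)
  have \<xi>0: "mpeval_tuple \<xi> x $ j = 0" if "j < d - \<mu>" for j x
    using that \<xi> \<xi>ev[of j x] by (simp add: T_space_def mpeval_def)
  have "mpeval (generic_hyperzout m M (\<mu>, k, d) x) \<theta> = mpeval q x" if x: "x \<in> carrier_vec m" for x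
  proof -
    define z where "z = mpeval_tuple \<phi> x"
    have z: "z \<in> carrier_vec n" using \<phi> by (simp add: z_def mpeval_tuple_def form_tuples_def)
    define F where "F = (\<lambda>j l. par_bezoutian d p u v z $$ (j, l) * mpeval_tuple \<xi> x $ j * mpeval_tuple \<xi> x $ l)"
    have "mpeval q x = (\<Sum>j<d. \<Sum>l<d. F j l)"
      unfolding q[OF x] F_def z_def[symmetric]
      by (rule quadratic_form_eq_sum[OF par_bezoutian_carrier[OF p z u v]]) (use \<xi>c in \<open>simp add: mpeval_tuple_def\<close>)
    also have "\<dots> = (\<Sum>i<\<mu>. \<Sum>l<d. F (d - \<mu> + i) l)"
      by (rule sum_lessThan_last_block) (use \<xi>0 \<mu> in \<open>auto simp: F_def\<close>)
    also have "\<dots> = (\<Sum>i<\<mu>. \<Sum>i'<\<mu>. F (d - \<mu> + i) (d - \<mu> + i'))"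
      by (rule sum.cong[OF refl], rule sum_lessThan_last_block) (use \<xi>0 \<mu> in \<open>auto simp: F_def\<close>)
    also have "\<dots> = (\<Sum>i<\<mu>. \<Sum>i'<\<mu>. \<Sum>a\<le>d. \<Sum>b<d. bez_coeff (d - \<mu> + i) (d - \<mu> + i') a b *
        ((mpeval (P a) x * mpeval (P (d + 1 + b)) x) * (mpeval (P (2 * d + 1 + i)) x * mpeval (P (2 * d + 1 + i')) x)))"
    proof (rule sum.cong[OF refl], rule sum.cong[OF refl])
      fix i i' assume i: "i \<in> {..<\<mu>}" "i' \<in> {..<\<mu>}"
      then have lt: "d - \<mu> + i < d" "d - \<mu> + i' < d" using \<mu> by auto
      show "F (d - \<mu> + i) (d - \<mu> + i') = (\<Sum>a\<le>d. \<Sum>b<d. bez_coeff (d - \<mu> + i) (d - \<mu> + i') a b *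
        ((mpeval (P a) x * mpeval (P (d + 1 + b)) x) * (mpeval (P (2 * d + 1 + i)) x * mpeval (P (2 * d + 1 + i')) x)))"
        unfolding F_def z_def C[OF lt] \<xi>ev[OF lt(1)] \<xi>ev[OF lt(2)] P\<xi> sum_distrib_right
        by (intro sum.cong refl) (simp add: PA PB[simplified] mult.assoc)
    qed
    also have "\<dots> = mpeval (generic_hyperzout m M (\<mu>, k, d) x) \<theta>"
      unfolding generic_hyperzout_def Let_def prod.case mpeval_eq_subst mpeval_simps
      unfolding mpeval_eq_subst[symmetric]
      by (intro sum.cong refl arg_cong2[of _ _ _ _ "(*)"] L[symmetric]) (use \<mu> in auto)
    finally show ?thesis ..
  qed
  then show ?thesis by blast
qed

end

section \<open>A form that is not a degree-restricted hyperzout\<close>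

text \<open>
  The separating form vanishes at points other than the origin, so a small multiple $\delta$ of
  $\sum_i x_i^{2y}$ is added to leave room for perturbations: they stay non-negative as long as they
  are dominated by $\delta \sum_i x_i^{2y}$.  With $\delta$ small enough, the values at the vertices of
  the cube still violate the inequality for hyperzouts of size two.  The forms $r_i$ are the normalised
  Lagrange basis, so that a perturbation changes the values at the lattice points independently.
\<close>

lemma separating_family:
  assumes y: "y \<ge> 2" and m: "m \<ge> y + 2"
  obtains \<eta> :: real and f :: mpoly and r :: "nat \<Rightarrow> mpoly" where "\<eta> > 0" and "f \<in> forms m (2 * y)"
    and "\<forall>i<card (monomials m (2 * y)). r i \<in> forms m (2 * y)"
    and "\<forall>i<card (monomials m (2 * y)). \<forall>j<card (monomials m (2 * y)).
      mpeval (r i) (mon_point m (mon_enum m (2 * y) j)) = (if i = j then 1 else 0)"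
    and "\<forall>w x. (\<forall>i<card (monomials m (2 * y)). \<bar>w i\<bar> \<le> \<eta>) \<longrightarrow>
      0 \<le> mpeval f x + (\<Sum>i<card (monomials m (2 * y)). w i * mpeval (r i) x)"
    and "\<forall>w. (\<forall>i<card (monomials m (2 * y)). \<bar>w i\<bar> \<le> \<eta>) \<longrightarrow>
      2 ^ card (Pow {1..Suc y} - {{1..Suc y}}) * (\<Sum>S\<in>Pow {1..Suc y} - {{1..Suc y}}.
        mpeval f (cube_point m S) + (\<Sum>i<card (monomials m (2 * y)). w i * mpeval (r i) (cube_point m S)))
      < mpeval f (cube_point m {1..Suc y})
        + (\<Sum>i<card (monomials m (2 * y)). w i * mpeval (r i) (cube_point m {1..Suc y}))"
proof -
  define D where "D = card (monomials m (2 * y))"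
  define en where "en = mon_enum m (2 * y)"
  have en: "bij_betw en {..<D} (monomials m (2 * y))" unfolding en_def D_def by (rule bij_betw_mon_enum)
  have en_mem: "en i \<in> monomials m (2 * y)" if "i < D" for i using en that by (auto simp: bij_betw_def)
  have K: "2 * y > 0" "y > 0" using y by auto
  define r where "r = (\<lambda>i. mconst (1 / mpeval (lagrange_form m (2 * y) (en i)) (mon_point m (en i)))
      * lagrange_form m (2 * y) (en i))"
  have r_mem: "r i \<in> forms m (2 * y)" if "i < D" for i
    unfolding r_def by (intro forms_cmult lagrange_form_mem en_mem that)
  have r_ev: "mpeval (r i) (mon_point m (en j)) = (if i = j then 1 else 0)" if "i < D" "j < D" for i j
  proof -
    have eq: "mpeval (r i) (mon_point m (en j)) = 1 / mpeval (lagrange_form m (2 * y) (en i)) (mon_point m (en i))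
      * mpeval (lagrange_form m (2 * y) (en i)) (mon_point m (en j))"
      by (simp add: r_def mpeval_eq_subst mpeval_simps)
    show ?thesis
    proof (cases "i = j")
      case True
      then show ?thesis using lagrange_form_eval_eq[OF en_mem[OF that(1)] K(1)] eq by simp
    next
      case False
      then have "en i \<noteq> en j" using en that by (auto simp: bij_betw_def inj_on_def)
      then show ?thesis using False lagrange_form_eval_neq[OF en_mem[OF that(1)] en_mem[OF that(2)] _ K(1)] eq by simp
    qed
  qed
  define L where "L = (\<lambda>x :: real vec. \<Sum>i<m. (x $ i) ^ (2 * y))"
  have L0: "L x \<ge> 0" for x unfolding L_def by (intro sum_nonneg) (simp add: power_mult)
  define C where "C = (\<Sum>i<D. \<Sum>\<alpha>\<in>monomials m (2 * y). \<bar>Poly_Mapping.lookup (r i) \<alpha>\<bar>)"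
  have C0: "C \<ge> 0" unfolding C_def by (intro sum_nonneg) auto
  let ?c = "card (Pow {1..Suc y} - {{1..Suc y}})"
  \<comment> \<open>$R\delta$ bounds the left-hand side of the inequality, as a perturbed form is at most $2\delta m$ at each of the vertices\<close>
  define R where "R = 2 ^ ?c * real ?c * (2 * real m)"
  have R0: "R \<ge> 0" by (simp add: R_def)
  define \<delta> where "\<delta> = 1 / (R + 1)"
  have \<delta>: "\<delta> > 0" "R * \<delta> < 1" using R0 by (auto simp: \<delta>_def)
  define \<eta> where "\<eta> = \<delta> / (C + 1)"
  have \<eta>: "\<eta> > 0" "\<eta> * C \<le> \<delta>" using \<delta> C0 by (auto simp: \<eta>_def field_simps)
  define f where "f = separating_form y + mconst \<delta> * (\<Sum>i<m. mvar i ^ (2 * y))"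
  have f_ev: "mpeval f x = mpeval (separating_form y) x + \<delta> * L x" for x
    by (simp add: f_def L_def mpeval_eq_subst mpeval_simps)
  have f_mem: "f \<in> forms m (2 * y)"
  proof -
    have "mvar i ^ (2 * y) \<in> forms m (2 * y)" if "i < m" for i
      using forms_power[OF forms_mvar[OF that], of "2 * y"] unfolding mult_1 .
    then show ?thesis unfolding f_def
      by (intro forms_add separating_form_mem forms_cmult forms_sum) (use y m in auto)
  qed
  have pert: "\<bar>\<Sum>i<D. w i * mpeval (r i) x\<bar> \<le> \<delta> * L x" if w: "\<And>i. i < D \<Longrightarrow> \<bar>w i\<bar> \<le> \<eta>" for w x
  proof -
    have "\<bar>\<Sum>i<D. w i * mpeval (r i) x\<bar> \<le> (\<Sum>i<D. \<bar>w i * mpeval (r i) x\<bar>)" by (rule sum_abs)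
    also have "\<dots> \<le> (\<Sum>i<D. \<eta> * ((\<Sum>\<alpha>\<in>monomials m (2 * y). \<bar>Poly_Mapping.lookup (r i) \<alpha>\<bar>) * L x))"
      unfolding abs_mult L_def
      by (intro sum_mono mult_mono form_bound r_mem w) (use K \<eta> in auto)
    also have "\<dots> = \<eta> * C * L x" by (simp add: C_def sum_distrib_left sum_distrib_right mult.assoc)
    also have "\<dots> \<le> \<delta> * L x" by (intro mult_right_mono \<eta> L0)
    finally show ?thesis .
  qed
  show thesis
  proof (rule that[of \<eta> f r, folded D_def en_def])
    show "\<eta> > 0" by (rule \<eta>(1))
    show "f \<in> forms m (2 * y)" by (rule f_mem)
    show "\<forall>i<D. r i \<in> forms m (2 * y)" using r_mem by blast
    show "\<forall>i<D. \<forall>j<D. mpeval (r i) (mon_point m (en j)) = (if i = j then 1 else 0)"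
      using r_ev by blast
  next
    show "\<forall>w x. (\<forall>i<D. \<bar>w i\<bar> \<le> \<eta>) \<longrightarrow> 0 \<le> mpeval f x + (\<Sum>i<D. w i * mpeval (r i) x)"
    proof (intro allI impI)
      fix w x assume "\<forall>i<D. \<bar>w i\<bar> \<le> \<eta>"
      then have w: "\<And>i. i < D \<Longrightarrow> \<bar>w i\<bar> \<le> \<eta>" by blast
      have "\<bar>\<Sum>i<D. w i * mpeval (r i) x\<bar> \<le> \<delta> * L x" by (rule pert) (rule w)
      then show "0 \<le> mpeval f x + (\<Sum>i<D. w i * mpeval (r i) x)"
        using separating_form_nonneg[of y x] unfolding f_ev by linarith
    qed
  next
    show "\<forall>w. (\<forall>i<D. \<bar>w i\<bar> \<le> \<eta>) \<longrightarrow>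
      2 ^ ?c * (\<Sum>S\<in>Pow {1..Suc y} - {{1..Suc y}}.
        mpeval f (cube_point m S) + (\<Sum>i<D. w i * mpeval (r i) (cube_point m S)))
      < mpeval f (cube_point m {1..Suc y}) + (\<Sum>i<D. w i * mpeval (r i) (cube_point m {1..Suc y}))"
    proof (intro allI impI)
      fix w assume "\<forall>i<D. \<bar>w i\<bar> \<le> \<eta>"
      then have w: "\<And>i. i < D \<Longrightarrow> \<bar>w i\<bar> \<le> \<eta>" by blast
      have up: "mpeval f (cube_point m S) + (\<Sum>i<D. w i * mpeval (r i) (cube_point m S)) \<le> 2 * (\<delta> * real m)"
        if "S \<in> Pow {1..Suc y} - {{1..Suc y}}" for S
      proof -
        have "L (cube_point m S) \<le> (\<Sum>i<m. 1)"
          unfolding L_def by (intro sum_mono) (auto simp: cube_point_def power_0_left)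
        then have "\<delta> * L (cube_point m S) \<le> \<delta> * real m" using \<delta>(1) by (intro mult_left_mono) auto
        moreover have "mpeval (separating_form y) (cube_point m S) = 0"
          using that by (intro separating_form_cube(2) m y) auto
        moreover have "\<bar>\<Sum>i<D. w i * mpeval (r i) (cube_point m S)\<bar> \<le> \<delta> * L (cube_point m S)"
          by (rule pert) (rule w)
        ultimately show ?thesis unfolding f_ev by linarith
      qed
      have "2 ^ ?c * (\<Sum>S\<in>Pow {1..Suc y} - {{1..Suc y}}.
          mpeval f (cube_point m S) + (\<Sum>i<D. w i * mpeval (r i) (cube_point m S)))
        \<le> 2 ^ ?c * (\<Sum>S\<in>Pow {1..Suc y} - {{1..Suc y}}. 2 * (\<delta> * real m))"
        by (intro mult_left_mono sum_mono up) auto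
      also have "\<dots> = R * \<delta>" by (simp add: R_def)
      also have "\<dots> < 16" using \<delta>(2) by simp
      finally have lt: "2 ^ ?c * (\<Sum>S\<in>Pow {1..Suc y} - {{1..Suc y}}.
          mpeval f (cube_point m S) + (\<Sum>i<D. w i * mpeval (r i) (cube_point m S))) < 16" .
      have "\<bar>\<Sum>i<D. w i * mpeval (r i) (cube_point m {1..Suc y})\<bar> \<le> \<delta> * L (cube_point m {1..Suc y})"
        by (rule pert) (rule w)
      then have "16 \<le> mpeval f (cube_point m {1..Suc y}) + (\<Sum>i<D. w i * mpeval (r i) (cube_point m {1..Suc y}))"
        using separating_form_cube(1)[OF m y] unfolding f_ev by linarith
      with lt show "2 ^ ?c * (\<Sum>S\<in>Pow {1..Suc y} - {{1..Suc y}}.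
          mpeval f (cube_point m S) + (\<Sum>i<D. w i * mpeval (r i) (cube_point m S)))
        < mpeval f (cube_point m {1..Suc y}) + (\<Sum>i<D. w i * mpeval (r i) (cube_point m {1..Suc y}))"
        by (rule less_le_trans)
    qed
  qed
qed

theorem theorem5p12:
  fixes m y :: nat
  assumes "m > 0" and "y > 1"
    and "int m > 10 * (int y)^2 - 2 * int y + 1"
  shows "\<exists>q \<in> forms m (2 * y). nonneg_form m q \<and> \<not> degree_restricted_hyperzout m y q"
proof -
  have y: "y \<ge> 2" using assms(2) by simp
  have m: "m \<ge> y + 2"
  proof -
    have "int y * 2 \<le> int y * int y" using y by (intro mult_left_mono) auto
    then have "int m > 20 * int y - 2 * int y + 1" using assms(3) by (simp add: power2_eq_square)
    then show ?thesis using y by linarith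
  qed
  define D where "D = card (monomials m (2 * y))"
  define M where "M = card (monomials m (2 * y - 1))"
  define H where "H = 5 * y"
  have HM: "H * M < D"
    unfolding H_def M_def D_def by (rule card_monomials_gap) (use assms in auto)
  define pt where "pt = (\<lambda>i. mon_point m (mon_enum m (2 * y) i))"
  obtain \<eta> f r where \<eta>: "\<eta> > 0" and f: "f \<in> forms m (2 * y)"
    and r: "\<forall>i<D. r i \<in> forms m (2 * y)"
    and r_pt: "\<forall>i<D. \<forall>j<D. mpeval (r i) (mon_point m (mon_enum m (2 * y) j)) = (if i = j then 1 else 0)"
    and nonneg: "\<forall>w x. (\<forall>i<D. \<bar>w i\<bar> \<le> \<eta>) \<longrightarrow> 0 \<le> mpeval f x + (\<Sum>i<D. w i * mpeval (r i) x)"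
    and sep: "\<forall>w. (\<forall>i<D. \<bar>w i\<bar> \<le> \<eta>) \<longrightarrow>
      2 ^ card (Pow {1..Suc y} - {{1..Suc y}}) * (\<Sum>S\<in>Pow {1..Suc y} - {{1..Suc y}}.
        mpeval f (cube_point m S) + (\<Sum>i<D. w i * mpeval (r i) (cube_point m S)))
      < mpeval f (cube_point m {1..Suc y}) + (\<Sum>i<D. w i * mpeval (r i) (cube_point m {1..Suc y}))"
    by (rule separating_family[OF y m, folded D_def]) (rule that)
  define J where "J = {(\<mu>, k, d). \<mu> > 0 \<and> \<mu> \<le> d \<and> d + 3 \<le> 2 * \<mu> \<and> k > 0 \<and> y = (\<mu> - 1) * k}"
  have "J \<subseteq> {..y + 1} \<times> {..y} \<times> {..2 * y + 2}"
  proof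
    fix j assume "j \<in> J"
    then obtain \<mu> k d where j: "j = (\<mu>, k, d)" and \<mu>: "\<mu> > 0" "\<mu> \<le> d" "d + 3 \<le> 2 * \<mu>"
      and k: "k > 0" and yk: "y = (\<mu> - 1) * k"
      by (auto simp: J_def)
    have "(\<mu> - 1) * 1 \<le> (\<mu> - 1) * k" using k by (intro mult_left_mono) auto
    moreover have "1 * k \<le> (\<mu> - 1) * k" using \<mu> by (intro mult_right_mono) auto
    ultimately have "\<mu> - 1 \<le> y" "k \<le> y" unfolding yk[symmetric] by simp_all
    then show "j \<in> {..y + 1} \<times> {..y} \<times> {..2 * y + 2}"
      using \<mu> unfolding j by auto
  qed
  then have J: "finite J" by (rule finite_subset) auto
  have "\<exists>W. (\<forall>i<D. W i \<in> {mpeval f (pt i)<..<mpeval f (pt i) + \<eta>}) \<and>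
      (\<forall>j\<in>J. \<forall>\<theta>. \<exists>i<D. mpeval (generic_hyperzout m M j (pt i)) \<theta> \<noteq> W i)"
  proof (rule polynomial_maps_miss_point[OF J HM])
    fix j i assume "j \<in> J"
    then obtain \<mu> k d where "j = (\<mu>, k, d)" "\<mu> > 0" "\<mu> \<le> d" "d + 3 \<le> 2 * \<mu>" "k > 0" "y = (\<mu> - 1) * k"
      by (auto simp: J_def)
    then show "generic_hyperzout m M j (pt i) \<in> forms (H * M) 4"
      using generic_hyperzout_mem[OF assms(1)] H_def M_def by blast
  qed (use \<eta> in \<open>simp add: infinite_Ioo\<close>)
  then obtain W where W: "\<And>i. i < D \<Longrightarrow> W i \<in> {mpeval f (pt i)<..<mpeval f (pt i) + \<eta>}"
    and miss: "\<And>j \<theta>. j \<in> J \<Longrightarrow> \<exists>i<D. mpeval (generic_hyperzout m M j (pt i)) \<theta> \<noteq> W i"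
    by blast
  define w where "w = (\<lambda>i. W i - mpeval f (pt i))"
  have w: "\<forall>i<D. \<bar>w i\<bar> \<le> \<eta>"
  proof (intro allI impI)
    fix i assume "i < D"
    from W[OF this] show "\<bar>w i\<bar> \<le> \<eta>" by (simp add: w_def)
  qed
  define q where "q = f + (\<Sum>i<D. mconst (w i) * r i)"
  have q_ev: "mpeval q x = mpeval f x + (\<Sum>i<D. w i * mpeval (r i) x)" for x
    by (simp add: q_def mpeval_eq_subst mpeval_simps)
  have q_pt: "mpeval q (pt j) = W j" if "j < D" for j
  proof -
    have "(\<Sum>i<D. w i * mpeval (r i) (pt j)) = (\<Sum>i<D. if i = j then w j else 0)"
      by (intro sum.cong refl) (use r_pt that in \<open>auto simp: pt_def\<close>)
    also have "\<dots> = w j" using that by simp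
    finally show ?thesis unfolding q_ev by (simp add: w_def)
  qed
  have "\<not> degree_restricted_hyperzout m y q"
  proof
    assume "degree_restricted_hyperzout m y q"
    then obtain \<mu> k n d e p u v \<phi> \<xi> where \<mu>: "\<mu> > 0" "\<mu> \<le> d" "\<mu> = 2 \<or> d + 3 \<le> 2 * \<mu>"
      and k: "k > 0" and yk: "y = (\<mu> - 1) * k" and d: "d > 0"
      and e: "e \<in> carrier_vec n" and p: "p \<in> Hyp n d e" and u: "u \<in> hyp_cone n p e"
      and v: "v \<in> hyp_cone n p e" and \<phi>: "\<phi> \<in> form_tuples n m k" and \<xi>: "\<xi> \<in> T_space m d \<mu> k"
      and q: "\<And>x. x \<in> carrier_vec m \<Longrightarrow> mpeval q x = mpeval_tuple \<xi> x \<bullet>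
               (par_bezoutian d p u v (mpeval_tuple \<phi> x) *\<^sub>v mpeval_tuple \<xi> x)"
      unfolding degree_restricted_hyperzout_def by blast
    show False
    proof (cases "\<mu> = 2")
      case True
      then have ky: "k = y" using yk by simp
      have "mpeval q (cube_point m {1..Suc y}) \<le> 2 ^ card (Pow {1..Suc y} - {{1..Suc y}})
          * (\<Sum>S\<in>Pow {1..Suc y} - {{1..Suc y}}. mpeval q (cube_point m S))"
      proof (rule hyperzout_size_two_bound[OF p e u v _ _ _ q])
        show "\<phi> \<in> form_tuples n m y" "\<xi> \<in> T_space m d 2 y" "2 \<le> d" using \<phi> \<xi> \<mu> True ky by auto
        show "(- 1) ^ (y + card S) = (1 :: real) \<or> (- 1) ^ (y + card S) = (- 1 :: real)" for S :: "nat set"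
          by (cases "even (y + card S)") auto
        show "mpeval h (cube_point m {1..Suc y}) = (\<Sum>S\<in>Pow {1..Suc y} - {{1..Suc y}}.
            (- 1) ^ (y + card S) * mpeval h (cube_point m S))" if "h \<in> forms m y" for h
          by (rule cube_vertex_relation[OF that])
      qed (auto simp: cube_point_def)
      moreover note sep[THEN spec, THEN mp, OF w]
      ultimately show False unfolding q_ev by simp
    next
      case False
      then have dm: "d + 3 \<le> 2 * \<mu>" using \<mu> by simp
      have pf: "p \<in> forms n d" and uc: "u \<in> carrier_vec n" and vc: "v \<in> carrier_vec n"
        using p u v by (auto simp: Hyp_def hyp_cone_def)
      obtain \<theta> where "\<And>x. x \<in> carrier_vec m \<Longrightarrow> mpeval (generic_hyperzout m M (\<mu>, k, d) x) \<theta> = mpeval q x"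
        using hyperzout_in_generic_family[OF assms(1) \<mu>(1,2) dm k yk H_def M_def d pf uc vc \<phi> \<xi> q] by blast
      then have "mpeval (generic_hyperzout m M (\<mu>, k, d) (pt i)) \<theta> = W i" if "i < D" for i
        using q_pt[OF that] by (simp add: pt_def)
      moreover have "(\<mu>, k, d) \<in> J" using \<mu> dm k yk by (simp add: J_def)
      ultimately show False using miss by blast
    qed
  qed
  moreover have "q \<in> forms m (2 * y)"
    unfolding q_def by (intro forms_add f forms_sum forms_cmult) (use r in auto)
  moreover have "nonneg_form m q"
    using nonneg w by (simp add: nonneg_form_def q_ev)
  ultimately show ?thesis by blast
qed

end
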